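(* For every simply-laced type $X_N$ ($X=A,D,E$) and every $i=1,\dots,N$, the Kac--Wakimoto coefficient $a_i$ is given by $$a_i=h^{-1}\prod_{k=1}^{h-1}\big(1-\eta^k\big)^{(\alpha_i\,|\,M^k\alpha_i)},\qquad\eta=e^{2\pi\sqrt{-1}/h}.$$
   Context: Let $\mathfrak g$ be the simple Lie algebra over $\mathbb C$ of type $X_N$, $X=A,D,E$, with Cartan subalgebra $\mathfrak h$, root spaces $\mathfrak g_\alpha$, and invariant form $(\cdot|\cdot)$ normalized by $(\alpha|\alpha)=2$ for all roots. Let $M$ be a Coxeter transformation, $h$ the Coxeter number (order of $M$), $\eta=e^{2\pi i/h}$, $m_1\le\dots\le m_N$ the Coxeter exponents ($\eta^{m_a}$ are the eigenvalues of $M$). The roots form $N$ orbits of $M$ of cardinality $h$; fix representatives $\alpha_1,\dots,\alpha_N$. Let $H_1,\dots,H_N$ be a basis of $\mathfrak h$ with $MH_a=\eta^{m_a}H_a$, $(H_a|H_b)=h\,\delta_{a+b,N+1}$. Let $E_+=\{(a,n):1\le a\le N,\ n\in\mathbb Z_{\ge0}\}$; by abuse of notation write $m\in E_+$ for $m=m_a+nh$, $a(m)=a$, and $a(-m)=N+1-a(m)$ (so $-m\equiv m_{a(-m)}\bmod h$). Let $\widehat{\mathfrak g}=\mathfrak g[t,t^{-1}]\oplus\mathbb CK\oplus\mathbb Cd$ with $[Xt^n,Yt^m]=[X,Y]t^{n+m}+n\delta_{n,-m}(X|Y)K$, $[d,Xt^n]=nXt^n$, $K$ central. Extend $M$ in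 the standard way to a finite order inner automorphism of $\mathfrak g$ with $M\mathfrak g_\alpha=\mathfrak g_{M\alpha}$, and pick $0\ne A_\alpha\in\mathfrak g_\alpha$ forming an $M$-invariant set of vectors. Extend $M$ to $\widehat{\mathfrak g}$ by $M(Xt^m)=(MX)(\eta^{-1}t)^m$, $MK=K$, $Md=d$, and let $\widehat{\mathfrak g}^M$ be the invariant subalgebra. Put $H_{i,m}=h^{-1}\sum_{k=1}^hM^k(H_it^m)$, $A_{\pm\alpha_i,m}=h^{-1}\sum_{k=1}^hM^k(A_{\pm\alpha_i}t^m)$. On the Fock space $\mathbb C[y_m\,|\,m\in E_+]$ the Heisenberg algebra $\mathfrak h[t,t^{-1}]^M\oplus\mathbb CK$ acts by $K\mapsto1/h$, $H_{a(m),m}\mapsto\partial/\partial y_m$, $H_{a(-m),-m}\mapsto m\,y_m$; it is known that this extends uniquely to the level 1 basic representation of $\widehat{\mathfrak g}^M$ (principal realization). Put $x_{\pm\alpha_i}(\zeta)=\sum_{m\in\mathbb Z}A_{\pm\alpha_i,m}\zeta^{-m}$ and $$\Gamma^{\pm\alpha_i}(\zeta)=\exp\Big(\pm\sum_{m\in E_+}\alpha_i(H_{a(m)})y_m\zeta^m\Big)\exp\Big(\mp\sum_{m\in E_+}\alpha_i(H_{a(-m)})\partial_{y_m}\frac{\zeta^{-m}}m\Big).$$ It is known that $x_{\pm\alpha_i}(\zeta)$ acts as a constant (independent of $\zeta$) multiple of $\Gamma^{\pm\alpha_i}(\zeta)$. The Kac--Wakimoto coefficient $a_i$ is defined by $$\frac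 h{(A_{\alpha_i}|A_{-\alpha_i})}\,x_{\alpha_i}(\zeta)\otimes x_{-\alpha_i}(\zeta)=a_i\,\Gamma^{\alpha_i}(\zeta)\otimes\Gamma^{-\alpha_i}(\zeta).$$ *)

theory Defs
  imports "HOL-Analysis.Analysis" "HOL-Library.Poly_Mapping"
begin

section \<open>Complex Lie algebras\<close>

locale lie_algebra = vector_space scale
  for scale :: "complex \<Rightarrow> 'g::ab_group_add \<Rightarrow> 'g" +
  fixes bracket :: "'g \<Rightarrow> 'g \<Rightarrow> 'g"
  assumes bracket_add_left: "bracket (x + y) z = bracket x z + bracket y z"
    and bracket_add_right: "bracket x (y + z) = bracket x y + bracket x z"
    and bracket_scale_left: "bracket (scale c x) y = scale c (bracket x y)"
    and bracket_scale_right: "bracket x (scale c y) = scale c (bracket x y)"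
    and bracket_self: "bracket x x = 0"
    and jacobi: "bracket x (bracket y z) + bracket y (bracket z x) + bracket z (bracket x y) = 0"
begin

definition ideal :: "'g set \<Rightarrow> bool" where
  "ideal I \<longleftrightarrow> subspace I \<and> (\<forall>x. \<forall>y\<in>I. bracket x y \<in> I)"

definition fin_dim :: bool where
  "fin_dim \<longleftrightarrow> (\<exists>B. finite B \<and> span B = UNIV)"

definition simple :: bool where
  "simple \<longleftrightarrow> (\<exists>x y. bracket x y \<noteq> 0) \<and> (\<forall>I. ideal I \<longrightarrow> I = {0} \<or> I = UNIV)"

definition ad_diagonalizable :: "'g \<Rightarrow> bool" where
  "ad_diagonalizable x \<longleftrightarrow> span {y. \<exists>c. bracket x y = scale c y} = UNIV"

text \<open>For a semisimple algebra: a toral subalgebra which is its own centralizer.\<close>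

definition cartan_subalgebra :: "'g set \<Rightarrow> bool" where
  "cartan_subalgebra \<hh> \<longleftrightarrow> subspace \<hh>
     \<and> (\<forall>x\<in>\<hh>. \<forall>y\<in>\<hh>. bracket x y = 0)
     \<and> (\<forall>x\<in>\<hh>. ad_diagonalizable x)
     \<and> (\<forall>x. (\<forall>y\<in>\<hh>. bracket y x = 0) \<longrightarrow> x \<in> \<hh>)"

definition invariant_form :: "('g \<Rightarrow> 'g \<Rightarrow> complex) \<Rightarrow> bool" where
  "invariant_form form \<longleftrightarrow>
     (\<forall>x y z. form (x + y) z = form x z + form y z)
     \<and> (\<forall>c x y. form (scale c x) y = c * form x y)
     \<and> (\<forall>x y. form x y = form y x)
     \<and> (\<forall>x y z. form (bracket x y) z = form x (bracket y z))
     \<and> (\<forall>x. (\<forall>y. form x y = 0) \<longrightarrow> x = 0)"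

text \<open>An element of the dual of \<open>\<hh>\<close> is a function that is linear on \<open>\<hh>\<close> and, to make
  it unique, zero outside \<open>\<hh>\<close>.\<close>

definition dual_space :: "'g set \<Rightarrow> ('g \<Rightarrow> complex) set" where
  "dual_space \<hh> = {\<gamma>. (\<forall>x\<in>\<hh>. \<forall>y\<in>\<hh>. \<gamma> (x + y) = \<gamma> x + \<gamma> y)
     \<and> (\<forall>c. \<forall>x\<in>\<hh>. \<gamma> (scale c x) = c * \<gamma> x) \<and> (\<forall>x. x \<notin> \<hh> \<longrightarrow> \<gamma> x = 0)}"

definition root_space :: "'g set \<Rightarrow> ('g \<Rightarrow> complex) \<Rightarrow> 'g set" where
  "root_space \<hh> \<gamma> = {x. \<forall>y\<in>\<hh>. bracket y x = scale (\<gamma> y) x}"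

definition roots :: "'g set \<Rightarrow> ('g \<Rightarrow> complex) set" where
  "roots \<hh> = {\<gamma>\<in>dual_space \<hh>. \<gamma> \<noteq> (\<lambda>_. 0) \<and> root_space \<hh> \<gamma> \<noteq> {0}}"

text \<open>\<open>\<beta> 1, \<dots>, \<beta> N\<close> are the simple roots for some choice of positive roots.\<close>

definition root_base :: "'g set \<Rightarrow> nat \<Rightarrow> (nat \<Rightarrow> 'g \<Rightarrow> complex) \<Rightarrow> bool" where
  "root_base \<hh> N \<beta> \<longleftrightarrow>
     (\<forall>j\<in>{1..N}. \<beta> j \<in> roots \<hh>)
     \<and> (\<forall>c :: nat \<Rightarrow> complex. (\<forall>x. (\<Sum>j=1..N. c j * \<beta> j x) = 0) \<longrightarrow> (\<forall>j\<in>{1..N}. c j = 0))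
     \<and> (\<forall>\<gamma>\<in>roots \<hh>. \<exists>c :: nat \<Rightarrow> nat.
           (\<forall>x. \<gamma> x = (\<Sum>j=1..N. of_nat (c j) * \<beta> j x))
         \<or> (\<forall>x. \<gamma> x = - (\<Sum>j=1..N. of_nat (c j) * \<beta> j x)))"

definition automorphism :: "('g \<Rightarrow> 'g) \<Rightarrow> bool" where
  "automorphism f \<longleftrightarrow> bij f \<and> (\<forall>x y. f (x + y) = f x + f y)
     \<and> (\<forall>c x. f (scale c x) = scale c (f x)) \<and> (\<forall>x y. f (bracket x y) = bracket (f x) (f y))"

definition ad_nilpotent :: "'g \<Rightarrow> bool" where
  "ad_nilpotent x \<longleftrightarrow> (\<exists>n. \<forall>y. (bracket x ^^ n) y = 0)"

definition exp_ad :: "'g \<Rightarrow> 'g \<Rightarrow> 'g" where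
  "exp_ad x y = Sum_any (\<lambda>r. scale (1 / fact r) ((bracket x ^^ r) y))"

text \<open>The inverse of \<open>exp_ad x\<close> is \<open>exp_ad (- x)\<close>, so this is a group.\<close>

inductive inner_automorphism :: "('g \<Rightarrow> 'g) \<Rightarrow> bool" where
  inner_id: "inner_automorphism id"
| inner_exp: "inner_automorphism f \<Longrightarrow> ad_nilpotent x \<Longrightarrow> inner_automorphism (exp_ad x \<circ> f)"

end

text \<open>The form on the dual of \<open>\<hh>\<close> induced by the identification
  \<open>\<gamma> \<leftrightarrow> dual_vec form \<hh> \<gamma>\<close>. For a simply laced algebra it takes integer values on pairs of roots, so for
  \<open>z \<noteq> 0\<close> the expression \<open>z powr dual_form form \<hh> \<gamma> \<delta>\<close> is an ordinary integer power.\<close>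

definition dual_vec :: "('g \<Rightarrow> 'g \<Rightarrow> complex) \<Rightarrow> 'g set \<Rightarrow> ('g \<Rightarrow> complex) \<Rightarrow> 'g" where
  "dual_vec form \<hh> \<gamma> = (THE t. t \<in> \<hh> \<and> (\<forall>x\<in>\<hh>. form t x = \<gamma> x))"

definition dual_form ::
    "('g \<Rightarrow> 'g \<Rightarrow> complex) \<Rightarrow> 'g set \<Rightarrow> ('g \<Rightarrow> complex) \<Rightarrow> ('g \<Rightarrow> complex) \<Rightarrow> complex" where
  "dual_form form \<hh> \<gamma> \<delta> = form (dual_vec form \<hh> \<gamma>) (dual_vec form \<hh> \<delta>)"

definition dual_action :: "'g set \<Rightarrow> ('g \<Rightarrow> 'g) \<Rightarrow> ('g \<Rightarrow> complex) \<Rightarrow> 'g \<Rightarrow> complex" where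
  "dual_action \<hh> M \<gamma> = (\<lambda>x. if x \<in> \<hh> then \<gamma> (inv_into \<hh> M x) else 0)"

definition order_on :: "'g set \<Rightarrow> ('g \<Rightarrow> 'g) \<Rightarrow> nat" where
  "order_on \<hh> M = (LEAST n. 0 < n \<and> (\<forall>x\<in>\<hh>. (M ^^ n) x = x))"

section \<open>Simply laced types\<close>

datatype ade = TypeA | TypeD | TypeE

fun ade_valid :: "ade \<Rightarrow> nat \<Rightarrow> bool" where
  "ade_valid TypeA N \<longleftrightarrow> 1 \<le> N"
| "ade_valid TypeD N \<longleftrightarrow> 4 \<le> N"
| "ade_valid TypeE N \<longleftrightarrow> N \<in> {6, 7, 8}"

text \<open>Edges \<open>i < j\<close> of the Dynkin diagrams on \<open>{1..N}\<close>, in the labelling of Bourbaki.\<close>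

fun dynkin_edge :: "ade \<Rightarrow> nat \<Rightarrow> nat \<Rightarrow> nat \<Rightarrow> bool" where
  "dynkin_edge TypeA N i j \<longleftrightarrow> j = i + 1"
| "dynkin_edge TypeD N i j \<longleftrightarrow> (j = i + 1 \<and> j < N) \<or> (i + 2 = N \<and> j = N)"
| "dynkin_edge TypeE N i j \<longleftrightarrow> (i, j) = (1, 3) \<or> (i, j) = (2, 4) \<or> (3 \<le> i \<and> j = i + 1)"

definition cartan_matrix :: "ade \<Rightarrow> nat \<Rightarrow> nat \<Rightarrow> nat \<Rightarrow> int" where
  "cartan_matrix X N i j =
     (if i = j then 2 else if dynkin_edge X N i j \<or> dynkin_edge X N j i then - 1 else 0)"

locale ade_lie_algebra = lie_algebra scale bracket
  for scale :: "complex \<Rightarrow> 'g::ab_group_add \<Rightarrow> 'g" and bracket +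
  fixes X :: ade and N :: nat and \<hh> :: "'g set" and form :: "'g \<Rightarrow> 'g \<Rightarrow> complex"
  assumes fin_dim: "fin_dim" and simple: "simple"
    and cartan: "cartan_subalgebra \<hh>"
    and form: "invariant_form form"
    and normalized: "\<gamma> \<in> roots \<hh> \<Longrightarrow> dual_form form \<hh> \<gamma> \<gamma> = 2"
    and valid: "ade_valid X N"
    and type: "\<exists>\<beta>. root_base \<hh> N \<beta> \<and> (\<forall>i\<in>{1..N}. \<forall>j\<in>{1..N}.
        2 * dual_form form \<hh> (\<beta> i) (\<beta> j) / dual_form form \<hh> (\<beta> j) (\<beta> j)
          = of_int (cartan_matrix X N i j))"
begin

definition reflection :: "('g \<Rightarrow> complex) \<Rightarrow> 'g \<Rightarrow> 'g" where
  "reflection \<gamma> x = x - scale (2 * \<gamma> x / dual_form form \<hh> \<gamma> \<gamma>) (dual_vec form \<hh> \<gamma>)"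

text \<open>The order of the factors is arbitrary because the indexing of the base is.\<close>

definition coxeter_transformation :: "('g \<Rightarrow> 'g) \<Rightarrow> bool" where
  "coxeter_transformation M \<longleftrightarrow>
     (\<exists>\<beta>. root_base \<hh> N \<beta> \<and> (\<forall>x\<in>\<hh>. M x = foldr (\<lambda>j. reflection (\<beta> j)) [1..<N+1] x))"

end

section \<open>Affine algebra\<close>

text \<open>\<open>(f, a, b)\<close> stands for \<open>(\<Sum>n. f\<^sub>n t\<^sup>n) + a K + b d\<close>.\<close>

type_synonym 'g affine = "(int \<Rightarrow>\<^sub>0 'g) \<times> complex \<times> complex"

definition loop_elem :: "'g::ab_group_add \<Rightarrow> int \<Rightarrow> 'g affine" where
  "loop_elem x n = (Poly_Mapping.single n x, 0, 0)"

definition central_K :: "'g::ab_group_add affine" where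
  "central_K = (0, 1, 0)"

context ade_lie_algebra
begin

fun affine_scale :: "complex \<Rightarrow> 'g affine \<Rightarrow> 'g affine" where
  "affine_scale c (f, a, b) = (Poly_Mapping.map (scale c) f, c * a, c * b)"

fun affine_bracket :: "'g affine \<Rightarrow> 'g affine \<Rightarrow> 'g affine" where
  "affine_bracket (f, a, b) (g, a', b') =
     ((\<Sum>n\<in>Poly_Mapping.keys f. \<Sum>m\<in>Poly_Mapping.keys g.
          Poly_Mapping.single (n + m) (bracket (Poly_Mapping.lookup f n) (Poly_Mapping.lookup g m)))
        + Poly_Mapping.mapp (\<lambda>m. scale (b * of_int m)) g
        - Poly_Mapping.mapp (\<lambda>n. scale (b' * of_int n)) f,
      \<Sum>n\<in>Poly_Mapping.keys f.
        of_int n * form (Poly_Mapping.lookup f n) (Poly_Mapping.lookup g (- n)),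
      0)"

end

section \<open>Fock space\<close>

text \<open>Polynomials in \<open>y\<^sub>v\<close>, \<open>v = (a, n)\<close>; monomials are finitely supported exponent functions.\<close>

type_synonym fock = "((nat \<times> nat) \<Rightarrow>\<^sub>0 nat) \<Rightarrow>\<^sub>0 complex"

definition E_plus :: "nat \<Rightarrow> (nat \<times> nat) set" where
  "E_plus N = {1..N} \<times> UNIV"

definition fock_space :: "nat \<Rightarrow> fock set" where
  "fock_space N = {p. \<forall>s\<in>Poly_Mapping.keys p. Poly_Mapping.keys s \<subseteq> E_plus N}"

definition pscale :: "complex \<Rightarrow> ('m \<Rightarrow>\<^sub>0 complex) \<Rightarrow> ('m \<Rightarrow>\<^sub>0 complex)" where
  "pscale c p = Poly_Mapping.map ((*) c) p"

definition yvar :: "nat \<times> nat \<Rightarrow> fock" where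
  "yvar v = Poly_Mapping.single (Poly_Mapping.single v 1) 1"

definition partial :: "nat \<times> nat \<Rightarrow> fock \<Rightarrow> fock" where
  "partial v p = (\<Sum>s\<in>Poly_Mapping.keys p.
     Poly_Mapping.single (s - Poly_Mapping.single v 1)
       (of_nat (Poly_Mapping.lookup s v) * Poly_Mapping.lookup p s))"

text \<open>The tensor square of the polynomials has the pairs of monomials as a basis.\<close>

definition tensor :: "('m \<Rightarrow>\<^sub>0 complex) \<Rightarrow> ('m \<Rightarrow>\<^sub>0 complex) \<Rightarrow> ('m \<times> 'm \<Rightarrow>\<^sub>0 complex)" where
  "tensor p q = (\<Sum>s\<in>Poly_Mapping.keys p. \<Sum>t\<in>Poly_Mapping.keys q.
     Poly_Mapping.single (s, t) (Poly_Mapping.lookup p s * Poly_Mapping.lookup q t))"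

text \<open>\<open>op_pow S r j\<close> is the coefficient of \<open>z\<^sup>j\<close> in \<open>(\<Sum>i. S\<^sub>i z\<^sup>i)\<^sup>r\<close>. If \<open>S\<^sub>0 = 0\<close>, it
  vanishes for \<open>r > j\<close>, so the sum in \<open>op_exp\<close> is the full exponential series.\<close>

fun op_pow :: "(nat \<Rightarrow> fock \<Rightarrow> fock) \<Rightarrow> nat \<Rightarrow> nat \<Rightarrow> fock \<Rightarrow> fock" where
  "op_pow S 0 j p = (if j = 0 then p else 0)"
| "op_pow S (Suc r) j p = (\<Sum>i\<le>j. S i (op_pow S r (j - i) p))"

definition op_exp :: "(nat \<Rightarrow> fock \<Rightarrow> fock) \<Rightarrow> nat \<Rightarrow> fock \<Rightarrow> fock" where
  "op_exp S j p = (\<Sum>r\<le>j. pscale (1 / fact r) (op_pow S r j p))"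

text \<open>\<open>series_tensor U V n p q\<close> is the coefficient of \<open>\<zeta>\<^sup>n\<close> in \<open>U(\<zeta>) p \<otimes> V(\<zeta>) q\<close>. The sum is finite
  when \<open>U(\<zeta>) p\<close> and \<open>V(\<zeta>) q\<close> have only finitely many negative powers of \<open>\<zeta>\<close>.\<close>

definition series_tensor ::
    "(int \<Rightarrow> fock \<Rightarrow> fock) \<Rightarrow> (int \<Rightarrow> fock \<Rightarrow> fock) \<Rightarrow> int \<Rightarrow> fock \<Rightarrow> fock
      \<Rightarrow> (((nat \<times> nat) \<Rightarrow>\<^sub>0 nat) \<times> ((nat \<times> nat) \<Rightarrow>\<^sub>0 nat)) \<Rightarrow>\<^sub>0 complex" where
  "series_tensor U V n p q = Sum_any (\<lambda>i. tensor (U i p) (V (n - i) q))"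

section \<open>Principal realization\<close>

locale coxeter_setup = ade_lie_algebra scale bracket X N \<hh> form
  for scale :: "complex \<Rightarrow> 'g::ab_group_add \<Rightarrow> 'g" and bracket and X and N and \<hh> and form +
  fixes M :: "'g \<Rightarrow> 'g"                          \<comment> \<open>extended to the whole algebra\<close>
    and m :: "nat \<Rightarrow> nat"
    and \<alpha> :: "nat \<Rightarrow> 'g \<Rightarrow> complex"
    and H :: "nat \<Rightarrow> 'g"
    and Av :: "('g \<Rightarrow> complex) \<Rightarrow> 'g"            \<comment> \<open>the root vectors\<close>
  assumes coxeter: "coxeter_transformation M"
    and aut: "automorphism M" and inner: "inner_automorphism M"
    and finite_order: "\<exists>r>0. M ^^ r = id"
    and root_space_image: "\<gamma> \<in> roots \<hh> \<Longrightarrow> M ` root_space \<hh> \<gamma> = root_space \<hh> (dual_action \<hh> M \<gamma>)"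
    and exponents: "a \<in> {1..N} \<Longrightarrow> 0 < m a \<and> m a < order_on \<hh> M" "mono_on {1..N} m"
    and orbits: "bij_betw (\<lambda>(i, k). (dual_action \<hh> M ^^ k) (\<alpha> i))
        ({1..N} \<times> {..<order_on \<hh> M}) (roots \<hh>)"
    and H_basis: "inj_on H {1..N}" "independent (H ` {1..N})" "span (H ` {1..N}) = \<hh>"
    and H_eigen: "a \<in> {1..N} \<Longrightarrow> M (H a) = scale (cis (2 * pi / of_nat (order_on \<hh> M)) ^ m a) (H a)"
    and H_form: "a \<in> {1..N} \<Longrightarrow> b \<in> {1..N} \<Longrightarrow>
        form (H a) (H b) = (if a + b = N + 1 then of_nat (order_on \<hh> M) else 0)"
    and Av_root: "\<gamma> \<in> roots \<hh> \<Longrightarrow> Av \<gamma> \<in> root_space \<hh> \<gamma> \<and> Av \<gamma> \<noteq> 0"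
    and Av_invariant: "M ` Av ` roots \<hh> = Av ` roots \<hh>"
begin

abbreviation cox :: nat where "cox \<equiv> order_on \<hh> M"

definition eta :: complex where "eta = cis (2 * pi / of_nat cox)"

fun M_affine :: "'g affine \<Rightarrow> 'g affine" where
  "M_affine (f, a, b) = (Poly_Mapping.mapp (\<lambda>n x. scale (eta powi (- n)) (M x)) f, a, b)"

definition invariants :: "'g affine set" where
  "invariants = {x. M_affine x = x}"

text \<open>Gives \<open>H\<^sub>i\<^sub>,\<^sub>n\<close> and \<open>A\<^sub>\<gamma>\<^sub>,\<^sub>n\<close> for \<open>x = H i\<close> and \<open>x = Av \<gamma>\<close>.\<close>

definition average :: "'g \<Rightarrow> int \<Rightarrow> 'g affine" where
  "average x n = affine_scale (1 / of_nat cox) (\<Sum>k=1..cox. (M_affine ^^ k) (loop_elem x n))"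

text \<open>The integer denoted by an element of \<open>E_plus N\<close>.\<close>

definition weight :: "nat \<times> nat \<Rightarrow> nat" where
  "weight v = m (fst v) + snd v * cox"

text \<open>Coefficients of \<open>\<zeta>\<^sup>j\<close> and of \<open>\<zeta>\<^sup>-\<^sup>j\<close> in the exponents of the vertex operator.\<close>

definition creation :: "('g \<Rightarrow> complex) \<Rightarrow> nat \<Rightarrow> fock \<Rightarrow> fock" where
  "creation \<gamma> j p = (\<Sum>v\<in>{v\<in>E_plus N. weight v = j}. pscale (\<gamma> (H (fst v))) (yvar v * p))"

definition annihilation :: "('g \<Rightarrow> complex) \<Rightarrow> nat \<Rightarrow> fock \<Rightarrow> fock" where
  "annihilation \<gamma> j p = (\<Sum>v\<in>{v\<in>E_plus N. weight v = j}.
     pscale (- \<gamma> (H (N + 1 - fst v)) / of_nat (weight v)) (partial v p))"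

text \<open>The coefficient of \<open>\<zeta>\<^sup>n\<close> in the vertex operator; \<open>op_exp (annihilation \<gamma>) k p\<close> vanishes for
  large \<open>k\<close>. The two signs of the vertex operator are \<open>\<gamma> = \<alpha> i\<close> and \<open>\<gamma> = - \<alpha> i\<close>.\<close>

definition Gam :: "('g \<Rightarrow> complex) \<Rightarrow> int \<Rightarrow> fock \<Rightarrow> fock" where
  "Gam \<gamma> n p = Sum_any (\<lambda>k :: nat. if 0 \<le> n + int k
     then op_exp (creation \<gamma>) (nat (n + int k)) (op_exp (annihilation \<gamma>) k p) else 0)"

text \<open>The coefficient of \<open>\<zeta>\<^sup>n\<close> in the action of \<open>x\<^sub>\<gamma>(\<zeta>)\<close> under \<open>\<rho>\<close>.\<close>

definition x_series :: "('g affine \<Rightarrow> fock \<Rightarrow> fock) \<Rightarrow> ('g \<Rightarrow> complex) \<Rightarrow> int \<Rightarrow> fock \<Rightarrow> fock" where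
  "x_series \<rho> \<gamma> n = \<rho> (average (Av \<gamma>) (- n))"

definition kac_wakimoto_coeff :: "('g affine \<Rightarrow> fock \<Rightarrow> fock) \<Rightarrow> nat \<Rightarrow> complex \<Rightarrow> bool" where
  "kac_wakimoto_coeff \<rho> i a \<longleftrightarrow> (\<forall>n. \<forall>p\<in>fock_space N. \<forall>q\<in>fock_space N.
     pscale (of_nat cox / form (Av (\<alpha> i)) (Av (\<lambda>x. - \<alpha> i x)))
       (series_tensor (x_series \<rho> (\<alpha> i)) (x_series \<rho> (\<lambda>x. - \<alpha> i x)) n p q)
     = pscale a (series_tensor (Gam (\<alpha> i)) (Gam (\<lambda>x. - \<alpha> i x)) n p q))"

end

text \<open>A representation \<open>\<rho>\<close> of the invariant subalgebra on the Fock space, extending the given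
  action of the Heisenberg algebra.\<close>

locale principal_realization = coxeter_setup scale bracket X N \<hh> form M m \<alpha> H Av
  for scale :: "complex \<Rightarrow> 'g::ab_group_add \<Rightarrow> 'g" and bracket and X and N and \<hh> and form
    and M and m and \<alpha> and H and Av +
  fixes \<rho> :: "'g affine \<Rightarrow> fock \<Rightarrow> fock"
  assumes rho_closed: "x \<in> invariants \<Longrightarrow> p \<in> fock_space N \<Longrightarrow> \<rho> x p \<in> fock_space N"
    and rho_add: "x \<in> invariants \<Longrightarrow> p \<in> fock_space N \<Longrightarrow> q \<in> fock_space N
        \<Longrightarrow> \<rho> x (p + q) = \<rho> x p + \<rho> x q"
    and rho_scale: "x \<in> invariants \<Longrightarrow> p \<in> fock_space N \<Longrightarrow> \<rho> x (pscale c p) = pscale c (\<rho> x p)"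
    and rho_add_left: "x \<in> invariants \<Longrightarrow> y \<in> invariants \<Longrightarrow> p \<in> fock_space N
        \<Longrightarrow> \<rho> (x + y) p = \<rho> x p + \<rho> y p"
    and rho_scale_left: "x \<in> invariants \<Longrightarrow> p \<in> fock_space N
        \<Longrightarrow> \<rho> (affine_scale c x) p = pscale c (\<rho> x p)"
    and rho_bracket: "x \<in> invariants \<Longrightarrow> y \<in> invariants \<Longrightarrow> p \<in> fock_space N
        \<Longrightarrow> \<rho> (affine_bracket x y) p = \<rho> x (\<rho> y p) - \<rho> y (\<rho> x p)"
    and rho_K: "p \<in> fock_space N \<Longrightarrow> \<rho> central_K p = pscale (1 / of_nat cox) p"
    and rho_annihilation: "v \<in> E_plus N \<Longrightarrow> p \<in> fock_space N
        \<Longrightarrow> \<rho> (average (H (fst v)) (int (weight v))) p = partial v p"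
    and rho_creation: "v \<in> E_plus N \<Longrightarrow> p \<in> fock_space N
        \<Longrightarrow> \<rho> (average (H (N + 1 - fst v)) (- int (weight v))) p
            = pscale (of_nat (weight v)) (yvar v * p)"

end

theory Submission
  imports Defs
begin

text \<open>Write \<open>x\<^sub>\<gamma>(\<zeta>)\<close> for the current of a root \<open>\<gamma>\<close> in the representation and \<open>\<Gamma>\<^sup>\<gamma>(\<zeta>)\<close> for the vertex operator.
  Bracketing \<open>x\<^sub>\<gamma>(\<zeta>)\<close> with the Heisenberg algebra gives the same exchange relations with the
  multiplications by \<open>y\<^sub>v\<close> and with the derivatives \<open>\<partial>\<^sub>v\<close> as \<open>\<Gamma>\<^sup>\<gamma>(\<zeta>)\<close> satisfies. These
  relations determine a series of operators up to a scalar Laurent series in \<open>\<zeta>\<close>, and the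
  derivation \<open>d\<close>, which measures the degree of a polynomial, cuts this down to a constant
  (\<open>vertex_family_unique\<close>, \<open>wave_vertex_family\<close>, \<open>Gam_vertex_family\<close>). So
  \<open>x\<^sub>\<plusminus>\<^sub>\<alpha>(\<zeta>) = c\<^sub>\<plusminus> \<Gamma>\<^sup>\<plusminus>\<^sup>\<alpha>(\<zeta>)\<close> with constants \<open>c\<^sub>\<plusminus>\<close>, and the Kac--Wakimoto coefficient is
  \<open>h c\<^sub>+ c\<^sub>- / (A\<^sub>\<alpha> | A\<^sub>-\<^sub>\<alpha>)\<close>.

  The product \<open>c\<^sub>+ c\<^sub>-\<close> comes from evaluating in two ways the vacuum expectation \<open>F(k)\<close> of the
  coefficient of \<open>\<zeta>\<^sup>-\<^sup>k\<close> in \<open>x\<^sub>\<alpha>(\<zeta>)\<close> times the coefficient of \<open>\<zeta>\<^sup>k\<close> in \<open>x\<^sub>-\<^sub>\<alpha>(\<zeta>)\<close>. First, the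
  exchange relations yield a recursion for \<open>F\<close> (\<open>two_point_recursion\<close>, \<open>weight_sum_eq\<close>) which says
  that \<open>\<Sum>\<^sub>k F(k) z\<^sup>k = c\<^sub>+ c\<^sub>- \<Prod>\<^sub>k (1 - \<eta>\<^sup>k z) powr - (\<alpha> | M\<^sup>k \<alpha>)\<close>, the product being over \<open>0 \<le> k < h\<close>;
  the factor \<open>k = 0\<close> is a double pole at \<open>z = 1\<close>. Secondly, for \<open>k > 0\<close> the first factor kills
  the vacuum, so \<open>F(k)\<close> is the expectation of a commutator. By the bracket of the affine algebra
  this is periodic in \<open>k\<close> with period \<open>h\<close>, except for the central term, which contributes
  \<open>k (A\<^sub>\<alpha> | A\<^sub>-\<^sub>\<alpha>) / h\<^sup>2\<close> (\<open>two_point_linear_plus_periodic\<close>). Comparing the coefficients of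
  \<open>(1 - z)\<^sup>-\<^sup>2\<close> as \<open>z\<close> tends to \<open>1\<close> gives \<open>(A\<^sub>\<alpha> | A\<^sub>-\<^sub>\<alpha>) / h\<^sup>2 = c\<^sub>+ c\<^sub>- \<Prod>\<^sub>k (1 - \<eta>\<^sup>k) powr - (\<alpha> | M\<^sup>k \<alpha>)\<close>, now
  with \<open>0 < k < h\<close> (\<open>slope_eq_product\<close>, \<open>vacuum_value_product\<close>).

  The same identity holds with any vectors of the two root spaces that are fixed by \<open>M\<^sup>h\<close> in place
  of \<open>A\<^sub>\<alpha>\<close> and \<open>A\<^sub>-\<^sub>\<alpha>\<close>. Hence \<open>c\<^sub>+\<close> and \<open>c\<^sub>-\<close> do not vanish, because each of \<open>A\<^sub>\<alpha>\<close> and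
  \<open>A\<^sub>-\<^sub>\<alpha>\<close> pairs nontrivially with some such vector (\<open>fixed_opposite_root_vector\<close>), and therefore
  \<open>(A\<^sub>\<alpha> | A\<^sub>-\<^sub>\<alpha>) \<noteq> 0\<close>.\<close>

section \<open>Polynomials in the Fock space\<close>

lemma lookup_pscale [simp]:
  "Poly_Mapping.lookup (pscale c p) s = c * Poly_Mapping.lookup p s"
  by (simp add: pscale_def Poly_Mapping.map.rep_eq when_def)

interpretation pscale: vector_space pscale
  by standard (auto intro!: poly_mapping_eqI simp: lookup_add algebra_simps)

lemma mult_pscale_right: "(p :: fock) * pscale c q = pscale c (p * q)"
  by (simp add: pscale_def mult_map_scale_conv_mult ac_simps)

lemma lookup_single_mult:
  fixes s :: "'m \<Rightarrow>\<^sub>0 nat" and p :: "('m \<Rightarrow>\<^sub>0 nat) \<Rightarrow>\<^sub>0 complex"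
  shows "Poly_Mapping.lookup (Poly_Mapping.single t c * p) s =
    (if \<exists>u. s = t + u then c * Poly_Mapping.lookup p (s - t) else 0)"
proof -
  have "Poly_Mapping.lookup (Poly_Mapping.single t c * p) s =
     (\<Sum>l. Poly_Mapping.lookup (Poly_Mapping.single t c) l * (\<Sum>q. Poly_Mapping.lookup p q when s = l + q))"
    by (simp add: lookup_mult)
  also have "\<dots> = (\<Sum>l. (c * (\<Sum>q. Poly_Mapping.lookup p q when s = t + q)) when t = l)"
    by (intro Sum_any.cong) (auto simp: lookup_single when_def)
  also have "\<dots> = c * (\<Sum>q. Poly_Mapping.lookup p q when s = t + q)"
    by simp
  also have "\<dots> = (if \<exists>u. s = t + u then c * Poly_Mapping.lookup p (s - t) else 0)"
  proof (cases "\<exists>u. s = t + u")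
    case True
    then obtain u where u: "s = t + u" by blast
    have "(\<Sum>q. Poly_Mapping.lookup p q when s = t + q) = (\<Sum>q. Poly_Mapping.lookup p q when u = q)"
      by (intro Sum_any.cong) (auto simp: u when_def)
    then show ?thesis by (auto simp: u)
  next
    case False
    then have "(\<Sum>q. Poly_Mapping.lookup p q when s = t + q) = (\<Sum>q::'m \<Rightarrow>\<^sub>0 nat. 0)"
      by (intro Sum_any.cong) (auto simp: when_def)
    with False show ?thesis by simp
  qed
  finally show ?thesis .
qed

lemma add_single_diff_single:
  fixes s :: "'m \<Rightarrow>\<^sub>0 nat"
  assumes "Poly_Mapping.lookup s v > 0"
  shows "s - Poly_Mapping.single v 1 + Poly_Mapping.single v 1 = s"
  using assms by (intro poly_mapping_eqI) (auto simp: lookup_add lookup_minus lookup_single when_def)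

lemma lookup_yvar_mult:
  "Poly_Mapping.lookup (yvar v * p) s = (if Poly_Mapping.lookup s v = 0 then 0
     else Poly_Mapping.lookup p (s - Poly_Mapping.single v 1))"
proof -
  have "(\<exists>u. s = Poly_Mapping.single v 1 + u) \<longleftrightarrow> Poly_Mapping.lookup s v \<noteq> 0"
  proof
    assume "Poly_Mapping.lookup s v \<noteq> 0"
    then have "s = Poly_Mapping.single v 1 + (s - Poly_Mapping.single v 1)"
      using add_single_diff_single[of s v] by (simp add: add.commute)
    then show "\<exists>u. s = Poly_Mapping.single v 1 + u" by blast
  qed (auto simp: lookup_add)
  then show ?thesis by (simp add: yvar_def lookup_single_mult)
qed

lemma lookup_partial:
  "Poly_Mapping.lookup (partial v p) s =
     of_nat (Poly_Mapping.lookup s v + 1) * Poly_Mapping.lookup p (s + Poly_Mapping.single v 1)"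
proof -
  let ?e = "Poly_Mapping.single v (1::nat)"
  let ?f = "\<lambda>t. of_nat (Poly_Mapping.lookup t v) * Poly_Mapping.lookup p t :: complex"
  have *: "t - ?e = s \<longleftrightarrow> t = s + ?e" if "?f t \<noteq> 0" for t
  proof -
    have "Poly_Mapping.lookup t v > 0" using that by auto
    from add_single_diff_single[OF this] show ?thesis by auto
  qed
  have "Poly_Mapping.lookup (partial v p) s =
     (\<Sum>t\<in>Poly_Mapping.keys p. ?f t when t - ?e = s)"
    by (simp add: partial_def lookup_sum lookup_single)
  also have "\<dots> = (\<Sum>t\<in>Poly_Mapping.keys p. if t = s + ?e then ?f t else 0)"
    unfolding when_def using * by (intro sum.cong refl) fastforce
  also have "\<dots> = ?f (s + ?e)"
    by (auto simp: in_keys_iff)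
  finally show ?thesis by (simp add: lookup_add)
qed

lemma partial_add: "partial v (p + q) = partial v p + partial v q"
  by (rule poly_mapping_eqI) (simp add: lookup_partial lookup_add algebra_simps)

lemma partial_pscale: "partial v (pscale c p) = pscale c (partial v p)"
  by (rule poly_mapping_eqI) (simp add: lookup_partial)

lemma partial_diff: "partial v (p - q) = partial v p - partial v q"
  by (rule poly_mapping_eqI) (simp add: lookup_partial lookup_minus algebra_simps)

lemma partial_zero [simp]: "partial v 0 = 0"
  by (simp add: partial_def)

lemma partial_sum: "partial v (sum f A) = (\<Sum>x\<in>A. partial v (f x))"
  by (induction A rule: infinite_finite_induct) (auto simp: partial_add)

lemma add_single_neq_zero: "s + Poly_Mapping.single v (1::nat) \<noteq> 0"
  by (metis lookup_add lookup_single_eq lookup_zero add_is_0 zero_neq_one)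

lemma partial_one [simp]: "partial v 1 = 0"
  by (rule poly_mapping_eqI) (simp add: lookup_partial lookup_one add_single_neq_zero[unfolded One_nat_def])

lemma partial_commute: "partial u (partial v p) = partial v (partial u p)"
  by (rule poly_mapping_eqI) (simp add: lookup_partial lookup_add lookup_single when_def ac_simps)

lemma partial_yvar_mult:
  "partial u (yvar v * p) = yvar v * partial u p + (if u = v then p else 0)"
proof (rule poly_mapping_eqI)
  fix s
  show "Poly_Mapping.lookup (partial u (yvar v * p)) s =
     Poly_Mapping.lookup (yvar v * partial u p + (if u = v then p else 0)) s"
  proof (cases "Poly_Mapping.lookup s v = 0")
    case True
    then show ?thesis
      by (auto simp: lookup_partial lookup_yvar_mult lookup_add lookup_single)
  next
    case False
    then have *: "s - Poly_Mapping.single v 1 + Poly_Mapping.single v 1 = s"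
      by (intro add_single_diff_single) auto
    show ?thesis
    proof (cases "u = v")
      case True
      then show ?thesis using False *
        by (auto simp: lookup_partial lookup_yvar_mult lookup_add lookup_single lookup_minus ring_distribs of_nat_diff)
    next
      case ne: False
      have "s + Poly_Mapping.single u 1 - Poly_Mapping.single v 1 =
            s - Poly_Mapping.single v 1 + Poly_Mapping.single u 1"
        using False ne
        by (intro poly_mapping_eqI) (auto simp: lookup_add lookup_minus lookup_single when_def)
      then show ?thesis using False ne
        by (auto simp: lookup_partial lookup_yvar_mult lookup_add lookup_single lookup_minus when_def)
    qed
  qed
qed

lemma const_coeff_yvar_mult [simp]: "Poly_Mapping.lookup (yvar v * p) 0 = 0"
  by (simp add: lookup_yvar_mult)

lemma monomial_induct [case_names zero add]:
  fixes s :: "'m \<Rightarrow>\<^sub>0 nat"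
  assumes zero: "P 0" and add: "\<And>s v. P s \<Longrightarrow> P (s + Poly_Mapping.single v 1)"
  shows "P s"
proof (induction s rule: update_induct)
  case const
  show ?case by (rule zero)
next
  case (update f a b)
  have *: "Poly_Mapping.update a b f = f + Poly_Mapping.single a b"
    using update(1) by (intro poly_mapping_eqI)
      (auto simp: lookup_update lookup_add lookup_single when_def in_keys_iff)
  have "P (f + Poly_Mapping.single a n)" for n
  proof (induction n)
    case 0
    then show ?case using update by simp
  next
    case (Suc n)
    have "f + Poly_Mapping.single a (Suc n) = f + Poly_Mapping.single a n + Poly_Mapping.single a 1"
      by (simp add: add.assoc flip: single_add)
    then show ?case using add[OF Suc] by simp
  qed
  then show ?case by (simp add: *)
qed

subsection \<open>The subspace spanned by the admissible monomials\<close>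

lemma fock_space_iff:
  "p \<in> fock_space N \<longleftrightarrow>
     (\<forall>s. Poly_Mapping.lookup p s \<noteq> 0 \<longrightarrow> (\<forall>v. Poly_Mapping.lookup s v \<noteq> 0 \<longrightarrow> v \<in> E_plus N))"
  by (auto simp: fock_space_def in_keys_iff subset_iff)

lemma fock_space_zero [simp]: "0 \<in> fock_space N"
  by (simp add: fock_space_iff)

lemma fock_space_one [simp]: "1 \<in> fock_space N"
  by (simp add: fock_space_iff lookup_one when_def)

lemma fock_space_add [intro]: "p \<in> fock_space N \<Longrightarrow> q \<in> fock_space N \<Longrightarrow> p + q \<in> fock_space N"
  unfolding fock_space_iff lookup_add by (metis add_0)

lemma fock_space_pscale [intro]: "p \<in> fock_space N \<Longrightarrow> pscale c p \<in> fock_space N"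
  by (auto simp: fock_space_iff)

lemma fock_space_diff [intro]: "p \<in> fock_space N \<Longrightarrow> q \<in> fock_space N \<Longrightarrow> p - q \<in> fock_space N"
  unfolding fock_space_iff lookup_minus by (metis diff_self)

lemma fock_space_sum [intro]: "(\<And>x. x \<in> A \<Longrightarrow> f x \<in> fock_space N) \<Longrightarrow> sum f A \<in> fock_space N"
  by (induction A rule: infinite_finite_induct) auto

lemma fock_space_partial [intro]:
  assumes "p \<in> fock_space N"
  shows "partial v p \<in> fock_space N"
  using assms unfolding fock_space_iff lookup_partial
  by (metis add_is_0 lookup_add mult_not_zero)

lemma fock_space_yvar_mult [intro]:
  assumes "p \<in> fock_space N" "v \<in> E_plus N"
  shows "yvar v * p \<in> fock_space N"
  unfolding fock_space_iff
proof (intro allI impI)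
  fix s u
  assume s: "Poly_Mapping.lookup (yvar v * p) s \<noteq> 0" and u: "Poly_Mapping.lookup s u \<noteq> 0"
  then have "Poly_Mapping.lookup p (s - Poly_Mapping.single v 1) \<noteq> 0"
    by (auto simp: lookup_yvar_mult split: if_splits)
  then show "u \<in> E_plus N"
    using assms u unfolding fock_space_iff
    by (cases "u = v") (simp, metis diff_zero lookup_minus lookup_single_not_eq)
qed

lemma fock_space_induct [consumes 1, case_names one add scale mult]:
  assumes "p \<in> fock_space N"
    and one: "P 1"
    and add: "\<And>p q. p \<in> fock_space N \<Longrightarrow> q \<in> fock_space N \<Longrightarrow> P p \<Longrightarrow> P q \<Longrightarrow> P (p + q)"
    and scale: "\<And>p c. p \<in> fock_space N \<Longrightarrow> P p \<Longrightarrow> P (pscale c p)"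
    and mult: "\<And>p v. p \<in> fock_space N \<Longrightarrow> v \<in> E_plus N \<Longrightarrow> P p \<Longrightarrow> P (yvar v * p)"
  shows "P p"
proof -
  have zero: "P 0" using scale[OF fock_space_one one, of 0] by simp
  have monomial: "Poly_Mapping.keys s \<subseteq> E_plus N \<Longrightarrow>
      Poly_Mapping.single s 1 \<in> fock_space N \<and> P (Poly_Mapping.single s 1)" for s
  proof (induction s rule: monomial_induct)
    case zero
    then show ?case using one by simp
  next
    case (add s v)
    have "u \<in> E_plus N" if "Poly_Mapping.lookup (s + Poly_Mapping.single v 1) u \<noteq> 0" for u
      using add.prems that by (auto simp: in_keys_iff)
    then have *: "Poly_Mapping.keys s \<subseteq> E_plus N" "v \<in> E_plus N"
      by (auto simp: in_keys_iff lookup_add)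
    have eq: "Poly_Mapping.single (s + Poly_Mapping.single v 1) 1 = yvar v * Poly_Mapping.single s 1"
      by (simp add: yvar_def mult_single add.commute)
    show ?case using add.IH[OF *(1)] *(2) mult unfolding eq by auto
  qed
  have single: "Poly_Mapping.single s c \<in> fock_space N \<and> P (Poly_Mapping.single s c)"
    if "Poly_Mapping.keys s \<subseteq> E_plus N" for s c
  proof -
    have "Poly_Mapping.single s c = pscale c (Poly_Mapping.single s 1)"
      by (rule poly_mapping_eqI) (simp add: lookup_single when_def)
    then show ?thesis using monomial[OF that] scale by auto
  qed
  show ?thesis using assms(1)
  proof (induction p rule: update_induct)
    case const
    show ?case by (rule zero)
  next
    case (update f a b)
    have eq: "Poly_Mapping.update a b f = f + Poly_Mapping.single a b"
      using update(1) by (intro poly_mapping_eqI)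
        (auto simp: lookup_update lookup_add lookup_single when_def in_keys_iff)
    have f: "f \<in> fock_space N"
      using update(1,2,4) unfolding fock_space_def
      by (auto simp: in_keys_iff lookup_update split: if_splits)
    have "Poly_Mapping.keys a \<subseteq> E_plus N"
      using update(1,2,4) unfolding fock_space_def
      by (auto simp: in_keys_iff lookup_update split: if_splits)
    then show ?case using single[of a b] update(3) f add unfolding eq by auto
  qed
qed

text \<open>Every coefficient of \<open>p\<close> is, up to a positive factor, the constant coefficient of an iterated
  derivative of \<open>p\<close>. The set \<open>S\<close> collects these derivatives, so the induction over the monomial has to
  run over all elements of \<open>S\<close> at once.\<close>

lemma fock_zero_if_derivatives_vanish_at_zero:
  assumes fock: "\<And>p. p \<in> S \<Longrightarrow> p \<in> fock_space N"
    and const: "\<And>p. p \<in> S \<Longrightarrow> Poly_Mapping.lookup p 0 = 0"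
    and closed: "\<And>p v. p \<in> S \<Longrightarrow> v \<in> E_plus N \<Longrightarrow> \<exists>c. \<exists>q\<in>S. partial v p = pscale c q"
    and "p \<in> S"
  shows "p = 0"
proof (rule poly_mapping_eqI)
  fix s
  have "\<forall>p\<in>S. Poly_Mapping.lookup p s = 0"
  proof (induction s rule: monomial_induct)
    case zero
    show ?case using const by auto
  next
    case (add s v)
    show ?case
    proof
      fix p assume p: "p \<in> S"
      show "Poly_Mapping.lookup p (s + Poly_Mapping.single v 1) = 0"
      proof (cases "v \<in> E_plus N")
        case True
        then have "Poly_Mapping.lookup (partial v p) s = 0" using add closed[OF p True] by auto
        then show ?thesis by (simp add: lookup_partial del: of_nat_add of_nat_Suc)
      next
        case False
        then show ?thesis using fock[OF p] unfolding fock_space_iff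
          by (metis add_is_0 lookup_add lookup_single_eq zero_neq_one)
      qed
    qed
  qed
  then show "Poly_Mapping.lookup p s = Poly_Mapping.lookup 0 s" using \<open>p \<in> S\<close> by simp
qed

section \<open>Vertex families\<close>

locale graded_fock =
  fixes N :: nat and w :: "nat \<times> nat \<Rightarrow> nat"
  assumes weight_pos: "v \<in> E_plus N \<Longrightarrow> 0 < w v"
    and finite_weight_le: "finite {v \<in> E_plus N. w v \<le> k}"

text \<open>Series \<open>X(\<zeta>) = \<Sum>\<^sub>n X\<^sub>n \<zeta>\<^sup>n\<close> of operators with \<open>[\<partial>\<^sub>v, X(\<zeta>)] = c\<^sub>v \<zeta>\<^sup>w X(\<zeta>)\<close> and
  \<open>[y\<^sub>v, X(\<zeta>)] = d\<^sub>v \<zeta>\<^sup>-\<^sup>w X(\<zeta>)\<close> for \<open>w = w(v)\<close>. These relations survive multiplication by a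
  Laurent series in \<open>\<zeta>\<close>; the condition \<open>vacuum\<close> leaves only the constants.\<close>

locale vertex_family = graded_fock +
  fixes c d :: "nat \<times> nat \<Rightarrow> complex" and X :: "int \<Rightarrow> fock \<Rightarrow> fock"
  assumes closed [intro]: "p \<in> fock_space N \<Longrightarrow> X n p \<in> fock_space N"
    and add: "p \<in> fock_space N \<Longrightarrow> q \<in> fock_space N \<Longrightarrow> X n (p + q) = X n p + X n q"
    and scale: "p \<in> fock_space N \<Longrightarrow> X n (pscale k p) = pscale k (X n p)"
    and partial_commutator: "v \<in> E_plus N \<Longrightarrow> p \<in> fock_space N \<Longrightarrow>
          partial v (X n p) = X n (partial v p) + pscale (c v) (X (n - int (w v)) p)"
    and yvar_commutator: "v \<in> E_plus N \<Longrightarrow> p \<in> fock_space N \<Longrightarrow>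
          X n (yvar v * p) = yvar v * X n p - pscale (d v) (X (n + int (w v)) p)"
    and vacuum: "n \<noteq> 0 \<Longrightarrow> Poly_Mapping.lookup (X n 1) 0 = 0"
begin

lemma zero [simp]: "X n 0 = 0"
  using scale[of 0 n 0] by simp

lemma sum: "(\<And>x. x \<in> A \<Longrightarrow> f x \<in> fock_space N) \<Longrightarrow> X n (sum f A) = (\<Sum>x\<in>A. X n (f x))"
  by (induction A rule: infinite_finite_induct) (auto simp: add fock_space_sum)

lemma partial_vacuum: "v \<in> E_plus N \<Longrightarrow> partial v (X n 1) = pscale (c v) (X (n - int (w v)) 1)"
  by (simp add: partial_commutator)

text \<open>The derivatives of \<open>X\<^sub>n 1\<close> are multiples of vectors \<open>X\<^sub>k 1\<close> with \<open>k < n\<close>, so the index never reaches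
  \<open>0\<close> and all their constant coefficients vanish.\<close>

lemma negative_vacuum:
  assumes "n < 0"
  shows "X n 1 = 0"
proof -
  let ?S = "{X n 1 | n. n < 0}"
  show ?thesis
  proof (rule fock_zero_if_derivatives_vanish_at_zero[where S = ?S and N = N])
    fix p v assume "p \<in> ?S" "v \<in> E_plus N"
    then obtain n where p: "p = X n 1" "n < 0" by auto
    then have "X (n - int (w v)) 1 \<in> ?S" by force
    then show "\<exists>k. \<exists>q\<in>?S. partial v p = pscale k q"
      using \<open>v \<in> E_plus N\<close> p(1) partial_vacuum by blast
  qed (use assms vacuum in \<open>auto intro!: closed\<close>)
qed

end

text \<open>The derivatives determine both families on the vacuum, and the exchange with \<open>y\<^sub>v\<close> carries the
  comparison from there to all polynomials.\<close>

theorem vertex_family_unique: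
  assumes "vertex_family N w c d X" "vertex_family N w c d Y"
    and Y: "Poly_Mapping.lookup (Y 0 1) 0 = 1" and "p \<in> fock_space N"
  shows "X n p = pscale (Poly_Mapping.lookup (X 0 1) 0) (Y n p)"
proof -
  interpret X: vertex_family N w c d X by fact
  interpret Y: vertex_family N w c d Y by fact
  define k where "k = Poly_Mapping.lookup (X 0 1) 0"
  define R where "R = (\<lambda>n. X n 1 - pscale k (Y n 1))"
  have const: "Poly_Mapping.lookup (R n) 0 = 0" for n
    using X.vacuum[of n] Y.vacuum[of n] Y by (cases "n = 0") (auto simp: R_def k_def lookup_minus)
  have "R n = 0" for n
  proof (rule fock_zero_if_derivatives_vanish_at_zero[where S = "range R" and N = N])
    fix p v assume "p \<in> range R" "v \<in> E_plus N"
    then obtain n where p: "p = R n" by auto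
    have "partial v p = pscale (c v) (R (n - int (w v)))"
      using \<open>v \<in> E_plus N\<close>
      by (simp add: p R_def partial_pscale partial_diff X.partial_vacuum Y.partial_vacuum
        pscale.scale_right_diff_distrib mult.commute)
    then show "\<exists>k. \<exists>q\<in>range R. partial v p = pscale k q" by blast
  next
    show "p \<in> fock_space N" if "p \<in> range R" for p
      using that by (auto intro!: X.closed Y.closed fock_space_pscale fock_space_diff simp: R_def)
  qed (use const in auto)
  then have vac: "X n 1 = pscale k (Y n 1)" for n
    by (simp add: R_def)
  have "\<forall>n. X n p = pscale k (Y n p)"
    using \<open>p \<in> fock_space N\<close>
  proof (induction p rule: fock_space_induct)
    case one
    then show ?case using vac by simp
  next
    case (add p q)
    then show ?case by (simp add: X.add Y.add pscale.scale_right_distrib)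
  next
    case (scale p c)
    then show ?case by (simp add: X.scale Y.scale mult.commute)
  next
    case (mult p v)
    then show ?case
      by (simp add: X.yvar_commutator Y.yvar_commutator mult_pscale_right
        pscale.scale_right_diff_distrib mult.commute[of k])
  qed
  then show ?thesis by (simp add: k_def)
qed

text \<open>The vector \<open>Y\<^sub>k 1\<close> is homogeneous of weight \<open>k\<close>, so Euler's identity expresses \<open>k Y\<^sub>k 1\<close> through the
  vectors \<open>y\<^sub>v Y\<^sub>k\<^sub>-\<^sub>w 1\<close> with \<open>w = w(v)\<close>. After moving \<open>X\<^sub>-\<^sub>k\<close> past \<open>y\<^sub>v\<close> the term that still has
  \<open>y\<^sub>v\<close> in front has no constant coefficient.\<close>

theorem two_point_recursion:
  assumes "vertex_family N w c d X" "vertex_family N w c' d' Y"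
  defines "F \<equiv> \<lambda>k :: nat. Poly_Mapping.lookup (X (- int k) (Y (int k) 1)) 0"
  shows "of_nat k * F k =
    (\<Sum>j=1..k. - (\<Sum>v | v \<in> E_plus N \<and> w v = j. of_nat j * c' v * d v) * F (k - j))"
proof -
  interpret X: vertex_family N w c d X by fact
  interpret Y: vertex_family N w c' d' Y by fact
  define V where "V = (\<lambda>n. {v \<in> E_plus N. int (w v) \<le> n})"
  have fin: "finite (V n)" for n
    by (rule finite_subset[OF _ X.finite_weight_le[of "nat n"]]) (auto simp: V_def)
  \<comment> \<open>\<open>Z n\<close> is the defect in Euler's identity for \<open>Y n 1\<close>; its derivatives are again such defects.\<close>
  define T where "T = (\<lambda>n v. pscale (of_nat (w v) * c' v) (yvar v * Y (n - int (w v)) 1))"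
  define Z where "Z = (\<lambda>n. pscale (of_int n) (Y n 1) - (\<Sum>v\<in>V n. T n v))"
  have T_fock: "v \<in> E_plus N \<Longrightarrow> T n v \<in> fock_space N" for n v
    unfolding T_def by (intro fock_space_pscale fock_space_yvar_mult Y.closed fock_space_one)
  have partial_Z: "partial u (Z n) = pscale (c' u) (Z (n - int (w u)))" if u: "u \<in> E_plus N" for u n
  proof -
    let ?n = "n - int (w u)"
    have "partial u (\<Sum>v\<in>V n. T n v) =
       (\<Sum>v\<in>V n. pscale (c' u) (T ?n v) + (if u = v then pscale (of_nat (w u) * c' u) (Y ?n 1) else 0))"
      unfolding partial_sum
    proof (intro sum.cong refl)
      fix v assume "v \<in> V n"
      then have v: "v \<in> E_plus N" by (simp add: V_def)
      show "partial u (T n v) = pscale (c' u) (T ?n v) +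
          (if u = v then pscale (of_nat (w u) * c' u) (Y ?n 1) else 0)"
        using u v by (auto simp: T_def partial_pscale partial_yvar_mult Y.partial_vacuum
          pscale.scale_right_distrib mult_pscale_right algebra_simps)
    qed
    also have "\<dots> = pscale (c' u) (\<Sum>v\<in>V n. T ?n v) +
        (if u \<in> V n then pscale (of_nat (w u) * c' u) (Y ?n 1) else 0)"
      using fin by (simp add: sum.distrib pscale.scale_sum_right)
    also have "(\<Sum>v\<in>V n. T ?n v) = (\<Sum>v\<in>V ?n. T ?n v)"
    proof (intro sum.mono_neutral_right ballI)
      fix v assume "v \<in> V n - V ?n"
      then have "Y (?n - int (w v)) 1 = 0"
        by (intro Y.negative_vacuum) (auto simp: V_def)
      then show "T ?n v = 0" by (simp add: T_def)
    qed (use fin in \<open>auto simp: V_def\<close>)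
    also have "(if u \<in> V n then pscale (of_nat (w u) * c' u) (Y ?n 1) else 0) =
        pscale (of_nat (w u) * c' u) (Y ?n 1)"
      using u by (auto simp: V_def Y.negative_vacuum)
    finally show ?thesis
      using u by (simp add: Z_def partial_diff partial_pscale Y.partial_vacuum algebra_simps
        pscale.scale_right_diff_distrib pscale.scale_left_diff_distrib)
  qed
  have const: "Poly_Mapping.lookup (Z n) 0 = 0" for n
    using Y.vacuum[of n] by (cases "n = 0") (auto simp: Z_def T_def lookup_minus lookup_sum)
  have "Z n = 0" for n
  proof (rule fock_zero_if_derivatives_vanish_at_zero[where S = "range Z" and N = N])
    fix p v assume "p \<in> range Z" "v \<in> E_plus N"
    then show "\<exists>k. \<exists>q\<in>range Z. partial v p = pscale k q"
      using partial_Z by blast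
  next
    show "p \<in> fock_space N" if "p \<in> range Z" for p
      using that T_fock by (auto intro!: Y.closed fock_space_pscale fock_space_diff fock_space_sum
        simp: Z_def V_def)
  qed (use const in auto)
  then have "Z (int k) = 0" by simp
  then have "pscale (of_nat k) (Y (int k) 1) = (\<Sum>v\<in>V (int k). T (int k) v)"
    by (simp add: Z_def)
  then have "X (- int k) (pscale (of_nat k) (Y (int k) 1)) = X (- int k) (\<Sum>v\<in>V (int k). T (int k) v)"
    by (rule arg_cong)
  also have "X (- int k) (\<Sum>v\<in>V (int k). T (int k) v) = (\<Sum>v\<in>V (int k). X (- int k) (T (int k) v))"
    using T_fock by (intro X.sum) (auto simp: V_def)
  finally have "of_nat k * F k = (\<Sum>v\<in>V (int k). Poly_Mapping.lookup (X (- int k) (T (int k) v)) 0)"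
    by (simp add: X.scale Y.closed F_def lookup_sum flip: lookup_pscale)
  also have "\<dots> = (\<Sum>v\<in>V (int k). - (of_nat (w v) * c' v * d v) * F (k - w v))"
  proof (intro sum.cong refl)
    fix v assume "v \<in> V (int k)"
    then have v: "v \<in> E_plus N" "w v \<le> k" by (auto simp: V_def)
    then show "Poly_Mapping.lookup (X (- int k) (T (int k) v)) 0 =
        - (of_nat (w v) * c' v * d v) * F (k - w v)"
      by (simp add: T_def X.scale fock_space_yvar_mult Y.closed X.yvar_commutator lookup_minus F_def
        of_nat_diff)
  qed
  also have "\<dots> = (\<Sum>j=1..k. \<Sum>v | v \<in> V (int k) \<and> w v = j. - (of_nat (w v) * c' v * d v) * F (k - w v))"
    using fin X.weight_pos X.finite_weight_le
    by (intro sum.group[symmetric]) (auto simp: V_def Suc_le_eq)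
  also have "\<dots> = (\<Sum>j=1..k. - (\<Sum>v | v \<in> E_plus N \<and> w v = j. of_nat j * c' v * d v) * F (k - j))"
    unfolding sum_distrib_right sum_negf[symmetric]
    by (intro sum.cong refl) (auto simp: V_def)
  finally show ?thesis .
qed

section \<open>Exponentials of operator series\<close>

text \<open>A series \<open>S(z) = \<Sum>\<^sub>i S\<^sub>i z\<^sup>i\<close> of operators without constant term, so that each coefficient of
  \<open>exp S(z)\<close> is a finite sum.\<close>

locale op_series =
  fixes S :: "nat \<Rightarrow> fock \<Rightarrow> fock"
  assumes S_add: "S i (p + q) = S i p + S i q"
    and S_scale: "S i (pscale k p) = pscale k (S i p)"
    and S_0: "S 0 p = 0"
begin

lemma S_zero [simp]: "S i 0 = 0"
  using S_scale[of i 0 0] by simp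

lemma op_pow_add: "op_pow S r j (p + q) = op_pow S r j p + op_pow S r j q"
  by (induction r arbitrary: j) (auto simp: S_add sum.distrib)

lemma op_pow_scale: "op_pow S r j (pscale k p) = pscale k (op_pow S r j p)"
  by (induction r arbitrary: j) (auto simp: S_scale pscale.scale_sum_right)

lemma op_exp_add: "op_exp S j (p + q) = op_exp S j p + op_exp S j q"
  by (simp add: op_exp_def op_pow_add pscale.scale_right_distrib sum.distrib)

lemma op_exp_scale: "op_exp S j (pscale k p) = pscale k (op_exp S j p)"
  by (simp add: op_exp_def op_pow_scale pscale.scale_sum_right mult.commute)

lemma op_exp_zero [simp]: "op_exp S j 0 = 0"
  using op_exp_scale[of j 0 0] by simp

lemma op_pow_eq_0: "j < r \<Longrightarrow> op_pow S r j p = 0"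
proof (induction r arbitrary: j)
  case (Suc r)
  have "S i (op_pow S r (j - i) p) = 0" if "i \<le> j" for i
    using Suc that by (cases "i = 0") (auto simp: S_0)
  then show ?case by simp
qed auto

lemma op_exp_closed:
  assumes "\<And>i p. p \<in> fock_space N \<Longrightarrow> S i p \<in> fock_space N" "p \<in> fock_space N"
  shows "op_exp S j p \<in> fock_space N"
proof -
  have "op_pow S r j p \<in> fock_space N" for r
    by (induction r arbitrary: j) (use assms in auto)
  then show ?thesis by (auto simp: op_exp_def)
qed

text \<open>If the commutator \<open>[D, S(z)] = c z\<^sup>n\<close> is a scalar, then \<open>[D, S(z)\<^sup>r] = r c z\<^sup>n S(z)\<^sup>r\<^sup>-\<^sup>1\<close> and hence
  \<open>[D, exp S(z)] = c z\<^sup>n exp S(z)\<close>. Both relations of a vertex operator with the Heisenberg algebra are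
  instances, and \<open>c = 0\<close> covers the operators that commute with \<open>S(z)\<close>.\<close>

lemma op_exp_commutator:
  fixes D :: "fock \<Rightarrow> fock"
  assumes D_add: "\<And>p q. D (p + q) = D p + D q"
    and D_scale: "\<And>k p. D (pscale k p) = pscale k (D p)"
    and D_S: "\<And>i p. D (S i p) = S i (D p) + (if i = n then pscale c p else 0)"
    and "0 < n"
  shows "D (op_exp S j p) =
    op_exp S j (D p) + (if n \<le> j then pscale c (op_exp S (j - n) p) else 0)"
proof -
  have D_zero [simp]: "D 0 = 0" using D_scale[of 0 0] by simp
  have D_sum: "D (sum f A) = (\<Sum>x\<in>A. D (f x))" for f and A :: "nat set"
    by (induction A rule: infinite_finite_induct) (auto simp: D_add)
  have pow: "D (op_pow S r j p) = op_pow S r j (D p) +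
      (if n \<le> j then pscale (of_nat r * c) (op_pow S (r - 1) (j - n) p) else 0)" for r j
  proof (induction r arbitrary: j)
    case (Suc r)
    let ?g = "\<lambda>i. pscale (of_nat r * c) (S i (op_pow S (r - 1) (j - n - i) p))"
    have "D (op_pow S (Suc r) j p) = (\<Sum>i\<le>j. S i (op_pow S r (j - i) (D p))
        + (if i + n \<le> j then ?g i else 0) + (if i = n then pscale c (op_pow S r (j - i) p) else 0))"
      unfolding op_pow.simps D_sum D_S Suc.IH
      by (intro sum.cong refl) (auto simp: S_add S_scale ac_simps)
    also have "\<dots> = op_pow S (Suc r) j (D p) + (\<Sum>i\<le>j. if i + n \<le> j then ?g i else 0)
        + (if n \<le> j then pscale c (op_pow S r (j - n) p) else 0)"
      by (simp add: sum.distrib)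
    also have "(\<Sum>i\<le>j. if i + n \<le> j then ?g i else 0) =
        (if n \<le> j then pscale (of_nat r * c) (op_pow S r (j - n) p) else 0)"
    proof (cases "n \<le> j \<and> r > 0")
      case True
      then have "(\<Sum>i\<le>j. if i + n \<le> j then ?g i else 0) = (\<Sum>i\<le>j - n. ?g i)"
        by (intro sum.mono_neutral_cong_right) auto
      also have "\<dots> = pscale (of_nat r * c) (op_pow S (Suc (r - 1)) (j - n) p)"
        by (simp add: pscale.scale_sum_right)
      finally show ?thesis using True by simp
    qed (auto intro!: sum.neutral)
    finally show ?case
      by (auto simp: ring_distribs pscale.scale_left_distrib)
  qed (auto simp: D_zero)
  have "D (op_exp S j p) = (\<Sum>r\<le>j. pscale (1 / fact r) (op_pow S r j (D p)) +
      (if n \<le> j then pscale (of_nat r / fact r * c) (op_pow S (r - 1) (j - n) p) else 0))"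
    unfolding op_exp_def D_sum D_scale pow
    by (intro sum.cong refl) (auto simp: pscale.scale_right_distrib)
  also have "\<dots> = op_exp S j (D p) + (\<Sum>r\<le>j.
      (if n \<le> j then pscale (of_nat r / fact r * c) (op_pow S (r - 1) (j - n) p) else 0))"
    by (simp add: sum.distrib op_exp_def)
  also have "(\<Sum>r\<le>j. (if n \<le> j then pscale (of_nat r / fact r * c) (op_pow S (r - 1) (j - n) p) else 0))
      = (if n \<le> j then pscale c (op_exp S (j - n) p) else 0)"
  proof (cases "n \<le> j")
    case True
    then obtain j' where j: "j = Suc j'" using \<open>0 < n\<close> by (cases j) auto
    have "(\<Sum>r\<le>j. pscale (of_nat r / fact r * c) (op_pow S (r - 1) (j - n) p)) =
        (\<Sum>r\<le>j'. pscale (of_nat (Suc r) / fact (Suc r) * c) (op_pow S r (j - n) p))"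
      unfolding j sum.atMost_Suc_shift by simp
    also have "\<dots> = (\<Sum>r\<le>j'. pscale (c / fact r) (op_pow S r (j - n) p))"
      by (intro sum.cong refl arg_cong2[where f = pscale])
        (simp add: field_simps del: of_nat_Suc)
    also have "\<dots> = (\<Sum>r\<le>j - n. pscale (c / fact r) (op_pow S r (j - n) p))"
      using j \<open>0 < n\<close> by (intro sum.mono_neutral_right) (auto simp: op_pow_eq_0)
    also have "\<dots> = pscale c (op_exp S (j - n) p)"
      by (simp add: op_exp_def pscale.scale_sum_right)
    finally show ?thesis using True by simp
  qed simp
  finally show ?thesis .
qed

end

section \<open>The vertex operators form a vertex family\<close>

context coxeter_setup
begin

lemma cox_pos: "0 < cox" and M_pow_cox: "x \<in> \<hh> \<Longrightarrow> (M ^^ cox) x = x"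
proof -
  have "\<exists>n. 0 < n \<and> (\<forall>x\<in>\<hh>. (M ^^ n) x = x)"
    using finite_order by (metis id_apply)
  from LeastI_ex[OF this] show "0 < cox" "x \<in> \<hh> \<Longrightarrow> (M ^^ cox) x = x"
    unfolding order_on_def by auto
qed

lemma in_E_plus: "v \<in> E_plus N \<longleftrightarrow> fst v \<in> {1..N}"
  by (auto simp: E_plus_def mem_Times_iff)

sublocale graded_fock N weight
proof
  show "0 < weight v" if "v \<in> E_plus N" for v
    using that exponents(1)[of "fst v"] by (simp add: in_E_plus weight_def)
  show "finite {v \<in> E_plus N. weight v \<le> k}" for k
  proof (rule finite_subset)
    show "{v \<in> E_plus N. weight v \<le> k} \<subseteq> {1..N} \<times> {..k}"
    proof
      fix v assume v: "v \<in> {v \<in> E_plus N. weight v \<le> k}"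
      have "snd v * 1 \<le> snd v * cox" using cox_pos by (intro mult_le_mono) auto
      also have "\<dots> \<le> k" using v by (simp add: weight_def)
      finally show "v \<in> {1..N} \<times> {..k}" using v by (simp add: in_E_plus mem_Times_iff)
    qed
  qed auto
qed

lemma weight_eq_0: "{v \<in> E_plus N. weight v = 0} = {}"
  using weight_pos by fastforce

lemma finite_weight_eq: "finite {v \<in> E_plus N. weight v = j}"
  by (rule finite_subset[OF _ finite_weight_le[of j]]) auto

lemma op_series_creation: "op_series (creation \<gamma>)"
proof
  show "creation \<gamma> i (p + q) = creation \<gamma> i p + creation \<gamma> i q" for i p q
    by (simp add: creation_def ring_distribs pscale.scale_right_distrib sum.distrib)
  show "creation \<gamma> i (pscale k p) = pscale k (creation \<gamma> i p)" for i k p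
    by (simp add: creation_def mult_pscale_right pscale.scale_sum_right mult.commute[of k])
  show "creation \<gamma> 0 p = 0" for p
    by (simp add: creation_def weight_eq_0)
qed

lemma op_series_annihilation: "op_series (annihilation \<gamma>)"
proof
  show "annihilation \<gamma> i (p + q) = annihilation \<gamma> i p + annihilation \<gamma> i q" for i p q
    unfolding annihilation_def partial_add pscale.scale_right_distrib sum.distrib ..
  show "annihilation \<gamma> i (pscale k p) = pscale k (annihilation \<gamma> i p)" for i k p
    unfolding annihilation_def partial_pscale pscale.scale_sum_right pscale.scale_scale
    by (simp add: mult.commute[of k])
  show "annihilation \<gamma> 0 p = 0" for p
    by (simp add: annihilation_def weight_eq_0)
qed

lemma partial_creation:
  assumes "v \<in> E_plus N"
  shows "partial v (creation \<gamma> i p) = creation \<gamma> i (partial v p) +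
     (if i = weight v then pscale (\<gamma> (H (fst v))) p else 0)"
proof -
  have "partial v (creation \<gamma> i p) = (\<Sum>u\<in>{u \<in> E_plus N. weight u = i}.
      pscale (\<gamma> (H (fst u))) (yvar u * partial v p) + (if v = u then pscale (\<gamma> (H (fst v))) p else 0))"
    unfolding creation_def partial_sum partial_pscale partial_yvar_mult
    by (intro sum.cong refl) (auto simp: pscale.scale_right_distrib)
  also have "\<dots> = creation \<gamma> i (partial v p) +
     (if i = weight v then pscale (\<gamma> (H (fst v))) p else 0)"
    using assms finite_weight_eq by (simp add: sum.distrib creation_def eq_commute[of i])
  finally show ?thesis .
qed

lemma partial_annihilation: "partial v (annihilation \<gamma> i p) = annihilation \<gamma> i (partial v p)"
  unfolding annihilation_def partial_sum partial_pscale by (simp add: partial_commute)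

lemma yvar_creation: "yvar v * creation \<gamma> i p = creation \<gamma> i (yvar v * p)"
  unfolding creation_def sum_distrib_left mult_pscale_right by (simp add: mult.left_commute)

lemma yvar_annihilation:
  assumes "v \<in> E_plus N"
  shows "yvar v * annihilation \<gamma> i p = annihilation \<gamma> i (yvar v * p) +
     (if i = weight v then pscale (\<gamma> (H (N + 1 - fst v)) / of_nat (weight v)) p else 0)"
proof -
  let ?c = "\<lambda>u. \<gamma> (H (N + 1 - fst u)) / of_nat (weight u)"
  have "annihilation \<gamma> i (yvar v * p) = (\<Sum>u\<in>{u \<in> E_plus N. weight u = i}.
      pscale (- ?c u) (yvar v * partial u p) - (if v = u then pscale (?c v) p else 0))"
    unfolding annihilation_def partial_yvar_mult
    by (intro sum.cong refl) (auto simp: pscale.scale_right_distrib pscale.scale_right_diff_distrib)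
  also have "\<dots> = yvar v * annihilation \<gamma> i p - (if i = weight v then pscale (?c v) p else 0)"
    using assms finite_weight_eq
    by (simp add: sum_subtractf annihilation_def eq_commute[of i] sum_distrib_left mult_pscale_right)
  finally show ?thesis by simp
qed

context
  fixes \<gamma> :: "'g \<Rightarrow> complex"
begin

interpretation C: op_series "creation \<gamma>" by (rule op_series_creation)
interpretation A: op_series "annihilation \<gamma>" by (rule op_series_annihilation)

lemma partial_exp_creation:
  assumes "v \<in> E_plus N"
  shows "partial v (op_exp (creation \<gamma>) j p) = op_exp (creation \<gamma>) j (partial v p) +
    (if weight v \<le> j then pscale (\<gamma> (H (fst v))) (op_exp (creation \<gamma>) (j - weight v) p) else 0)"
  using C.op_exp_commutator[of "partial v" "weight v", OF partial_add partial_pscale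
      partial_creation[OF assms] weight_pos[OF assms]] .

lemma yvar_exp_annihilation:
  assumes "v \<in> E_plus N"
  shows "yvar v * op_exp (annihilation \<gamma>) j p = op_exp (annihilation \<gamma>) j (yvar v * p) +
    (if weight v \<le> j then pscale (\<gamma> (H (N + 1 - fst v)) / of_nat (weight v))
       (op_exp (annihilation \<gamma>) (j - weight v) p) else 0)"
  using A.op_exp_commutator[of "\<lambda>p. yvar v * p" "weight v", OF ring_distribs(1) mult_pscale_right
      yvar_annihilation[OF assms] weight_pos[OF assms]] .

lemma partial_exp_annihilation:
  "partial v (op_exp (annihilation \<gamma>) j p) = op_exp (annihilation \<gamma>) j (partial v p)"
  using A.op_exp_commutator[of "partial v" 1 0 j p, OF partial_add partial_pscale]
  by (simp add: partial_annihilation)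

lemma yvar_exp_creation:
  "yvar v * op_exp (creation \<gamma>) j p = op_exp (creation \<gamma>) j (yvar v * p)"
  using C.op_exp_commutator[of "\<lambda>p. yvar v * p" 1 0 j p, OF ring_distribs(1) mult_pscale_right]
  by (simp add: yvar_creation)

lemma exp_annihilation_one: "op_exp (annihilation \<gamma>) j 1 = (if j = 0 then 1 else 0)"
proof -
  have "op_pow (annihilation \<gamma>) r j 1 = (if j = 0 \<and> r = 0 then 1 else 0)" for r
  proof (induction r arbitrary: j)
    case (Suc r)
    have "annihilation \<gamma> i (op_pow (annihilation \<gamma>) r (j - i) 1) = 0" for i
      by (simp add: Suc annihilation_def)
    then show ?case by simp
  qed simp
  then have "op_exp (annihilation \<gamma>) j 1 = (\<Sum>r\<le>j. if r = 0 then (if j = 0 then 1 else 0) else 0)"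
    unfolding op_exp_def by (intro sum.cong refl) auto
  then show ?thesis by simp
qed

lemma const_coeff_exp_creation:
  "Poly_Mapping.lookup (op_exp (creation \<gamma>) j 1) 0 = (if j = 0 then 1 else 0)"
proof -
  have "Poly_Mapping.lookup (op_pow (creation \<gamma>) r j 1) 0 = (if j = 0 \<and> r = 0 then 1 else 0)" for r
    by (cases r) (auto simp: lookup_sum creation_def)
  then show ?thesis by (auto simp: op_exp_def lookup_sum if_distrib cong: if_cong)
qed

text \<open>Multiplication by \<open>y\<^sub>v\<close> delays the vanishing by the weight of \<open>v\<close> at most.\<close>

lemma exp_annihilation_eventually_zero:
  assumes "p \<in> fock_space N"
  shows "\<exists>K. \<forall>k\<ge>K. op_exp (annihilation \<gamma>) k p = 0"
  using assms
proof (induction p rule: fock_space_induct)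
  case one
  show ?case by (rule exI[of _ 1]) (auto simp: exp_annihilation_one)
next
  case (add p q)
  then obtain K L where "\<forall>k\<ge>K. op_exp (annihilation \<gamma>) k p = 0" "\<forall>k\<ge>L. op_exp (annihilation \<gamma>) k q = 0"
    by blast
  then have "\<forall>k\<ge>max K L. op_exp (annihilation \<gamma>) k (p + q) = 0"
    by (simp add: A.op_exp_add)
  then show ?case ..
next
  case (scale p c)
  then show ?case by (auto simp: A.op_exp_scale)
next
  case (mult p v)
  then obtain K where K: "\<forall>k\<ge>K. op_exp (annihilation \<gamma>) k p = 0" by blast
  have "op_exp (annihilation \<gamma>) k (yvar v * p) = 0" if "k \<ge> K + weight v" for k
    using yvar_exp_annihilation[OF mult.hyps(2), of k p] K that by simp
  then show ?case by blast
qed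

text \<open>Indexing the coefficients of the creation factor by all integers, with zeros at the negative ones,
  turns the index shifts in the exchange relations into plain translations.\<close>

definition exp_creation_int :: "int \<Rightarrow> fock \<Rightarrow> fock" where
  "exp_creation_int n p = (if 0 \<le> n then op_exp (creation \<gamma>) (nat n) p else 0)"

lemma Gam_eq_sum:
  assumes "\<forall>k\<ge>K. op_exp (annihilation \<gamma>) k p = 0"
  shows "Gam \<gamma> n p = (\<Sum>k<K. exp_creation_int (n + int k) (op_exp (annihilation \<gamma>) k p))"
proof -
  have "{k. exp_creation_int (n + int k) (op_exp (annihilation \<gamma>) k p) \<noteq> 0} \<subseteq> {..<K}"
  proof (rule subsetI, rule ccontr)
    fix k assume k: "k \<in> {k. exp_creation_int (n + int k) (op_exp (annihilation \<gamma>) k p) \<noteq> 0}" "k \<notin> {..<K}"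
    then have "op_exp (annihilation \<gamma>) k p = 0" using assms by auto
    then show False using k(1) by (simp add: exp_creation_int_def split: if_splits)
  qed
  then show ?thesis unfolding Gam_def exp_creation_int_def[symmetric]
    by (intro Sum_any.expand_superset) auto
qed

lemma exp_creation_int_add: "exp_creation_int n (p + q) = exp_creation_int n p + exp_creation_int n q"
  by (simp add: exp_creation_int_def C.op_exp_add)

lemma exp_creation_int_scale: "exp_creation_int n (pscale k p) = pscale k (exp_creation_int n p)"
  by (simp add: exp_creation_int_def C.op_exp_scale)

lemma exp_creation_int_zero [simp]: "exp_creation_int n 0 = 0"
  by (simp add: exp_creation_int_def)

lemma creation_closed: "p \<in> fock_space N \<Longrightarrow> creation \<gamma> i p \<in> fock_space N"
  by (auto simp: creation_def)

lemma annihilation_closed: "p \<in> fock_space N \<Longrightarrow> annihilation \<gamma> i p \<in> fock_space N"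
  unfolding annihilation_def by (intro fock_space_sum fock_space_pscale fock_space_partial)

lemma exp_creation_int_closed: "p \<in> fock_space N \<Longrightarrow> exp_creation_int n p \<in> fock_space N"
  by (auto simp: exp_creation_int_def intro!: C.op_exp_closed creation_closed)

lemma exp_annihilation_closed: "p \<in> fock_space N \<Longrightarrow> op_exp (annihilation \<gamma>) k p \<in> fock_space N"
  by (intro A.op_exp_closed annihilation_closed)

lemma partial_exp_creation_int:
  assumes "v \<in> E_plus N"
  shows "partial v (exp_creation_int n p) = exp_creation_int n (partial v p) +
    pscale (\<gamma> (H (fst v))) (exp_creation_int (n - int (weight v)) p)"
  by (auto simp: exp_creation_int_def partial_exp_creation[OF assms] nat_diff_distrib nat_le_iff le_nat_iff)

lemma yvar_exp_creation_int: "yvar v * exp_creation_int n p = exp_creation_int n (yvar v * p)"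
  by (simp add: exp_creation_int_def yvar_exp_creation)

lemma Gam_one: "Gam \<gamma> n 1 = exp_creation_int n 1"
  using Gam_eq_sum[of 1 1 n] by (simp add: exp_annihilation_one)

text \<open>A derivative commutes with the annihilation factor and multiplication by a variable with the
  creation factor, so each exchange relation comes from one factor only.\<close>

proposition Gam_vertex_family:
  "vertex_family N weight (\<lambda>v. \<gamma> (H (fst v))) (\<lambda>v. \<gamma> (H (N + 1 - fst v)) / of_nat (weight v)) (Gam \<gamma>)"
proof
  fix p n assume p: "p \<in> fock_space N"
  then obtain K where K: "\<forall>k\<ge>K. op_exp (annihilation \<gamma>) k p = 0"
    using exp_annihilation_eventually_zero by blast
  show "Gam \<gamma> n p \<in> fock_space N"
    using p by (auto simp: Gam_eq_sum[OF K] intro!: exp_creation_int_closed exp_annihilation_closed)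
  show "Gam \<gamma> n (pscale k p) = pscale k (Gam \<gamma> n p)" for k
  proof -
    have "\<forall>j\<ge>K. op_exp (annihilation \<gamma>) j (pscale k p) = 0"
      using K by (simp add: A.op_exp_scale)
    from Gam_eq_sum[OF this] Gam_eq_sum[OF K] show ?thesis
      by (simp add: A.op_exp_scale exp_creation_int_scale pscale.scale_sum_right)
  qed
  show "Gam \<gamma> n (p + q) = Gam \<gamma> n p + Gam \<gamma> n q" if q: "q \<in> fock_space N" for q
  proof -
    obtain L where L: "\<forall>k\<ge>L. op_exp (annihilation \<gamma>) k q = 0"
      using q exp_annihilation_eventually_zero by blast
    define R where "R = max K L"
    have "\<forall>k\<ge>R. op_exp (annihilation \<gamma>) k p = 0" "\<forall>k\<ge>R. op_exp (annihilation \<gamma>) k q = 0"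
      "\<forall>k\<ge>R. op_exp (annihilation \<gamma>) k (p + q) = 0"
      using K L by (auto simp: R_def A.op_exp_add)
    from this[THEN Gam_eq_sum] show ?thesis
      by (simp add: A.op_exp_add exp_creation_int_add sum.distrib)
  qed
  fix v assume v: "v \<in> E_plus N"
  show "partial v (Gam \<gamma> n p) = Gam \<gamma> n (partial v p) +
      pscale (\<gamma> (H (fst v))) (Gam \<gamma> (n - int (weight v)) p)"
  proof -
    have "\<forall>k\<ge>K. op_exp (annihilation \<gamma>) k (partial v p) = 0"
      using K by (simp flip: partial_exp_annihilation)
    from Gam_eq_sum[OF this] Gam_eq_sum[OF K] show ?thesis
      by (simp add: partial_sum partial_exp_creation_int[OF v] partial_exp_annihilation sum.distrib
        pscale.scale_sum_right algebra_simps)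
  qed
  show "Gam \<gamma> n (yvar v * p) = yvar v * Gam \<gamma> n p -
      pscale (\<gamma> (H (N + 1 - fst v)) / of_nat (weight v)) (Gam \<gamma> (n + int (weight v)) p)"
  proof -
    let ?w = "weight v" and ?d = "\<gamma> (H (N + 1 - fst v)) / of_nat (weight v)"
    let ?A = "op_exp (annihilation \<gamma>)"
    let ?g = "\<lambda>k. exp_creation_int (n + int k) (?A (k - ?w) p)"
    have "?A k (yvar v * p) = 0" if "k \<ge> K + ?w" for k
      using yvar_exp_annihilation[OF v, of k p] K that by simp
    then have y: "\<forall>k\<ge>K + ?w. ?A k (yvar v * p) = 0" by blast
    have "yvar v * Gam \<gamma> n p = yvar v * (\<Sum>k<K + ?w. exp_creation_int (n + int k) (?A k p))"
      by (subst Gam_eq_sum) (use K in auto)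
    also have "\<dots> = (\<Sum>k<K + ?w. exp_creation_int (n + int k) (?A k (yvar v * p)) +
        (if ?w \<le> k then pscale ?d (?g k) else 0))"
      unfolding sum_distrib_left yvar_exp_creation_int yvar_exp_annihilation[OF v]
      by (intro sum.cong refl) (auto simp: exp_creation_int_add exp_creation_int_scale exp_creation_int_zero)
    also have "\<dots> = Gam \<gamma> n (yvar v * p) + (\<Sum>k<K + ?w. (if ?w \<le> k then pscale ?d (?g k) else 0))"
      by (simp add: sum.distrib Gam_eq_sum[OF y])
    also have "(\<Sum>k<K + ?w. (if ?w \<le> k then pscale ?d (?g k) else 0)) =
        (\<Sum>k=?w..<K + ?w. pscale ?d (?g k))"
      by (intro sum.mono_neutral_cong_right) auto
    also have "\<dots> = (\<Sum>k<K. pscale ?d (?g (k + ?w)))"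
      by (intro sum.reindex_bij_witness[where i = "\<lambda>k. k + ?w" and j = "\<lambda>k. k - ?w"]) auto
    also have "\<dots> = pscale ?d (Gam \<gamma> (n + int ?w) p)"
      by (simp add: Gam_eq_sum[OF K] pscale.scale_sum_right algebra_simps)
    finally show ?thesis by simp
  qed
next
  show "Poly_Mapping.lookup (Gam \<gamma> n 1) 0 = 0" if "n \<noteq> 0" for n
    using that by (simp add: Gam_one exp_creation_int_def const_coeff_exp_creation)
qed

lemma const_coeff_Gam_0: "Poly_Mapping.lookup (Gam \<gamma> 0 1) 0 = 1"
  by (simp add: Gam_one exp_creation_int_def const_coeff_exp_creation)

end

end

section \<open>Roots and the Coxeter transformation\<close>

context lie_algebra
begin

lemma bracket_zero [simp]: "bracket 0 x = 0" "bracket x 0 = 0"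
  using bracket_scale_left[of 0 0 x] bracket_scale_right[of x 0 0] by simp_all

lemma bracket_sum_left: "bracket (sum f A) y = (\<Sum>x\<in>A. bracket (f x) y)"
  by (induction A rule: infinite_finite_induct) (auto simp: bracket_add_left)

lemma bracket_sum_right: "bracket y (sum f A) = (\<Sum>x\<in>A. bracket y (f x))"
  by (induction A rule: infinite_finite_induct) (auto simp: bracket_add_right)

lemma bracket_diff_right: "bracket x (y - z) = bracket x y - bracket x z"
  using bracket_add_right[of x "y - z" z] by (simp add: algebra_simps)

lemma bracket_commute: "bracket x y = - bracket y x"
proof -
  have "bracket x y + bracket y x = bracket (x + y) (x + y)"
    unfolding bracket_add_left bracket_add_right bracket_self[of x] bracket_self[of y] by simp
  then show ?thesis unfolding bracket_self by (simp add: eq_neg_iff_add_eq_0)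
qed

lemma bracket_derivation: "bracket z (bracket x y) = bracket (bracket z x) y + bracket x (bracket z y)"
proof -
  have "bracket y (bracket z x) = - bracket (bracket z x) y" by (rule bracket_commute)
  moreover have "bracket x (bracket y z) = - bracket x (bracket z y)"
    using bracket_scale_right[of x "-1" "bracket z y"] bracket_commute[of y z] by simp
  ultimately show ?thesis using jacobi[of x y z] by (simp add: algebra_simps)
qed

end

context coxeter_setup
begin

lemma M_bij: "bij M" and M_add: "M (x + y) = M x + M y" and M_scale: "M (scale c x) = scale c (M x)"
  and M_bracket: "M (bracket x y) = bracket (M x) (M y)"
  using aut by (auto simp: automorphism_def)

lemma M_zero [simp]: "M 0 = 0"
  using M_scale[of 0 0] by simp

lemma M_sum: "M (sum f A) = (\<Sum>x\<in>A. M (f x))"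
  by (induction A rule: infinite_finite_induct) (auto simp: M_add)

lemma form_add_left: "form (x + y) z = form x z + form y z"
  and form_scale_left: "form (scale c x) y = c * form x y"
  and form_sym: "form x y = form y x"
  and form_bracket: "form (bracket x y) z = form x (bracket y z)"
  and form_nondegenerate: "(\<And>y. form x y = 0) \<Longrightarrow> x = 0"
  using form by (auto simp: invariant_form_def)

lemma form_add_right: "form z (x + y) = form z x + form z y"
  by (simp add: form_sym[of z] form_add_left)

lemma form_scale_right: "form x (scale c y) = c * form x y"
  by (simp add: form_sym[of x] form_scale_left)

lemma form_zero [simp]: "form 0 x = 0" "form x 0 = 0"
  using form_scale_left[of 0 0 x] form_scale_right[of x 0 0] by simp_all

lemma form_sum_left: "form (sum f A) y = (\<Sum>x\<in>A. form (f x) y)"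
  by (induction A rule: infinite_finite_induct) (auto simp: form_add_left)

lemma form_sum_right: "form y (sum f A) = (\<Sum>x\<in>A. form y (f x))"
  by (induction A rule: infinite_finite_induct) (auto simp: form_add_right)

lemma form_diff_left: "form (x - y) z = form x z - form y z"
  using form_add_left[of "x - y" y z] by (simp add: algebra_simps)

lemma form_diff_right: "form z (x - y) = form z x - form z y"
  by (simp add: form_sym[of z] form_diff_left)

subsection \<open>Powers of the root of unity\<close>

lemma eta_neq_0 [simp]: "eta \<noteq> 0"
  by (simp add: eta_def)

text \<open>The root of unity is primitive, being \<open>exp (2 \<pi> \<i> / h)\<close>.\<close>

lemma eta_pow_eq_1_iff: "eta ^ j = 1 \<longleftrightarrow> cox dvd j"
proof -
  have "eta ^ j = exp (2 * of_real pi * \<i> * of_nat j / of_nat cox)"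
    unfolding eta_def Complex.DeMoivre unfolding cis_conv_exp by (simp add: mult_ac)
  then show ?thesis
    using complex_root_unity_eq_1[of cox j] cox_pos by simp
qed

lemma eta_powi_cox: "eta powi (int cox * n) = 1"
  using eta_pow_eq_1_iff[of cox] by (simp add: power_int_mult)

lemma eta_powi_eq_1_iff: "eta powi n = 1 \<longleftrightarrow> int cox dvd n"
proof -
  have n: "n = int cox * (n div int cox) + n mod int cox" by simp
  have "n mod int cox \<ge> 0" using cox_pos by simp
  have "eta powi n = eta powi (n mod int cox)"
    by (subst n, subst power_int_add) (simp_all add: eta_powi_cox)
  also have "\<dots> = eta ^ nat (n mod int cox)"
    using \<open>n mod int cox \<ge> 0\<close> by (simp add: power_int_nonneg_exp)
  finally have "eta powi n = 1 \<longleftrightarrow> cox dvd nat (n mod int cox)"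
    by (simp add: eta_pow_eq_1_iff)
  also have "\<dots> \<longleftrightarrow> int cox dvd n mod int cox"
    using \<open>n mod int cox \<ge> 0\<close> by (metis int_dvd_int_iff nat_0_le)
  finally show ?thesis by (simp add: dvd_mod_iff)
qed

lemma eta_powi_weight: "v \<in> E_plus N \<Longrightarrow> eta powi int (weight v) = eta powi int (m (fst v))"
  using eta_powi_cox[of "int (snd v)"] by (simp add: weight_def power_int_add mult.commute)

subsection \<open>The Cartan subalgebra and its dual\<close>

lemma cartan_subspace: "subspace \<hh>"
  and cartan_abelian: "x \<in> \<hh> \<Longrightarrow> y \<in> \<hh> \<Longrightarrow> bracket x y = 0"
  and cartan_diagonalizable: "x \<in> \<hh> \<Longrightarrow> ad_diagonalizable x"
  and cartan_self_centralizing: "(\<And>y. y \<in> \<hh> \<Longrightarrow> bracket y x = 0) \<Longrightarrow> x \<in> \<hh>"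
  using cartan unfolding cartan_subalgebra_def by blast+

lemma H_in_cartan: "a \<in> {1..N} \<Longrightarrow> H a \<in> \<hh>"
  unfolding H_basis(3)[symmetric] by (intro span_base imageI)

lemma cartan_sum: "(\<And>x. x \<in> A \<Longrightarrow> f x \<in> \<hh>) \<Longrightarrow> sum f A \<in> \<hh>"
  using cartan_subspace by (rule subspace_sum)

lemma cartan_scale: "x \<in> \<hh> \<Longrightarrow> scale c x \<in> \<hh>"
  using cartan_subspace by (rule subspace_scale)

lemma star_index: "a \<in> {1..N} \<Longrightarrow> N + 1 - a \<in> {1..N}"
  by auto

lemma H_form_star:
  assumes "a \<in> {1..N}" "b \<in> {1..N}"
  shows "form (H b) (H (N + 1 - a)) = (if b = a then of_nat cox else 0)"
    and "form (H (N + 1 - a)) (H b) = (if b = a then of_nat cox else 0)"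
proof -
  have eq: "b + (N + 1 - a) = N + 1 \<longleftrightarrow> b = a" "N + 1 - a + b = N + 1 \<longleftrightarrow> b = a"
    using assms by auto
  show "form (H b) (H (N + 1 - a)) = (if b = a then of_nat cox else 0)"
    using H_form[OF assms(2) star_index[OF assms(1)]] unfolding eq .
  show "form (H (N + 1 - a)) (H b) = (if b = a then of_nat cox else 0)"
    using H_form[OF star_index[OF assms(1)] assms(2)] unfolding eq .
qed

text \<open>The Gram matrix of the basis \<open>H\<close> is antidiagonal, so \<open>H (N + 1 - a) / h\<close> is dual to \<open>H a\<close>. This makes the
  form nondegenerate on \<open>\<hh>\<close>.\<close>

lemma cartan_expansion:
  assumes "x \<in> \<hh>"
  shows "x = (\<Sum>a=1..N. scale (form x (H (N + 1 - a)) / of_nat cox) (H a))"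
proof -
  have "x \<in> span (H ` {1..N})" using assms H_basis(3) by simp
  then obtain u where "x = (\<Sum>v\<in>H ` {1..N}. scale (u v) v)"
    by (auto simp: span_finite)
  then have x: "x = (\<Sum>a=1..N. scale (u (H a)) (H a))"
    using H_basis(1) by (simp add: sum.reindex)
  have coeff: "form x (H (N + 1 - a)) / of_nat cox = u (H a)" if a: "a \<in> {1..N}" for a
  proof -
    have "form x (H (N + 1 - a)) = (\<Sum>b=1..N. u (H b) * form (H b) (H (N + 1 - a)))"
      by (subst x) (simp add: form_sum_left form_scale_left)
    also have "\<dots> = (\<Sum>b=1..N. if b = a then u (H a) * of_nat cox else 0)"
      using H_form_star(1)[OF a] by (intro sum.cong refl) (simp del: add_Suc_right)
    finally show ?thesis using a cox_pos by simp
  qed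
  have "(\<Sum>a=1..N. scale (form x (H (N + 1 - a)) / of_nat cox) (H a)) = (\<Sum>a=1..N. scale (u (H a)) (H a))"
    by (intro sum.cong refl) (simp only: coeff)
  from trans[OF x this[symmetric]] show ?thesis .
qed

lemma cartan_eqI:
  assumes "x \<in> \<hh>" "y \<in> \<hh>" "\<And>a. a \<in> {1..N} \<Longrightarrow> form x (H a) = form y (H a)"
  shows "x = y"
  using assms(3)[OF star_index]
  by (subst cartan_expansion[OF assms(1)], subst cartan_expansion[OF assms(2)])
    (auto intro!: sum.cong)

lemma dual_scale: "\<gamma> \<in> dual_space \<hh> \<Longrightarrow> x \<in> \<hh> \<Longrightarrow> \<gamma> (scale c x) = c * \<gamma> x"
  by (simp add: dual_space_def)

lemma dual_sum:
  assumes "\<gamma> \<in> dual_space \<hh>" "\<And>x. x \<in> A \<Longrightarrow> f x \<in> \<hh>"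
  shows "\<gamma> (sum f A) = (\<Sum>x\<in>A. \<gamma> (f x))"
proof -
  have zero: "\<gamma> 0 = 0"
    using dual_scale[OF assms(1) subspace_0[OF cartan_subspace], of 0] by simp
  show ?thesis using assms(2)
  proof (induction A rule: infinite_finite_induct)
    case (insert x A)
    then have "f x \<in> \<hh>" "sum f A \<in> \<hh>" by (auto intro: cartan_sum)
    then have "\<gamma> (f x + sum f A) = \<gamma> (f x) + \<gamma> (sum f A)"
      using assms(1) by (simp add: dual_space_def)
    with insert show ?case by simp
  qed (auto simp: zero)
qed

lemma dual_expansion:
  assumes "\<gamma> \<in> dual_space \<hh>" "x \<in> \<hh>"
  shows "\<gamma> x = (\<Sum>a=1..N. form x (H (N + 1 - a)) / of_nat cox * \<gamma> (H a))"
proof -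
  let ?f = "\<lambda>a. scale (form x (H (N + 1 - a)) / of_nat cox) (H a)"
  have "\<gamma> x = \<gamma> (sum ?f {1..N})" using cartan_expansion[OF assms(2)] by simp
  also have "\<dots> = (\<Sum>a=1..N. \<gamma> (?f a))"
    by (intro dual_sum assms cartan_scale H_in_cartan)
  also have "\<dots> = (\<Sum>a=1..N. form x (H (N + 1 - a)) / of_nat cox * \<gamma> (H a))"
    by (intro sum.cong refl dual_scale assms H_in_cartan)
  finally show ?thesis .
qed

lemma dual_eqI:
  assumes "\<gamma> \<in> dual_space \<hh>" "\<delta> \<in> dual_space \<hh>" "\<And>a. a \<in> {1..N} \<Longrightarrow> \<gamma> (H a) = \<delta> (H a)"
  shows "\<gamma> = \<delta>"
proof
  fix x
  show "\<gamma> x = \<delta> x"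
  proof (cases "x \<in> \<hh>")
    case True
    then show ?thesis using assms by (simp add: dual_expansion)
  next
    case False
    then show ?thesis using assms by (simp add: dual_space_def)
  qed
qed

lemma dual_uminus: "\<gamma> \<in> dual_space \<hh> \<Longrightarrow> (\<lambda>x. - \<gamma> x) \<in> dual_space \<hh>"
  by (auto simp: dual_space_def)

lemma dual_vec:
  assumes "\<gamma> \<in> dual_space \<hh>"
  shows "dual_vec form \<hh> \<gamma> \<in> \<hh>" "x \<in> \<hh> \<Longrightarrow> form (dual_vec form \<hh> \<gamma>) x = \<gamma> x"
proof -
  let ?t = "\<Sum>a=1..N. scale (\<gamma> (H (N + 1 - a)) / of_nat cox) (H a)"
  have t: "?t \<in> \<hh>" by (intro cartan_sum cartan_scale H_in_cartan)
  have tH: "form ?t (H b) = \<gamma> (H b)" if b: "b \<in> {1..N}" for b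
  proof -
    have "form ?t (H b) = (\<Sum>a=1..N. \<gamma> (H (N + 1 - a)) / of_nat cox * form (H a) (H b))"
      by (simp add: form_sum_left form_scale_left)
    also have "\<dots> = (\<Sum>a=1..N. \<gamma> (H a) / of_nat cox * form (H (N + 1 - a)) (H b))"
      by (intro sum.reindex_bij_witness[where i = "\<lambda>a. N + 1 - a" and j = "\<lambda>a. N + 1 - a"]) auto
    also have "\<dots> = (\<Sum>a=1..N. if a = b then \<gamma> (H b) else 0)"
      using cox_pos b H_form_star(2)[OF _ b] by (intro sum.cong refl) simp
    finally show ?thesis using b by simp
  qed
  have tx: "form ?t x = \<gamma> x" if x: "x \<in> \<hh>" for x
  proof -
    have "form ?t x = (\<Sum>a=1..N. form x (H (N + 1 - a)) / of_nat cox * form ?t (H a))"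
      by (subst cartan_expansion[OF x]) (simp only: form_sum_right form_scale_right)
    also have "\<dots> = (\<Sum>a=1..N. form x (H (N + 1 - a)) / of_nat cox * \<gamma> (H a))"
      by (intro sum.cong refl) (simp only: tH)
    also have "\<dots> = \<gamma> x" using dual_expansion[OF assms x] by simp
    finally show ?thesis .
  qed
  have "\<exists>!t. t \<in> \<hh> \<and> (\<forall>x\<in>\<hh>. form t x = \<gamma> x)"
  proof (rule ex1I[of _ ?t])
    fix s assume "s \<in> \<hh> \<and> (\<forall>x\<in>\<hh>. form s x = \<gamma> x)"
    then show "s = ?t" using t tH H_in_cartan by (intro cartan_eqI) auto
  qed (use t tx in auto)
  from theI'[OF this] show "dual_vec form \<hh> \<gamma> \<in> \<hh>"
    "x \<in> \<hh> \<Longrightarrow> form (dual_vec form \<hh> \<gamma>) x = \<gamma> x"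
    unfolding dual_vec_def by auto
qed

lemma dual_form_expansion:
  assumes "\<gamma> \<in> dual_space \<hh>" "\<delta> \<in> dual_space \<hh>"
  shows "dual_form form \<hh> \<gamma> \<delta> = (\<Sum>a=1..N. \<gamma> (H (N + 1 - a)) * \<delta> (H a)) / of_nat cox"
proof -
  have "dual_form form \<hh> \<gamma> \<delta> = \<delta> (dual_vec form \<hh> \<gamma>)"
    using assms by (simp add: dual_form_def form_sym dual_vec)
  also have "\<dots> = (\<Sum>a=1..N. form (dual_vec form \<hh> \<gamma>) (H (N + 1 - a)) / of_nat cox * \<delta> (H a))"
    using assms by (intro dual_expansion dual_vec)
  also have "\<dots> = (\<Sum>a=1..N. \<gamma> (H (N + 1 - a)) * \<delta> (H a)) / of_nat cox"
    unfolding sum_divide_distrib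
    using dual_vec(2)[OF assms(1) H_in_cartan[OF star_index]] by (intro sum.cong refl) simp
  finally show ?thesis .
qed

subsection \<open>The Coxeter transformation on the Cartan subalgebra and on the roots\<close>

lemma M_H: "a \<in> {1..N} \<Longrightarrow> M (H a) = scale (eta ^ m a) (H a)"
  using H_eigen by (simp add: eta_def)

lemma M_cartan: "x \<in> \<hh> \<Longrightarrow> M x \<in> \<hh>"
  by (subst cartan_expansion, assumption)
    (auto simp: M_sum M_scale M_H intro!: cartan_sum cartan_scale H_in_cartan)

lemma M_pow_cartan: "x \<in> \<hh> \<Longrightarrow> (M ^^ k) x \<in> \<hh>"
  by (induction k) (auto intro: M_cartan)

lemma cartan_M_preimage:
  assumes "x \<in> \<hh>"
  obtains y where "y \<in> \<hh>" "x = M y"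
proof
  have "M ((M ^^ (cox - 1)) x) = (M ^^ Suc (cox - 1)) x" by simp
  also have "\<dots> = x" using cox_pos M_pow_cox[OF assms] by simp
  finally show "x = M ((M ^^ (cox - 1)) x)" ..
qed (use assms M_pow_cartan in auto)

lemma dual_action_M: "x \<in> \<hh> \<Longrightarrow> dual_action \<hh> M \<gamma> (M x) = \<gamma> x"
  using M_bij by (simp add: dual_action_def M_cartan inv_into_f_f bij_def inj_on_def)

lemma dual_action_dual:
  assumes "\<gamma> \<in> dual_space \<hh>"
  shows "dual_action \<hh> M \<gamma> \<in> dual_space \<hh>"
proof -
  have "dual_action \<hh> M \<gamma> (x + y) = dual_action \<hh> M \<gamma> x + dual_action \<hh> M \<gamma> y"
    if x: "x \<in> \<hh>" and y: "y \<in> \<hh>" for x y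
  proof -
    obtain x' where x': "x' \<in> \<hh>" "x = M x'" using x by (rule cartan_M_preimage)
    obtain y' where y': "y' \<in> \<hh>" "y = M y'" using y by (rule cartan_M_preimage)
    note * = x' y'
    have "\<gamma> (x' + y') = \<gamma> x' + \<gamma> y'"
      using assms * by (simp add: dual_space_def)
    then show ?thesis
      using * subspace_add[OF cartan_subspace] by (simp add: dual_action_M flip: M_add)
  qed
  moreover have "dual_action \<hh> M \<gamma> (scale c x) = c * dual_action \<hh> M \<gamma> x" if x: "x \<in> \<hh>" for c x
  proof -
    obtain x' where *: "x' \<in> \<hh>" "x = M x'" using x by (rule cartan_M_preimage)
    then show ?thesis
      using assms by (simp add: dual_action_M cartan_scale dual_scale flip: M_scale)
  qed
  ultimately show ?thesis by (auto simp: dual_space_def dual_action_def)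
qed

lemma dual_action_pow_dual: "\<gamma> \<in> dual_space \<hh> \<Longrightarrow> (dual_action \<hh> M ^^ k) \<gamma> \<in> dual_space \<hh>"
  by (induction k) (auto intro: dual_action_dual)

lemma dual_action_H:
  assumes "\<gamma> \<in> dual_space \<hh>" "a \<in> {1..N}"
  shows "dual_action \<hh> M \<gamma> (H a) = eta powi (- int (m a)) * \<gamma> (H a)"
proof -
  have "H a = M (scale (eta powi (- int (m a))) (H a))"
    using assms by (simp add: M_scale M_H power_int_minus)
  then have "dual_action \<hh> M \<gamma> (H a) = dual_action \<hh> M \<gamma> (M (scale (eta powi (- int (m a))) (H a)))"
    by simp
  also have "\<dots> = eta powi (- int (m a)) * \<gamma> (H a)"
    using assms by (simp only: dual_action_M cartan_scale H_in_cartan dual_scale)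
  finally show ?thesis .
qed

lemma dual_action_pow_H:
  assumes "\<gamma> \<in> dual_space \<hh>" "a \<in> {1..N}"
  shows "(dual_action \<hh> M ^^ k) \<gamma> (H a) = eta powi (- int (k * m a)) * \<gamma> (H a)"
proof (induction k)
  case (Suc k)
  have "eta powi (- int (Suc k * m a)) = eta powi (- int (m a)) * eta powi (- int (k * m a))"
    by (subst power_int_add[symmetric]) (auto simp: algebra_simps)
  then show ?case
    using assms Suc by (simp add: dual_action_H dual_action_pow_dual)
qed simp

lemma dual_action_pow_cox: "\<gamma> \<in> dual_space \<hh> \<Longrightarrow> (dual_action \<hh> M ^^ cox) \<gamma> = \<gamma>"
  using eta_powi_cox[of "- int (m _)"]
  by (intro dual_eqI dual_action_pow_dual) (auto simp: dual_action_pow_H)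

lemma dual_action_pow_uminus:
  "(dual_action \<hh> M ^^ k) (\<lambda>x. - \<gamma> x) = (\<lambda>x. - (dual_action \<hh> M ^^ k) \<gamma> x)"
  by (induction k) (auto simp: dual_action_def)

lemma dual_action_nonzero:
  assumes "\<gamma> \<in> dual_space \<hh>" "\<gamma> \<noteq> (\<lambda>_. 0)"
  shows "dual_action \<hh> M \<gamma> \<noteq> (\<lambda>_. 0)"
proof
  assume *: "dual_action \<hh> M \<gamma> = (\<lambda>_. 0)"
  obtain x where x: "\<gamma> x \<noteq> 0" using assms by auto
  then have "x \<in> \<hh>" using assms by (auto simp: dual_space_def)
  with x dual_action_M[of x \<gamma>] * show False by simp
qed

lemma reflection_isometry:
  assumes "\<gamma> \<in> roots \<hh>" "x \<in> \<hh>" "y \<in> \<hh>"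
  shows "reflection \<gamma> x \<in> \<hh>" "form (reflection \<gamma> x) (reflection \<gamma> y) = form x y"
proof -
  let ?t = "dual_vec form \<hh> \<gamma>"
  have \<gamma>: "\<gamma> \<in> dual_space \<hh>" using assms by (simp add: roots_def)
  have refl: "reflection \<gamma> z = z - scale (\<gamma> z) ?t" for z
    using normalized[OF assms(1)] by (simp add: reflection_def)
  have tt: "form ?t ?t = 2" using normalized[OF assms(1)] by (simp add: dual_form_def)
  show "reflection \<gamma> x \<in> \<hh>"
    using assms(2) dual_vec(1)[OF \<gamma>] cartan_subspace by (simp add: refl subspace_diff subspace_scale)
  show "form (reflection \<gamma> x) (reflection \<gamma> y) = form x y"
    unfolding refl form_diff_left form_diff_right form_scale_left form_scale_right tt form_sym[of x ?t]
      dual_vec(2)[OF \<gamma> assms(2)] dual_vec(2)[OF \<gamma> assms(3)]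
    by (simp add: algebra_simps)
qed

text \<open>On \<open>\<hh>\<close> the Coxeter transformation is a product of reflections, which are isometries because
  \<open>(\<gamma> | \<gamma>) = 2\<close>.\<close>

lemma form_M_cartan:
  assumes "x \<in> \<hh>" "y \<in> \<hh>"
  shows "form (M x) (M y) = form x y"
proof -
  obtain \<beta> where \<beta>: "root_base \<hh> N \<beta>"
    and M: "\<And>x. x \<in> \<hh> \<Longrightarrow> M x = foldr (\<lambda>j. reflection (\<beta> j)) [1..<N+1] x"
    using coxeter unfolding coxeter_transformation_def by blast
  have iso: "foldr (\<lambda>j. reflection (\<beta> j)) js x \<in> \<hh> \<and> foldr (\<lambda>j. reflection (\<beta> j)) js y \<in> \<hh> \<and>
     form (foldr (\<lambda>j. reflection (\<beta> j)) js x) (foldr (\<lambda>j. reflection (\<beta> j)) js y) = form x y"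
    if "set js \<subseteq> {1..N}" for js
    using that
  proof (induction js)
    case (Cons j js)
    then have "\<beta> j \<in> roots \<hh>" using \<beta> by (auto simp: root_base_def)
    with Cons show ?case by (auto simp: reflection_isometry)
  qed (use assms in auto)
  have "set [1..<N+1] \<subseteq> {1..N}" by auto
  from iso[OF this] show ?thesis unfolding M[OF assms(1)] M[OF assms(2)] by blast
qed

text \<open>The vectors \<open>H a\<close> and \<open>H (N + 1 - a)\<close> have a nonzero product which \<open>M\<close> preserves. Hence \<open>h\<close> divides the
  sum of their exponents, and this sum lies strictly between \<open>0\<close> and \<open>2 h\<close>.\<close>

lemma exponent_duality:
  assumes a: "a \<in> {1..N}"
  shows "m a + m (N + 1 - a) = cox"
proof -
  have b: "N + 1 - a \<in> {1..N}" using a by auto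
  have "form (M (H a)) (M (H (N + 1 - a))) = form (H a) (H (N + 1 - a))"
    by (intro form_M_cartan H_in_cartan a b)
  moreover have "form (H a) (H (N + 1 - a)) = of_nat cox"
    using H_form[OF a b] a by simp
  ultimately have "eta ^ m a * (eta ^ m (N + 1 - a) * of_nat cox) = of_nat cox"
    unfolding M_H[OF a] M_H[OF b] form_scale_left form_scale_right
    by (simp only: mult.left_commute)
  then have "eta ^ (m a + m (N + 1 - a)) * of_nat cox = 1 * of_nat cox"
    by (simp only: power_add mult.assoc mult_1)
  then have "eta ^ (m a + m (N + 1 - a)) = 1"
    using cox_pos by (metis less_not_refl mult_right_cancel of_nat_0_eq_iff)
  then obtain q where q: "m a + m (N + 1 - a) = cox * q"
    by (auto simp: eta_pow_eq_1_iff)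
  have "cox * 0 < cox * q" "cox * q < cox * 2"
    using exponents(1)[OF a] exponents(1)[OF b] by (auto simp flip: q)
  then have "q = 1" by (simp only: mult_less_cancel1) simp
  then show ?thesis using q by simp
qed

lemma root_space_M:
  assumes "x \<in> root_space \<hh> \<gamma>"
  shows "M x \<in> root_space \<hh> (dual_action \<hh> M \<gamma>)"
  unfolding root_space_def
proof (intro CollectI ballI)
  fix z assume "z \<in> \<hh>"
  then obtain z' where z: "z' \<in> \<hh>" "z = M z'" by (rule cartan_M_preimage)
  show "bracket z (M x) = scale (dual_action \<hh> M \<gamma> z) (M x)"
    using assms z by (simp add: dual_action_M root_space_def flip: M_bracket M_scale)
qed

lemma root_space_M_pow:
  "x \<in> root_space \<hh> \<gamma> \<Longrightarrow> (M ^^ k) x \<in> root_space \<hh> ((dual_action \<hh> M ^^ k) \<gamma>)"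
  by (induction k) (auto intro: root_space_M)

lemma root_spaceD: "x \<in> root_space \<hh> \<gamma> \<Longrightarrow> z \<in> \<hh> \<Longrightarrow> bracket z x = scale (\<gamma> z) x"
  by (simp add: root_space_def)

lemma form_root_vectors:
  assumes "x \<in> root_space \<hh> \<gamma>" "y \<in> root_space \<hh> \<delta>" "z \<in> \<hh>"
  shows "(\<gamma> z + \<delta> z) * form x y = 0"
proof -
  have "\<gamma> z * form x y = form (bracket z x) y"
    using assms by (simp add: root_spaceD form_scale_left)
  also have "\<dots> = - form x (bracket z y)"
    using form_scale_left[of "-1" "bracket x z" y]
    by (subst bracket_commute) (simp add: form_bracket)
  also have "\<dots> = - \<delta> z * form x y"
    using assms by (simp add: root_spaceD form_scale_right)
  finally show ?thesis by (simp add: algebra_simps)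
qed

lemma bracket_opposite_roots:
  assumes "\<gamma> \<in> dual_space \<hh>" "x \<in> root_space \<hh> \<gamma>" "y \<in> root_space \<hh> (\<lambda>z. - \<gamma> z)"
  shows "bracket x y = scale (form x y) (dual_vec form \<hh> \<gamma>)"
proof (rule cartan_eqI)
  have "bracket z (bracket x y) = 0" if "z \<in> \<hh>" for z
    using assms that
    by (subst bracket_derivation)
      (simp add: root_spaceD bracket_scale_left bracket_scale_right
        flip: scale_minus_left scale_left_distrib)
  then show "bracket x y \<in> \<hh>" by (rule cartan_self_centralizing)
  show "scale (form x y) (dual_vec form \<hh> \<gamma>) \<in> \<hh>"
    by (intro cartan_scale dual_vec assms)
  fix a assume a: "a \<in> {1..N}"
  have "bracket y (H a) = scale (\<gamma> (H a)) y"
    using root_spaceD[OF assms(3) H_in_cartan[OF a]] by (subst bracket_commute) simp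
  then show "form (bracket x y) (H a) = form (scale (form x y) (dual_vec form \<hh> \<gamma>)) (H a)"
    using dual_vec(2)[OF assms(1) H_in_cartan[OF a]]
    by (simp add: form_bracket form_scale_left form_scale_right)
qed

text \<open>Apply \<open>M\<close> to \<open>[x, y] = (x | y) t\<^sub>\<gamma>\<close>: since \<open>M\<close> is an isometry of \<open>\<hh>\<close>, it maps \<open>t\<^sub>\<gamma>\<close> to the vector
  \<open>t\<close> of the root \<open>M \<gamma>\<close>, and comparing with \<open>[M x, M y] = (M x | M y) t\<close> gives the claim.\<close>

lemma form_M_opposite_roots:
  assumes \<gamma>: "\<gamma> \<in> dual_space \<hh>" "\<gamma> \<noteq> (\<lambda>_. 0)"
    and x: "x \<in> root_space \<hh> \<gamma>" and y: "y \<in> root_space \<hh> (\<lambda>z. - \<gamma> z)"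
  shows "form (M x) (M y) = form x y"
proof -
  let ?t = "dual_vec form \<hh> \<gamma>" and ?t' = "dual_vec form \<hh> (dual_action \<hh> M \<gamma>)"
  have \<gamma>': "dual_action \<hh> M \<gamma> \<in> dual_space \<hh>" using \<gamma> by (intro dual_action_dual)
  have Mt: "M ?t = ?t'"
  proof (rule cartan_eqI)
    fix a assume "a \<in> {1..N}"
    then obtain z where z: "z \<in> \<hh>" "H a = M z" by (rule cartan_M_preimage[OF H_in_cartan])
    then show "form (M ?t) (H a) = form ?t' (H a)"
      using dual_vec[OF \<gamma>(1)] dual_vec(2)[OF \<gamma>', of "M z"]
      by (simp add: form_M_cartan dual_action_M M_cartan)
  qed (intro M_cartan dual_vec(1) \<gamma>(1) \<gamma>')+
  have "scale (form x y) ?t' = M (bracket x y)"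
    by (simp add: bracket_opposite_roots[OF \<gamma>(1) x y] M_scale Mt)
  also have "\<dots> = scale (form (M x) (M y)) ?t'"
    using root_space_M[OF y] dual_action_pow_uminus[of 1 \<gamma>]
    by (simp add: M_bracket bracket_opposite_roots[OF \<gamma>' root_space_M[OF x]])
  finally have "form x y = form (M x) (M y) \<or> ?t' = 0"
    by simp
  moreover have "?t' \<noteq> 0"
  proof
    assume "?t' = 0"
    then have "dual_action \<hh> M \<gamma> z = 0" if "z \<in> \<hh>" for z
      using dual_vec(2)[OF \<gamma>' that] by simp
    then have "dual_action \<hh> M \<gamma> = (\<lambda>_. 0)"
      using \<gamma>' unfolding dual_space_def by blast
    then show False using dual_action_nonzero \<gamma> by blast
  qed
  ultimately show ?thesis by simp
qed

lemma form_M_pow_opposite_roots: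
  assumes "\<gamma> \<in> dual_space \<hh>" "\<gamma> \<noteq> (\<lambda>_. 0)"
    and "x \<in> root_space \<hh> \<gamma>" and "y \<in> root_space \<hh> (\<lambda>z. - \<gamma> z)"
  shows "form ((M ^^ k) x) ((M ^^ k) y) = form x y"
proof (induction k)
  case (Suc k)
  let ?\<gamma> = "(dual_action \<hh> M ^^ k) \<gamma>"
  have "?\<gamma> \<noteq> (\<lambda>_. 0)"
    using dual_action_nonzero[OF dual_action_pow_dual[OF assms(1)]] assms(2) by (induction k) auto
  then have "form (M ((M ^^ k) x)) (M ((M ^^ k) y)) = form ((M ^^ k) x) ((M ^^ k) y)"
    using assms root_space_M_pow[OF assms(4), of k]
    by (intro form_M_opposite_roots[of ?\<gamma>] dual_action_pow_dual root_space_M_pow)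
      (auto simp: dual_action_pow_uminus)
  with Suc show ?case by simp
qed simp

subsection \<open>Pairing opposite root spaces\<close>

text \<open>The functional \<open>(x | -)\<close> is an eigenvector of the transpose of \<open>ad z\<close> with eigenvalue \<open>d\<close>. If \<open>y\<close> has a
  component of another eigenvalue \<open>c\<close>, then \<open>ad z - c\<close> removes it, multiplies \<open>(x | y)\<close> by the nonzero
  number \<open>d - c\<close> and does not leave \<open>V\<close>. After finitely many steps only the eigenvalue \<open>d\<close> remains.\<close>

lemma eigenvector_extraction:
  assumes diag: "ad_diagonalizable z"
    and V: "\<And>y c. y \<in> V \<Longrightarrow> bracket z y - scale c y \<in> V"
    and \<phi>: "\<And>y. form x (bracket z y) = d * form x y"
    and y: "y \<in> V" "form x y \<noteq> 0"
  obtains y' where "y' \<in> V" "bracket z y' = scale d y'" "form x y' \<noteq> 0"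
proof -
  \<comment> \<open>\<open>u\<close> gathers the components of eigenvalue \<open>d\<close>; the others are spanned by \<open>B\<close>.\<close>
  have main: "\<exists>y'\<in>V. bracket z y' = scale d y' \<and> form x y' \<noteq> 0"
    if "finite B" "\<forall>b\<in>B. \<exists>c. bracket z b = scale c b"
      "u + v \<in> V" "form x (u + v) \<noteq> 0" "bracket z u = scale d u" "v \<in> span B" for B u v
    using that
  proof (induction B arbitrary: u v rule: finite_induct)
    case empty
    then have "v = 0" by simp
    then show ?case using empty by auto
  next
    case (insert b B)
    obtain c where c: "bracket z b = scale c b" using insert.prems by auto
    obtain k where k: "v - scale k b \<in> span B"
      using insert.prems(5) by (auto simp: span_insert)
    let ?v = "v - scale k b"
    show ?case
    proof (cases "c = d")
      case True
      show ?thesis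
      proof (rule insert.IH[of "u + scale k b" ?v])
        show "bracket z (u + scale k b) = scale d (u + scale k b)"
          using insert.prems c True
          by (simp add: bracket_add_right bracket_scale_right scale_right_distrib mult.commute)
      qed (use insert.prems k in auto)
    next
      case False
      let ?T = "\<lambda>y. bracket z y - scale c y"
      have "?T (u + v) = scale (d - c) u + ?T ?v"
        using insert.prems(4) c
        by (simp add: bracket_add_right bracket_diff_right bracket_scale_right scale_right_distrib
          scale_right_diff_distrib scale_left_diff_distrib mult.commute)
      moreover have "form x (?T (u + v)) = (d - c) * form x (u + v)"
        by (simp only: form_diff_right \<phi> form_scale_right left_diff_distrib)
      moreover have "?T ?v \<in> span B"
      proof -
        have "bracket z w \<in> span B" if "w \<in> span B" for w
          using that
        proof (induction w rule: span_induct_alt)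
          case (step e w y)
          then obtain c' where "bracket z w = scale c' w" using insert.prems(1) by auto
          with step show ?case
            by (simp add: bracket_add_right bracket_scale_right span_add span_scale span_base)
        qed (simp add: span_zero)
        then show ?thesis using k span_diff span_scale by blast
      qed
      ultimately show ?thesis
        using insert.prems V[OF insert.prems(2), of c] False
        by (intro insert.IH[of "scale (d - c) u" "?T ?v"])
          (auto simp: bracket_scale_right mult.commute)
    qed
  qed
  have "y \<in> span {y. \<exists>c. bracket z y = scale c y}"
    using diag by (simp add: ad_diagonalizable_def)
  then obtain t r where t: "finite t" "t \<subseteq> {y. \<exists>c. bracket z y = scale c y}" "y = (\<Sum>a\<in>t. scale (r a) a)"
    by (auto simp: span_explicit)
  have "y \<in> span t" unfolding t(3) by (intro span_sum span_scale span_base)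
  have "\<exists>y'\<in>V. bracket z y' = scale d y' \<and> form x y' \<noteq> 0"
  proof (rule main[of t 0 y])
    show "\<forall>b\<in>t. \<exists>c. bracket z b = scale c b" using t(2) by blast
    show "y \<in> span t" by fact
  qed (use t(1) y in simp_all)
  then show ?thesis using that by blast
qed

end

context coxeter_setup
begin

text \<open>Start with any \<open>y\<close> that pairs nontrivially with \<open>x\<close> and make it an eigenvector of
  \<open>H 1, \<dots>, H N\<close> in turn. The eigenvalues are forced by invariance of the form, and the operators commute, so
  a step does not spoil the preceding ones.\<close>

lemma opposite_root_vector:
  assumes \<gamma>: "\<gamma> \<in> dual_space \<hh>" and x: "x \<in> root_space \<hh> \<gamma>" "x \<noteq> 0"
  obtains y where "y \<in> root_space \<hh> (\<lambda>z. - \<gamma> z)" "form x y \<noteq> 0"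
proof -
  have "\<exists>y. form x y \<noteq> 0 \<and> (\<forall>a\<in>{1..n}. bracket (H a) y = scale (- \<gamma> (H a)) y)" if "n \<le> N" for n
    using that
  proof (induction n)
    case 0
    then show ?case using form_nondegenerate x(2) by auto
  next
    case (Suc n)
    let ?V = "{y. \<forall>a\<in>{1..n}. bracket (H a) y = scale (- \<gamma> (H a)) y}"
    obtain y where y: "form x y \<noteq> 0" "y \<in> ?V" using Suc by auto
    let ?z = "H (Suc n)"
    have z: "?z \<in> \<hh>" using Suc.prems by (intro H_in_cartan) auto
    have closed: "bracket ?z y - scale c y \<in> ?V" if "y \<in> ?V" for y c
    proof (intro CollectI ballI)
      fix a assume a: "a \<in> {1..n}"
      then have Ha: "H a \<in> \<hh>" using Suc.prems by (intro H_in_cartan) auto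
      have y: "bracket (H a) y = scale (- \<gamma> (H a)) y" using that a by blast
      have "bracket (H a) (bracket ?z y) = scale (- \<gamma> (H a)) (bracket ?z y)"
        unfolding bracket_derivation[of "H a"] cartan_abelian[OF Ha z] y bracket_scale_right by simp
      then show "bracket (H a) (bracket ?z y - scale c y) = scale (- \<gamma> (H a)) (bracket ?z y - scale c y)"
        unfolding bracket_diff_right bracket_scale_right y scale_right_diff_distrib
        by (simp add: mult.commute)
    qed
    have pair: "form x (bracket ?z y) = - \<gamma> ?z * form x y" for y
    proof -
      have "form x (bracket ?z y) = form (- bracket ?z x) y"
        by (simp add: form_bracket flip: bracket_commute)
      also have "\<dots> = - \<gamma> ?z * form x y"
        using root_spaceD[OF x(1) z] by (simp add: form_scale_left flip: scale_minus_left)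
      finally show ?thesis .
    qed
    have "ad_diagonalizable ?z" using z by (rule cartan_diagonalizable)
    from eigenvector_extraction[OF this closed pair y(2,1)] obtain y'
      where "y' \<in> ?V" "bracket ?z y' = scale (- \<gamma> ?z) y'" "form x y' \<noteq> 0" by blast
    then show ?case by (auto simp: atLeastAtMostSuc_conv)
  qed
  from this[of N] obtain y where y: "form x y \<noteq> 0"
    "\<And>a. a \<in> {1..N} \<Longrightarrow> bracket (H a) y = scale (- \<gamma> (H a)) y" by auto
  have "bracket z y = scale (- \<gamma> z) y" if z: "z \<in> \<hh>" for z
  proof -
    let ?c = "\<lambda>a. form z (H (N + 1 - a)) / of_nat cox"
    have "bracket z y = (\<Sum>a=1..N. scale (?c a) (bracket (H a) y))"
      by (subst cartan_expansion[OF z]) (simp only: bracket_sum_left bracket_scale_left)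
    also have "\<dots> = (\<Sum>a=1..N. scale (- (?c a * \<gamma> (H a))) y)"
      by (intro sum.cong refl) (simp add: y(2))
    also have "\<dots> = scale (- (\<Sum>a=1..N. ?c a * \<gamma> (H a))) y"
      by (simp add: scale_sum_left flip: sum_negf)
    also have "(\<Sum>a=1..N. ?c a * \<gamma> (H a)) = \<gamma> z"
      using dual_expansion[OF \<gamma> z] by simp
    finally show ?thesis .
  qed
  then show ?thesis using y(1) by (intro that[of y]) (auto simp: root_space_def)
qed

lemma M_pow_mult_fixed: "(M ^^ n) x = x \<Longrightarrow> (M ^^ (n * j)) x = x"
  by (induction j) (auto simp: funpow_add)

lemma M_pow_sum: "(M ^^ k) (sum f A) = (\<Sum>x\<in>A. (M ^^ k) (f x))"
  by (induction k) (auto simp: M_sum)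

lemma M_pow_M_pow: "(M ^^ k) ((M ^^ l) x) = (M ^^ (k + l)) x"
  by (simp add: funpow_add)

lemma sum_shift_cyclic:
  fixes f :: "nat \<Rightarrow> 'g"
  assumes "f n = f 0"
  shows "(\<Sum>k<n. f (Suc k)) = (\<Sum>k<n. f k)"
  using sum_lessThan_telescope[of f n] assms by (simp add: sum_subtractf)

text \<open>Averaging over the powers of \<open>M\<^sup>h\<close>, which form a finite group, changes the product with the fixed
  vector \<open>x\<close> by a positive factor only.\<close>

lemma fixed_opposite_root_vector:
  assumes \<gamma>: "\<gamma> \<in> dual_space \<hh>" "\<gamma> \<noteq> (\<lambda>_. 0)"
    and x: "x \<in> root_space \<hh> \<gamma>" "x \<noteq> 0" "(M ^^ cox) x = x"
  obtains y where "y \<in> root_space \<hh> (\<lambda>z. - \<gamma> z)" "(M ^^ cox) y = y" "form x y \<noteq> 0"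
proof -
  obtain y where y: "y \<in> root_space \<hh> (\<lambda>z. - \<gamma> z)" "form x y \<noteq> 0"
    using opposite_root_vector[OF \<gamma>(1) x(1,2)] .
  obtain r where r: "r > 0" "M ^^ r = id" using finite_order by blast
  let ?f = "\<lambda>j. (M ^^ (cox * j)) y"
  let ?y = "\<Sum>j<r. ?f j"
  have f_root: "?f j \<in> root_space \<hh> (\<lambda>z. - \<gamma> z)" for j
  proof -
    have "(dual_action \<hh> M ^^ (cox * j)) \<delta> = \<delta>" if "\<delta> \<in> dual_space \<hh>" for \<delta>
      using that dual_action_pow_cox by (induction j) (auto simp: funpow_add)
    then show ?thesis
      using root_space_M_pow[OF y(1), of "cox * j"] dual_uminus[OF \<gamma>(1)] by simp
  qed
  have "?y \<in> root_space \<hh> (\<lambda>z. - \<gamma> z)"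
    using f_root by (simp add: root_space_def bracket_sum_right scale_sum_right sum_negf)
  moreover have "?f r = ?f 0"
    using M_pow_mult_fixed[of r y cox] r by (simp add: mult.commute)
  then have "(M ^^ cox) ?y = ?y"
    using sum_shift_cyclic[of ?f r] by (simp add: M_pow_sum M_pow_M_pow)
  moreover have "form x (?f j) = form x y" for j
    using form_M_pow_opposite_roots[OF \<gamma> x(1) y(1), of "cox * j"] M_pow_mult_fixed[OF x(3)] by simp
  then have "form x ?y = of_nat r * form x y"
    by (simp add: form_sum_right)
  ultimately show ?thesis using that r y(2) by simp
qed

lemma root_opposite:
  assumes "\<gamma> \<in> roots \<hh>"
  shows "(\<lambda>z. - \<gamma> z) \<in> roots \<hh>"
proof -
  have \<gamma>: "\<gamma> \<in> dual_space \<hh>" "\<gamma> \<noteq> (\<lambda>_. 0)" "root_space \<hh> \<gamma> \<noteq> {0}"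
    using assms by (auto simp: roots_def)
  have "0 \<in> root_space \<hh> \<gamma>" by (simp add: root_space_def)
  then obtain x where "x \<in> root_space \<hh> \<gamma>" "x \<noteq> 0" using \<gamma>(3) by blast
  then obtain y where y: "y \<in> root_space \<hh> (\<lambda>z. - \<gamma> z)" "form x y \<noteq> 0"
    using opposite_root_vector[OF \<gamma>(1)] by blast
  then have "y \<noteq> 0" by auto
  then show ?thesis
    using y \<gamma> dual_uminus[OF \<gamma>(1)] by (auto simp: roots_def fun_eq_iff)
qed

text \<open>\<open>M\<close> permutes the chosen root vectors in the same way as their roots, and \<open>M\<^sup>h\<close> fixes every root.\<close>

lemma Av_fixed:
  assumes "\<gamma> \<in> roots \<hh>"
  shows "(M ^^ cox) (Av \<gamma>) = Av \<gamma>"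
proof -
  have step: "dual_action \<hh> M \<delta> \<in> roots \<hh> \<and> M (Av \<delta>) = Av (dual_action \<hh> M \<delta>)" if \<delta>: "\<delta> \<in> roots \<hh>" for \<delta>
  proof -
    have "M (Av \<delta>) \<in> Av ` roots \<hh>" using \<delta> Av_invariant by blast
    then obtain \<epsilon> where \<epsilon>: "\<epsilon> \<in> roots \<hh>" "M (Av \<delta>) = Av \<epsilon>" by blast
    have d: "dual_action \<hh> M \<delta> \<in> dual_space \<hh>" "\<epsilon> \<in> dual_space \<hh>"
      using \<delta> \<epsilon> dual_action_dual by (auto simp: roots_def)
    have "M (Av \<delta>) \<in> root_space \<hh> (dual_action \<hh> M \<delta>)" "Av \<epsilon> \<in> root_space \<hh> \<epsilon>" "Av \<epsilon> \<noteq> 0"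
      using Av_root[OF \<delta>] Av_root[OF \<epsilon>(1)] root_space_M by auto
    then have "scale (dual_action \<hh> M \<delta> z) (Av \<epsilon>) = scale (\<epsilon> z) (Av \<epsilon>)" if "z \<in> \<hh>" for z
      using that \<epsilon>(2) by (metis root_spaceD)
    then have "dual_action \<hh> M \<delta> = \<epsilon>"
      using \<open>Av \<epsilon> \<noteq> 0\<close> by (intro dual_eqI d) (auto simp: H_in_cartan)
    then show ?thesis using \<epsilon> by simp
  qed
  have "(dual_action \<hh> M ^^ k) \<gamma> \<in> roots \<hh> \<and> (M ^^ k) (Av \<gamma>) = Av ((dual_action \<hh> M ^^ k) \<gamma>)" for k
    using assms step by (induction k) auto
  from this[of cox] show ?thesis
    using assms dual_action_pow_cox by (auto simp: roots_def)
qed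

section \<open>Averaged loops\<close>

text \<open>The average of \<open>x t\<^sup>n\<close> is \<open>wave x n t\<^sup>n\<close> if \<open>M\<^sup>h x = x\<close>.\<close>

definition wave :: "'g \<Rightarrow> int \<Rightarrow> 'g" where
  "wave x n = scale (1 / of_nat cox) (\<Sum>k<cox. scale (eta powi (- n * int k)) ((M ^^ k) x))"

lemma loop_elem_add: "loop_elem (x + y) n = loop_elem x n + loop_elem y n"
  by (simp add: loop_elem_def single_add)

lemma loop_elem_sum: "loop_elem (sum f A) n = (\<Sum>x\<in>A. loop_elem (f x) n)"
proof (induction A rule: infinite_finite_induct)
  case (insert x A)
  then show ?case by (simp add: loop_elem_add)
qed (auto simp: loop_elem_def zero_prod_def)

lemma map_scale_zero [simp]: "Poly_Mapping.map (scale c) 0 = 0"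
  by (rule poly_mapping_eqI) (simp add: Poly_Mapping.map.rep_eq)

lemma affine_scale_loop: "affine_scale c (loop_elem x n) = loop_elem (scale c x) n"
  by (simp add: loop_elem_def)

lemma M_affine_loop: "M_affine (loop_elem x n) = loop_elem (scale (eta powi (- n)) (M x)) n"
  by (auto simp: loop_elem_def intro!: poly_mapping_eqI)
    (simp add: lookup_mapp lookup_single when_def in_keys_iff)

lemma M_affine_pow_loop:
  "(M_affine ^^ k) (loop_elem x n) = loop_elem (scale (eta powi (- n * int k)) ((M ^^ k) x)) n"
proof (induction k)
  case (Suc k)
  have "eta powi (- n) * eta powi (- n * int k) = eta powi (- n * int (Suc k))"
    by (simp add: algebra_simps flip: power_int_add)
  then show ?case using Suc by (simp add: M_affine_loop M_scale)
qed simp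

lemma average_eq_wave:
  assumes "(M ^^ cox) x = x"
  shows "average x n = loop_elem (wave x n) n"
proof -
  let ?f = "\<lambda>k. scale (eta powi (- n * int k)) ((M ^^ k) x)"
  have "?f cox = ?f 0"
    using eta_powi_cox[of "- n"] assms by (simp add: mult.commute)
  then have "(\<Sum>k=1..cox. ?f k) = (\<Sum>k<cox. ?f k)"
    using sum_shift_cyclic[of ?f cox] by (simp add: sum.atLeast1_atMost_eq)
  then show ?thesis
    unfolding average_def M_affine_pow_loop loop_elem_sum[symmetric] affine_scale_loop wave_def by simp
qed

lemma M_wave:
  assumes "(M ^^ cox) x = x"
  shows "M (wave x n) = scale (eta powi n) (wave x n)"
proof -
  let ?f = "\<lambda>k. scale (eta powi (- n * int k)) ((M ^^ k) x)"
  have "M (?f k) = scale (eta powi n) (?f (Suc k))" for k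
    by (simp add: M_scale algebra_simps flip: power_int_add)
  then have "M (sum ?f {..<cox}) = scale (eta powi n) (\<Sum>k<cox. ?f (Suc k))"
    unfolding M_sum scale_sum_right by simp
  also have "(\<Sum>k<cox. ?f (Suc k)) = sum ?f {..<cox}"
    using eta_powi_cox[of "- n"] assms by (intro sum_shift_cyclic) (simp add: mult.commute)
  finally show ?thesis
    unfolding wave_def M_scale by (simp add: mult.commute)
qed

lemma wave_periodic: "wave x (n + int cox * l) = wave x n"
proof -
  have "eta powi (- (n + int cox * l) * int k) = eta powi (- n * int k)" for k
    using eta_powi_cox[of "- (l * int k)"]
    by (simp add: algebra_simps power_int_diff power_int_minus_divide)
  then show ?thesis by (simp add: wave_def)
qed

lemma wave_H:
  assumes "a \<in> {1..N}" "eta powi n = eta powi int (m a)"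
  shows "wave (H a) n = H a"
proof -
  have MH: "(M ^^ k) (H a) = scale (eta powi (int (m a) * int k)) (H a)" for k
  proof (induction k)
    case (Suc k)
    then show ?case using assms(1)
      by (simp add: M_scale M_H algebra_simps power_int_add)
  qed simp
  have "eta powi (- n * int k) * eta powi (int (m a) * int k) = 1" for k
    using assms(2) by (simp add: power_int_mult power_int_minus flip: power_int_mult_distrib)
  then have "(\<Sum>k<cox. scale (eta powi (- n * int k)) ((M ^^ k) (H a))) = (\<Sum>k<cox. scale 1 (H a))"
    unfolding MH scale_scale by (simp only:)
  also have "\<dots> = scale (of_nat cox) (H a)"
    by (subst scale_sum_left[symmetric]) simp
  finally show ?thesis
    using cox_pos by (simp add: wave_def)
qed

lemma bracket_H_wave:
  assumes "\<gamma> \<in> dual_space \<hh>" "x \<in> root_space \<hh> \<gamma>" "a \<in> {1..N}" "eta powi n = eta powi int (m a)"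
  shows "bracket (H a) (wave x l) = scale (\<gamma> (H a)) (wave x (n + l))"
proof -
  have summand: "bracket (H a) (scale (eta powi (- l * int k)) ((M ^^ k) x)) =
      scale (\<gamma> (H a)) (scale (eta powi (- (n + l) * int k)) ((M ^^ k) x))" for k
  proof -
    have "eta powi (- (n + l) * int k) = eta powi (- l * int k) * eta powi (- (n * int k))"
      by (simp add: algebra_simps flip: power_int_add)
    also have "eta powi (- (n * int k)) = eta powi (- int (k * m a))"
      using assms(4) by (simp add: power_int_minus power_int_mult mult.commute[of "int k"])
    finally show ?thesis
      using root_spaceD[OF root_space_M_pow[OF assms(2)] H_in_cartan[OF assms(3)], of k]
        dual_action_pow_H[OF assms(1,3), of k]
      by (simp add: bracket_scale_right mult_ac)
  qed
  show ?thesis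
    unfolding wave_def bracket_scale_right[of "H a" "1 / of_nat cox"] bracket_sum_right summand
    by (simp only: scale_sum_right scale_scale mult_ac)
qed

lemma form_H_wave:
  assumes \<gamma>: "\<gamma> \<in> dual_space \<hh>" "\<gamma> \<noteq> (\<lambda>_. 0)" and x: "x \<in> root_space \<hh> \<gamma>" and a: "a \<in> {1..N}"
  shows "form (H a) (wave x l) = 0"
proof -
  have "\<exists>b\<in>{1..N}. \<gamma> (H b) \<noteq> 0"
  proof (rule ccontr)
    assume "\<not> ?thesis"
    then have "\<gamma> = (\<lambda>_. 0)" using \<gamma> by (intro dual_eqI) (auto simp: dual_space_def)
    with \<gamma> show False by simp
  qed
  then obtain b where b: "b \<in> {1..N}" "\<gamma> (H b) \<noteq> 0" by blast
  have "\<gamma> (H b) * form (H a) (wave x l) = form (H a) (bracket (H b) (wave x (l - int (m b))))"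
    using bracket_H_wave[OF \<gamma>(1) x b(1), of "int (m b)"] by (simp add: form_scale_right)
  also have "\<dots> = 0"
    using cartan_abelian[OF H_in_cartan[OF a] H_in_cartan[OF b(1)]] by (simp flip: form_bracket)
  finally show ?thesis using b by simp
qed

text \<open>The vectors \<open>M\<^sup>k x\<close> and \<open>M\<^sup>l y\<close> belong to the roots \<open>M\<^sup>k \<gamma>\<close> and \<open>- M\<^sup>l \<gamma>\<close>, which cancel only for
  \<open>k = l\<close> because the orbit of \<open>\<gamma>\<close> has \<open>h\<close> elements. Each of the \<open>h\<close> diagonal terms equals
  \<open>(x | y)\<close>.\<close>

lemma form_wave_wave:
  assumes \<gamma>: "\<gamma> \<in> dual_space \<hh>" "\<gamma> \<noteq> (\<lambda>_. 0)" and free: "inj_on (\<lambda>k. (dual_action \<hh> M ^^ k) \<gamma>) {..<cox}"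
    and x: "x \<in> root_space \<hh> \<gamma>" and y: "y \<in> root_space \<hh> (\<lambda>z. - \<gamma> z)"
  shows "form (wave x n) (wave y (- n)) = form x y / of_nat cox"
proof -
  have orth: "form ((M ^^ k) x) ((M ^^ l) y) = (if k = l then form x y else 0)"
    if "k < cox" "l < cox" for k l
  proof (cases "k = l")
    case True
    then show ?thesis using form_M_pow_opposite_roots[OF \<gamma> x y] by simp
  next
    case False
    then have "(dual_action \<hh> M ^^ k) \<gamma> \<noteq> (dual_action \<hh> M ^^ l) \<gamma>"
      using that inj_onD[OF free] by auto
    then obtain a where a: "a \<in> {1..N}"
      "(dual_action \<hh> M ^^ k) \<gamma> (H a) \<noteq> (dual_action \<hh> M ^^ l) \<gamma> (H a)"
      using dual_eqI dual_action_pow_dual[OF \<gamma>(1)] by blast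
    show ?thesis
      using form_root_vectors[OF root_space_M_pow[OF x] root_space_M_pow[OF y] H_in_cartan[OF a(1)], of k l]
        a False by (simp add: dual_action_pow_uminus)
  qed
  have "form (wave x n) (wave y (- n)) = (\<Sum>l<cox. \<Sum>k<cox.
      eta powi (- n * int k) * eta powi (n * int l) * form ((M ^^ k) x) ((M ^^ l) y)) / of_nat cox / of_nat cox"
    by (simp add: wave_def form_scale_left form_scale_right form_sum_left form_sum_right sum_distrib_left
      sum_divide_distrib mult_ac)
  also have "(\<Sum>l<cox. \<Sum>k<cox.
      eta powi (- n * int k) * eta powi (n * int l) * form ((M ^^ k) x) ((M ^^ l) y)) =
      (\<Sum>l<cox. \<Sum>k<cox. if k = l then form x y else 0)"
    using orth by (intro sum.cong refl) (auto simp flip: power_int_add)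
  also have "\<dots> = of_nat cox * form x y" by simp
  finally show ?thesis using cox_pos by simp
qed

lemma loop_invariant: "scale (eta powi (- n)) (M x) = x \<Longrightarrow> loop_elem x n \<in> invariants"
  by (simp add: invariants_def M_affine_loop)

lemma wave_invariant: "(M ^^ cox) x = x \<Longrightarrow> loop_elem (wave x n) n \<in> invariants"
  by (intro loop_invariant) (simp add: M_wave flip: power_int_add)

lemma affine_bracket_loop:
  "affine_bracket (loop_elem x n) (loop_elem y l) =
     loop_elem (bracket x y) (n + l) + affine_scale (if n + l = 0 then of_int n * form x y else 0) central_K"
proof (cases "x = 0 \<or> y = 0")
  case True
  then show ?thesis
    by (auto simp: loop_elem_def central_K_def lookup_single mapp_def when_def intro!: poly_mapping_eqI)
next
  case False
  have "Poly_Mapping.mapp (\<lambda>m. scale (0 * of_int m)) g = 0" for g :: "int \<Rightarrow>\<^sub>0 'g"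
    by (rule poly_mapping_eqI) (simp add: lookup_mapp)
  then show ?thesis using False
    by (auto simp: loop_elem_def central_K_def lookup_single when_def)
qed

lemma affine_bracket_derivation:
  "affine_bracket (0, 0, 1) (loop_elem x n) = loop_elem (scale (of_int n) x) n"
  by (auto simp: loop_elem_def intro!: poly_mapping_eqI)
    (simp add: lookup_mapp lookup_single lookup_minus lookup_add when_def in_keys_iff)

lemma derivation_invariant: "(0, 0, 1) \<in> invariants" and central_K_invariant: "affine_scale c central_K \<in> invariants"
  by (auto simp: invariants_def central_K_def lookup_mapp intro!: poly_mapping_eqI)

end

section \<open>The basic representation\<close>

context principal_realization
begin

lemma average_invariant: "(M ^^ cox) x = x \<Longrightarrow> average x n \<in> invariants"
  by (simp add: average_eq_wave wave_invariant)

lemma average_H: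
  assumes "a \<in> {1..N}" "eta powi n = eta powi int (m a)"
  shows "average (H a) n = loop_elem (H a) n" "loop_elem (H a) n \<in> invariants"
  using average_eq_wave[of "H a" n] wave_invariant[of "H a" n] wave_H[OF assms]
    M_pow_cox[OF H_in_cartan[OF assms(1)]] by simp_all

lemma eta_weight_star:
  assumes "v \<in> E_plus N"
  shows "eta powi (- int (weight v)) = eta powi int (m (N + 1 - fst v))"
proof -
  have "int (m (N + 1 - fst v)) = - int (m (fst v)) + int cox * 1"
    using exponent_duality[of "fst v"] assms by (simp add: in_E_plus)
  then have "eta powi int (m (N + 1 - fst v)) = eta powi (- int (m (fst v))) * eta powi (int cox * 1)"
    by (simp only: power_int_add eta_neq_0 simp_thms)
  then have "eta powi int (m (N + 1 - fst v)) = eta powi (- int (m (fst v)))"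
    unfolding eta_powi_cox by simp
  then show ?thesis using eta_powi_weight[OF assms] by (simp add: power_int_minus)
qed

lemma rho_positive:
  assumes "v \<in> E_plus N"
  shows "loop_elem (H (fst v)) (int (weight v)) \<in> invariants"
    and "p \<in> fock_space N \<Longrightarrow> \<rho> (loop_elem (H (fst v)) (int (weight v))) p = partial v p"
  using average_H[of "fst v" "int (weight v)"] assms eta_powi_weight[OF assms] rho_annihilation[OF assms]
  by (auto simp: in_E_plus)

lemma rho_negative:
  assumes "v \<in> E_plus N"
  shows "loop_elem (H (N + 1 - fst v)) (- int (weight v)) \<in> invariants"
    and "p \<in> fock_space N \<Longrightarrow>
      \<rho> (loop_elem (H (N + 1 - fst v)) (- int (weight v))) p = pscale (of_nat (weight v)) (yvar v * p)"
  using average_H[of "N + 1 - fst v" "- int (weight v)"] assms eta_weight_star[OF assms]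
    rho_creation[OF assms] star_index[of "fst v"]
  by (auto simp: in_E_plus)

lemma affine_scale_1 [simp]: "affine_scale 1 x = x"
  by (cases x) (auto intro!: poly_mapping_eqI simp: Poly_Mapping.map.rep_eq when_def)

lemma affine_scale_0 [simp]: "affine_scale 0 x = 0"
  by (cases x) (auto intro!: poly_mapping_eqI simp: Poly_Mapping.map.rep_eq when_def zero_prod_def)

text \<open>The operator by which \<open>d\<close> acts is a constant minus the weighted degree. What is used of this is
  that taking the constant coefficient is an eigenfunctional of it (\<open>const_coeff_D\<close>) and the vacuum an
  eigenvector (\<open>D_vacuum\<close>), with the same eigenvalue.\<close>

definition D :: "fock \<Rightarrow> fock" where "D = \<rho> (0, 0, 1)"

lemma D_closed: "p \<in> fock_space N \<Longrightarrow> D p \<in> fock_space N"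
  and D_add: "p \<in> fock_space N \<Longrightarrow> q \<in> fock_space N \<Longrightarrow> D (p + q) = D p + D q"
  and D_scale: "p \<in> fock_space N \<Longrightarrow> D (pscale c p) = pscale c (D p)"
  using derivation_invariant by (simp_all add: D_def rho_closed rho_add rho_scale)

lemma D_zero [simp]: "D 0 = 0"
  using D_scale[of 0 0] by simp

lemma D_loop:
  assumes "loop_elem x n \<in> invariants" "p \<in> fock_space N"
  shows "D (\<rho> (loop_elem x n) p) = \<rho> (loop_elem x n) (D p) + pscale (of_int n) (\<rho> (loop_elem x n) p)"
proof -
  have "pscale (of_int n) (\<rho> (loop_elem x n) p) = \<rho> (affine_bracket (0, 0, 1) (loop_elem x n)) p"
    unfolding affine_bracket_derivation affine_scale_loop[symmetric] using assms by (simp add: rho_scale_left)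
  also have "\<dots> = D (\<rho> (loop_elem x n) p) - \<rho> (loop_elem x n) (D p)"
    using assms derivation_invariant by (simp add: rho_bracket D_def)
  finally show ?thesis by simp
qed

lemma const_coeff_D:
  assumes "p \<in> fock_space N"
  shows "Poly_Mapping.lookup (D p) 0 = Poly_Mapping.lookup (D 1) 0 * Poly_Mapping.lookup p 0"
  using assms
proof (induction p rule: fock_space_induct)
  case (mult p v)
  let ?w = "of_nat (weight v) :: complex"
  have "pscale ?w (D (yvar v * p)) = D (pscale ?w (yvar v * p))"
    using mult by (simp add: D_scale fock_space_yvar_mult)
  also have "\<dots> = pscale ?w (yvar v * D p) + pscale (- ?w) (pscale ?w (yvar v * p))"
    using D_loop[OF rho_negative(1)[OF mult.hyps(2)] mult.hyps(1)] mult.hyps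
    by (simp only: rho_negative(2) D_closed) simp
  finally have "Poly_Mapping.lookup (pscale ?w (D (yvar v * p))) 0 = 0"
    by (simp add: lookup_minus)
  then show ?case using weight_pos[OF mult.hyps(2)] by simp
qed (auto simp: lookup_one lookup_add D_add D_scale algebra_simps)

lemma D_vacuum: "D 1 = pscale (Poly_Mapping.lookup (D 1) 0) 1"
proof -
  let ?p = "D 1 - pscale (Poly_Mapping.lookup (D 1) 0) 1"
  have "?p = 0"
  proof (rule fock_zero_if_derivatives_vanish_at_zero[where S = "{?p}" and N = N])
    fix p v assume v: "v \<in> E_plus N" and p: "p \<in> {?p}"
    have "partial v (D 1) = 0"
      using D_loop[OF rho_positive(1)[OF v] fock_space_one] v by (simp add: rho_positive D_closed)
    then have "partial v p = pscale 0 ?p"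
      using p by (simp add: partial_diff partial_pscale)
    then show "\<exists>c. \<exists>q\<in>{?p}. partial v p = pscale c q" by blast
  qed (auto simp: lookup_minus D_closed intro!: fock_space_diff)
  then show ?thesis by simp
qed

lemma rho_bracket_H:
  assumes \<gamma>: "\<gamma> \<in> dual_space \<hh>" "\<gamma> \<noteq> (\<lambda>_. 0)" and x: "x \<in> root_space \<hh> \<gamma>" "(M ^^ cox) x = x"
    and a: "a \<in> {1..N}" "eta powi k = eta powi int (m a)" and p: "p \<in> fock_space N"
  shows "\<rho> (loop_elem (H a) k) (\<rho> (average x n) p) =
    \<rho> (average x n) (\<rho> (loop_elem (H a) k) p) + pscale (\<gamma> (H a)) (\<rho> (average x (k + n)) p)"
proof -
  have "affine_bracket (loop_elem (H a) k) (average x n) = affine_scale (\<gamma> (H a)) (average x (k + n))"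
    using bracket_H_wave[OF \<gamma>(1) x(1) a] form_H_wave[OF \<gamma> x(1) a(1)]
    by (simp add: average_eq_wave[OF x(2)] affine_bracket_loop affine_scale_loop)
  then have "pscale (\<gamma> (H a)) (\<rho> (average x (k + n)) p) =
      \<rho> (affine_bracket (loop_elem (H a) k) (average x n)) p"
    using p average_invariant[OF x(2)] by (simp add: rho_scale_left)
  then show ?thesis
    using p average_invariant[OF x(2)] average_H(2)[OF a] by (simp add: rho_bracket)
qed

text \<open>The exchange relations are the brackets with the Heisenberg algebra. As the vacuum and the constant
  coefficient have the same eigenvalue under \<open>d\<close>, only the mode \<open>0\<close>, which commutes with \<open>d\<close>, can have a
  nonzero vacuum expectation.\<close>

proposition wave_vertex_family:
  assumes \<gamma>: "\<gamma> \<in> dual_space \<hh>" "\<gamma> \<noteq> (\<lambda>_. 0)" and x: "x \<in> root_space \<hh> \<gamma>" "(M ^^ cox) x = x"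
  shows "vertex_family N weight (\<lambda>v. \<gamma> (H (fst v))) (\<lambda>v. \<gamma> (H (N + 1 - fst v)) / of_nat (weight v))
    (\<lambda>n. \<rho> (average x (- n)))"
proof
  fix p n assume p: "p \<in> fock_space N"
  note inv = average_invariant[OF x(2)]
  show "\<rho> (average x (- n)) p \<in> fock_space N" using p inv by (intro rho_closed)
  show "\<rho> (average x (- n)) (p + q) = \<rho> (average x (- n)) p + \<rho> (average x (- n)) q"
    if "q \<in> fock_space N" for q
    using p inv that by (intro rho_add)
  show "\<rho> (average x (- n)) (pscale k p) = pscale k (\<rho> (average x (- n)) p)" for k
    using p inv by (intro rho_scale)
  fix v assume v: "v \<in> E_plus N"
  then have a: "fst v \<in> {1..N}" "N + 1 - fst v \<in> {1..N}" by (auto simp: in_E_plus)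
  show "partial v (\<rho> (average x (- n)) p) = \<rho> (average x (- n)) (partial v p) +
      pscale (\<gamma> (H (fst v))) (\<rho> (average x (- (n - int (weight v)))) p)"
    using rho_bracket_H[OF \<gamma> x a(1) eta_powi_weight[OF v] p, of "- n"] p inv
    by (simp add: rho_positive(2)[OF v] rho_closed algebra_simps)
  let ?w = "of_nat (weight v) :: complex"
  have "pscale ?w (yvar v * \<rho> (average x (- n)) p) = \<rho> (average x (- n)) (pscale ?w (yvar v * p)) +
      pscale (\<gamma> (H (N + 1 - fst v))) (\<rho> (average x (- (n + int (weight v)))) p)"
    using rho_bracket_H[OF \<gamma> x a(2) eta_weight_star[OF v] p, of "- n"] p inv
    by (simp only: rho_negative(2)[OF v] rho_closed) (simp add: algebra_simps)
  then have "pscale ?w (\<rho> (average x (- n)) (yvar v * p)) = pscale ?w (yvar v * \<rho> (average x (- n)) p) -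
      pscale (\<gamma> (H (N + 1 - fst v))) (\<rho> (average x (- (n + int (weight v)))) p)"
    using p v inv by (simp add: rho_scale fock_space_yvar_mult)
  then have "pscale (1 / ?w) (pscale ?w (\<rho> (average x (- n)) (yvar v * p))) =
      pscale (1 / ?w) (pscale ?w (yvar v * \<rho> (average x (- n)) p) -
      pscale (\<gamma> (H (N + 1 - fst v))) (\<rho> (average x (- (n + int (weight v)))) p))"
    by (rule arg_cong)
  then show "\<rho> (average x (- n)) (yvar v * p) = yvar v * \<rho> (average x (- n)) p -
      pscale (\<gamma> (H (N + 1 - fst v)) / ?w) (\<rho> (average x (- (n + int (weight v)))) p)"
    using weight_pos[OF v] by (simp add: pscale.scale_right_diff_distrib)
next
  fix n :: int assume n: "n \<noteq> 0"
  let ?p = "\<rho> (average x (- n)) 1" and ?e = "Poly_Mapping.lookup (D 1) 0"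
  note inv = average_invariant[OF x(2)]
  have p: "?p \<in> fock_space N" using inv by (intro rho_closed fock_space_one)
  have "\<rho> (average x (- n)) (D 1) = pscale ?e ?p"
    by (subst D_vacuum) (intro rho_scale inv fock_space_one)
  then have "D ?p = pscale ?e ?p + pscale (of_int (- n)) ?p"
    using D_loop[OF wave_invariant[OF x(2)] fock_space_one, of "- n"]
    by (simp add: average_eq_wave[OF x(2)])
  then have "?e * Poly_Mapping.lookup ?p 0 = ?e * Poly_Mapping.lookup ?p 0 - of_int n * Poly_Mapping.lookup ?p 0"
    using const_coeff_D[OF p] by (simp add: lookup_minus)
  then show "Poly_Mapping.lookup ?p 0 = 0" using n by simp
qed

text \<open>As \<open>x t\<^sup>k\<close> with \<open>k > 0\<close> annihilates the vacuum, the product may be replaced by a commutator. The finite part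
  of the bracket depends on \<open>k\<close> only modulo \<open>h\<close>. The central part is \<open>k (x | y) / h\<close> times \<open>K\<close>, and
  \<open>K\<close> acts by \<open>1 / h\<close>.\<close>

proposition two_point_linear_plus_periodic:
  assumes \<gamma>: "\<gamma> \<in> dual_space \<hh>" "\<gamma> \<noteq> (\<lambda>_. 0)" and free: "inj_on (\<lambda>k. (dual_action \<hh> M ^^ k) \<gamma>) {..<cox}"
    and x: "x \<in> root_space \<hh> \<gamma>" "(M ^^ cox) x = x"
    and y: "y \<in> root_space \<hh> (\<lambda>z. - \<gamma> z)" "(M ^^ cox) y = y"
  obtains per :: "nat \<Rightarrow> complex" where "\<And>k. per (k + cox) = per k"
    "\<And>k. 0 < k \<Longrightarrow> Poly_Mapping.lookup (\<rho> (average x (int k)) (\<rho> (average y (- int k)) 1)) 0 =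
       per k + of_nat k * (form x y / of_nat cox ^ 2)"
proof
  let ?z = "\<lambda>k. loop_elem (bracket (wave x (int k)) (wave y (- int k))) 0"
  let ?per = "\<lambda>k. Poly_Mapping.lookup (\<rho> (?z k) 1) 0"
  show "?per (k + cox) = ?per k" for k
    using wave_periodic[of x "int k" 1] wave_periodic[of y "- int k" "-1"] by (simp add: algebra_simps)
  fix k :: nat assume k: "0 < k"
  interpret X: vertex_family N weight "\<lambda>v. \<gamma> (H (fst v))" "\<lambda>v. \<gamma> (H (N + 1 - fst v)) / of_nat (weight v)"
    "\<lambda>n. \<rho> (average x (- n))"
    by (rule wave_vertex_family[OF \<gamma> x])
  let ?x = "average x (int k)" and ?y = "average y (- int k)"
  have inv: "?x \<in> invariants" "?y \<in> invariants" using x y by (auto intro: average_invariant)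
  have vac: "\<rho> ?x 1 = 0" using X.negative_vacuum[of "- int k"] k by simp
  have "\<rho> ?y 0 = pscale 0 (\<rho> ?y 0)" using rho_scale[OF inv(2) fock_space_zero, of 0] by simp
  then have zero: "\<rho> ?y 0 = 0" by simp
  have z: "?z k \<in> invariants"
    using x y by (intro loop_invariant)
      (simp add: M_bracket M_wave bracket_scale_left bracket_scale_right power_int_minus)
  let ?c = "of_nat k * (form x y / of_nat cox)"
  have "affine_bracket ?x ?y = ?z k + affine_scale ?c central_K"
    using form_wave_wave[OF \<gamma> free x(1) y(1), of "int k"]
    by (simp add: average_eq_wave x y affine_bracket_loop)
  then have "\<rho> ?x (\<rho> ?y 1) = \<rho> (?z k + affine_scale ?c central_K) 1"
    using rho_bracket[OF inv fock_space_one] by (simp add: vac zero)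
  also have "\<dots> = \<rho> (?z k) 1 + pscale ?c (pscale (1 / of_nat cox) 1)"
    using z central_K_invariant central_K_invariant[of 1]
    by (simp add: rho_add_left rho_scale_left rho_K)
  finally show "Poly_Mapping.lookup (\<rho> ?x (\<rho> ?y 1)) 0 =
       ?per k + of_nat k * (form x y / of_nat cox ^ 2)"
    by (simp add: lookup_add power2_eq_square)
qed

end

section \<open>A power series with a double pole\<close>

lemma summable_linear_growth:
  fixes F per :: "nat \<Rightarrow> complex"
  assumes h: "0 < h" and per: "\<And>k. per (k + h) = per k"
    and F: "\<And>k. 0 < k \<Longrightarrow> F k = per k + of_nat k * s" and z: "norm z < 1"
  shows "summable (\<lambda>k. norm (F k * z ^ k))"
proof (rule summable_comparison_test')
  define m where "m = Max ((\<lambda>k. norm (per k)) ` {..<h})"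
  define C where "C = norm (F 0) + m + norm s"
  have per_bound: "norm (per k) \<le> m" for k
  proof -
    have "per (l + h * q) = per l" for l q
    proof (induction q)
      case (Suc q)
      have "l + h * Suc q = (l + h * q) + h" by simp
      then show ?case using per[of "l + h * q"] Suc by (simp only:)
    qed simp
    from this[of "k mod h" "k div h"] have "per k = per (k mod h)" by simp
    then show ?thesis using h by (auto simp: m_def intro!: Max_ge)
  qed
  have m_nonneg: "0 \<le> m"
    using per_bound[of 0] norm_ge_zero order_trans by blast
  have C: "m \<le> C" "norm s \<le> C"
    unfolding C_def using m_nonneg norm_ge_zero[of "F 0"] norm_ge_zero[of s] by linarith+
  have F_bound: "norm (F k) \<le> C * of_nat (Suc k)" for k
  proof (cases "k = 0")
    case True
    then show ?thesis using m_nonneg by (simp add: C_def)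
  next
    case False
    have "norm (F k) \<le> norm (per k) + of_nat k * norm s"
      using F[of k] False norm_triangle_ineq[of "per k" "of_nat k * s"] by (simp add: norm_mult)
    also have "\<dots> \<le> C * 1 + of_nat k * C"
      using per_bound[of k] C by (intro add_mono mult_left_mono) auto
    finally show ?thesis by (simp add: algebra_simps)
  qed
  have "summable (\<lambda>k. of_nat (Suc k) * norm z ^ k)"
    using geometric_deriv_sums[of "norm z"] z by (auto simp: sums_iff)
  then show "summable (\<lambda>k. C * (of_nat (Suc k) * norm z ^ k))" by (rule summable_mult)
  show "norm (norm (F k * z ^ k)) \<le> C * (of_nat (Suc k) * norm z ^ k)" for k
    using mult_right_mono[OF F_bound[of k], of "norm z ^ k"]
    by (simp add: norm_mult norm_power mult.assoc)
qed

text \<open>The recursion says that the power series \<open>g\<close> with coefficients \<open>F\<close> satisfies \<open>g' = B g\<close> with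
  \<open>B(z) = \<Sum>\<^sub>k e\<^sub>k x\<^sub>k / (1 - x\<^sub>k z)\<close>. This is also the logarithmic derivative of
  \<open>\<Prod>\<^sub>k (1 - x\<^sub>k z) powr - e\<^sub>k\<close>.\<close>

lemma power_series_eq_product:
  fixes F b e :: "nat \<Rightarrow> complex" and x :: "nat \<Rightarrow> complex"
  assumes norm_x: "\<And>k. norm (x k) = 1"
    and rec: "\<And>k. of_nat k * F k = (\<Sum>j=1..k. b j * F (k - j))"
    and b: "\<And>j. 0 < j \<Longrightarrow> b j = (\<Sum>k<h. e k * x k ^ j)"
    and F_summable: "\<And>z. norm z < 1 \<Longrightarrow> summable (\<lambda>k. norm (F k * z ^ k))"
    and z: "norm z < 1"
  shows "suminf (\<lambda>k. F k * z ^ k) * exp (\<Sum>k<h. e k * Ln (1 - x k * z)) = F 0"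
proof -
  define g where "g = (\<lambda>z. suminf (\<lambda>k. F k * z ^ k))"
  define B where "B = (\<lambda>z. \<Sum>k<h. e k * (x k / (1 - x k * z)))"
  define Q where "Q = (\<lambda>z. exp (\<Sum>k<h. e k * Ln (1 - x k * z)))"
  have small: "norm (x k * z) < 1" if "norm z < 1" for z k
    using that norm_x[of k] by (simp add: norm_mult)
  have g_deriv: "(g has_field_derivative B z * g z) (at z)" if z: "norm z < 1" for z
  proof -
    obtain r :: real where r: "norm z < r" "r < 1" using z dense by blast
    have "0 \<le> r" using r(1) norm_ge_zero[of z] by linarith
    then have "norm (of_real r :: complex) = r" by simp
    note r = r this
    have "summable (\<lambda>k. F k * of_real r ^ k)"
      by (rule summable_norm_cancel, rule F_summable) (simp only: r)
    then have deriv: "(g has_field_derivative suminf (\<lambda>k. diffs F k * z ^ k)) (at z)"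
      unfolding g_def by (rule termdiffs_strong) (simp only: r)
    have "(\<lambda>j. e k * (x k * (x k * z) ^ j)) sums (e k * (x k * (1 / (1 - x k * z))))" for k
      by (intro sums_mult geometric_sums small z)
    then have "(\<lambda>j. \<Sum>k<h. e k * (x k * (x k * z) ^ j)) sums B z"
      unfolding B_def by (intro sums_sum) simp
    also have "(\<lambda>j. \<Sum>k<h. e k * (x k * (x k * z) ^ j)) = (\<lambda>j. b (Suc j) * z ^ j)"
      by (rule ext) (simp add: b sum_distrib_left power_mult_distrib mult_ac)
    finally have B_sums: "(\<lambda>j. b (Suc j) * z ^ j) sums B z" .
    have B_summable: "summable (\<lambda>j. norm (b (Suc j) * z ^ j))"
    proof (rule summable_comparison_test')
      show "summable (\<lambda>j. (\<Sum>k<h. norm (e k)) * norm z ^ j)"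
        using z by (intro summable_mult summable_geometric) simp
      fix j
      have "norm (b (Suc j)) \<le> (\<Sum>k<h. norm (e k))"
        unfolding b[OF zero_less_Suc]
        by (intro order_trans[OF norm_sum] sum_mono) (simp add: norm_mult norm_power norm_x)
      then show "norm (norm (b (Suc j) * z ^ j)) \<le> (\<Sum>k<h. norm (e k)) * norm z ^ j"
        by (simp add: norm_mult norm_power mult_right_mono)
    qed
    have "(\<lambda>k. \<Sum>i\<le>k. (F i * z ^ i) * (b (Suc (k - i)) * z ^ (k - i))) sums
        (suminf (\<lambda>k. F k * z ^ k) * suminf (\<lambda>k. b (Suc k) * z ^ k))"
      by (rule Cauchy_product_sums[OF F_summable[OF z] B_summable])
    also have "(\<lambda>k. \<Sum>i\<le>k. (F i * z ^ i) * (b (Suc (k - i)) * z ^ (k - i))) = (\<lambda>k. diffs F k * z ^ k)"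
    proof
      fix k
      have "diffs F k = (\<Sum>j=1..Suc k. b j * F (Suc k - j))"
        unfolding diffs_def by (rule rec)
      also have "\<dots> = (\<Sum>i\<le>k. b (Suc (k - i)) * F i)"
        by (intro sum.reindex_bij_witness[where i = "\<lambda>i. Suc k - i" and j = "\<lambda>j. Suc k - j"])
          (auto simp: Suc_diff_le)
      finally have "diffs F k * z ^ k = (\<Sum>i\<le>k. b (Suc (k - i)) * F i * z ^ k)"
        by (simp add: sum_distrib_right)
      also have "\<dots> = (\<Sum>i\<le>k. (F i * z ^ i) * (b (Suc (k - i)) * z ^ (k - i)))"
      proof (intro sum.cong refl)
        fix i assume "i \<in> {..k}"
        then have "z ^ k = z ^ i * z ^ (k - i)" by (simp flip: power_add)
        then show "b (Suc (k - i)) * F i * z ^ k = (F i * z ^ i) * (b (Suc (k - i)) * z ^ (k - i))"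
          by simp
      qed
      finally show "(\<Sum>i\<le>k. (F i * z ^ i) * (b (Suc (k - i)) * z ^ (k - i))) = diffs F k * z ^ k" ..
    qed
    finally have "suminf (\<lambda>k. diffs F k * z ^ k) = g z * B z"
      using B_sums by (simp add: sums_iff g_def)
    then show ?thesis using deriv by (simp add: mult.commute)
  qed
  have Q_deriv: "(Q has_field_derivative - B z * Q z) (at z)" if z: "norm z < 1" for z
  proof -
    have nonpos: "1 - x k * z \<notin> \<real>\<^sub>\<le>\<^sub>0" for k
    proof -
      have "Re (x k * z) < 1" using small[OF z, of k] complex_Re_le_cmod[of "x k * z"] by linarith
      then show ?thesis by (auto simp: complex_nonpos_Reals_iff)
    qed
    have "((\<lambda>z. e k * Ln (1 - x k * z)) has_field_derivative e k * (inverse (1 - x k * z) * (- x k))) (at z)" for k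
    proof (rule DERIV_cmult)
      have "((\<lambda>z. 1 - x k * z) has_field_derivative - x k) (at z)"
        by (auto intro!: derivative_eq_intros)
      from DERIV_chain2[where f = Ln and g = "\<lambda>z. 1 - x k * z" and x = z,
          OF has_field_derivative_Ln[OF nonpos[of k]] this]
      show "((\<lambda>z. Ln (1 - x k * z)) has_field_derivative inverse (1 - x k * z) * (- x k)) (at z)" .
    qed
    then have "(Q has_field_derivative Q z * (\<Sum>k<h. e k * (inverse (1 - x k * z) * (- x k)))) (at z)"
      unfolding Q_def
      by (intro DERIV_chain2[where f = exp and g = "\<lambda>z. \<Sum>k<h. e k * Ln (1 - x k * z)", OF DERIV_exp] DERIV_sum)
    also have "Q z * (\<Sum>k<h. e k * (inverse (1 - x k * z) * (- x k))) = - B z * Q z"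
      by (simp add: B_def sum_negf divide_inverse mult.commute)
    finally show ?thesis .
  qed
  have "((\<lambda>z. g z * Q z) has_field_derivative 0) (at z within ball 0 1)" if "z \<in> ball 0 1" for z
  proof -
    have "norm z < 1" using that by simp
    from DERIV_mult[OF g_deriv[OF this] Q_deriv[OF this]]
    have "((\<lambda>z. g z * Q z) has_field_derivative B z * g z * Q z + - B z * Q z * g z) (at z)" .
    moreover have "B z * g z * Q z + - B z * Q z * g z = 0" by algebra
    ultimately show ?thesis by (simp only: has_field_derivative_at_within)
  qed
  then obtain c where c: "\<And>z. z \<in> ball 0 1 \<Longrightarrow> g z * Q z = c"
    using has_field_derivative_zero_constant[of "ball 0 1" "\<lambda>z. g z * Q z"] by auto
  have "g z * Q z = g 0 * Q 0" using c[of z] c[of 0] z by simp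
  also have "\<dots> = F 0" by (simp add: g_def Q_def powser_zero)
  finally show ?thesis by (simp add: g_def Q_def)
qed

text \<open>Multiplication by \<open>1 - u\<^sup>h\<close> takes differences at distance \<open>h\<close>. They equal \<open>h s\<close>, except that \<open>F 0\<close> does
  not follow the pattern.\<close>

lemma power_series_linear_plus_periodic:
  fixes F per :: "nat \<Rightarrow> complex"
  assumes sm: "summable (\<lambda>k. F k * u ^ k)" and per: "\<And>k. per (k + h) = per k"
    and F: "\<And>k. 0 < k \<Longrightarrow> F k = per k + of_nat k * s" and u: "norm u < 1"
  shows "(1 - u) * (1 - u ^ h) * suminf (\<lambda>k. F k * u ^ k) =
    (1 - u) * ((\<Sum>k<h+1. F k * u ^ k) - F 0 * u ^ h) + of_nat h * s * u ^ (h + 1)"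
proof -
  define g where "g = suminf (\<lambda>k. F k * u ^ k)"
  have jump: "F (k + (h + 1)) = F (k + 1) + of_nat h * s" for k
  proof -
    have "per (k + (h + 1)) = per (k + 1)" using per[of "k + 1"] by (simp add: add_ac)
    then show ?thesis using F[of "k + (h + 1)"] F[of "k + 1"] by (simp add: algebra_simps)
  qed
  have sm': "summable (\<lambda>k. F (k + 1) * u ^ (k + 1))"
    using sm by (subst summable_iff_shift)
  have geo: "summable (\<lambda>k. u ^ k)" "suminf (\<lambda>k. u ^ k) = 1 / (1 - u)"
    using u by (simp_all add: suminf_geometric summable_geometric)
  have solve: "(1 - w) * G = S - f * w + c" if "G = w * (G - f) + c + S" for w G S f c :: complex
    using that by algebra
  have "g = suminf (\<lambda>k. F (k + (h + 1)) * u ^ (k + (h + 1))) + (\<Sum>k<h+1. F k * u ^ k)"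
    unfolding g_def by (rule suminf_split_initial_segment[OF sm])
  also have "(\<lambda>k. F (k + (h + 1)) * u ^ (k + (h + 1))) =
      (\<lambda>k. u ^ h * (F (k + 1) * u ^ (k + 1)) + of_nat h * s * u ^ (h + 1) * u ^ k)"
    unfolding jump by (rule ext) (simp add: algebra_simps power_add)
  also have "suminf (\<lambda>k. u ^ h * (F (k + 1) * u ^ (k + 1)) + of_nat h * s * u ^ (h + 1) * u ^ k) =
      u ^ h * suminf (\<lambda>k. F (k + 1) * u ^ (k + 1)) + of_nat h * s * u ^ (h + 1) * suminf (\<lambda>k. u ^ k)"
    using suminf_add[OF summable_mult[OF sm', of "u ^ h"] summable_mult[OF geo(1), of "of_nat h * s * u ^ (h + 1)"]]
    by (simp only: suminf_mult[OF sm'] suminf_mult[OF geo(1)])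
  also have "suminf (\<lambda>k. F (k + 1) * u ^ (k + 1)) = g - F 0"
    using suminf_split_initial_segment[OF sm, of 1] by (simp add: g_def)
  finally have "(1 - u ^ h) * g = (\<Sum>k<h+1. F k * u ^ k) - F 0 * u ^ h + of_nat h * s * u ^ (h + 1) * (1 / (1 - u))"
    unfolding geo(2) by (rule solve)
  then have "(1 - u) * (1 - u ^ h) * g =
      (1 - u) * ((\<Sum>k<h+1. F k * u ^ k) - F 0 * u ^ h + of_nat h * s * u ^ (h + 1) * (1 / (1 - u)))"
    by (simp only: mult.assoc)
  moreover have "1 - u \<noteq> 0" using u by auto
  ultimately show ?thesis unfolding g_def[symmetric] distrib_left[of "1 - u"] by simp
qed

text \<open>Both sides are the limit of \<open>(1 - u)\<^sup>2 g(u)\<close> as \<open>u\<close> increases to \<open>1\<close>, where \<open>g\<close> is the power series with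
  coefficients \<open>F\<close>: the slope \<open>s\<close> by the growth of the coefficients, and the product because
  \<open>e 0 = 2\<close>.\<close>

proposition slope_eq_product:
  fixes F b e per :: "nat \<Rightarrow> complex" and h :: nat and \<eta> s :: complex
  assumes h: "0 < h" and norm_\<eta>: "norm \<eta> = 1" and \<eta>: "\<And>k. 0 < k \<Longrightarrow> k < h \<Longrightarrow> \<eta> ^ k \<noteq> 1"
    and rec: "\<And>k. of_nat k * F k = (\<Sum>j=1..k. b j * F (k - j))"
    and b: "\<And>j. 0 < j \<Longrightarrow> b j = (\<Sum>k<h. e k * (\<eta> ^ k) ^ j)"
    and e: "e 0 = 2"
    and per: "\<And>k. per (k + h) = per k"
    and F: "\<And>k. 0 < k \<Longrightarrow> F k = per k + of_nat k * s"
  shows "s = F 0 * (\<Prod>k=1..h-1. (1 - \<eta> ^ k) powr (- e k))"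
proof -
  have norm_pow: "norm (\<eta> ^ k) = 1" for k using norm_\<eta> by (simp add: norm_power)
  have F_summable: "summable (\<lambda>k. norm (F k * z ^ k))" if "norm z < 1" for z
    by (rule summable_linear_growth[OF h per F that])
  define g where "g = (\<lambda>u. suminf (\<lambda>k. F k * u ^ k))"
  define L where "L = (\<lambda>u. (1 - u) * ((\<Sum>k<h+1. F k * u ^ k) - F 0 * u ^ h) + of_nat h * s * u ^ (h + 1))"
  define G where "G = (\<lambda>u :: complex. \<Sum>j<h. u ^ j)"
  define R where "R = (\<lambda>u. exp (\<Sum>k=1..<h. e k * Ln (1 - \<eta> ^ k * u)))"
  \<comment> \<open>The identity \<open>(1 - u)\<^sup>2 G(u) g(u) = L(u)\<close>, freed of \<open>g\<close>, extends to \<open>u = 1\<close> by continuity.\<close>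
  have key: "L u * R u = F 0 * G u" if u: "norm u < 1" for u
  proof -
    have "u \<noteq> 1" using u by auto
    have "{..<h} = insert 0 {1..<h}" using h by auto
    then have "exp (\<Sum>k<h. e k * Ln (1 - \<eta> ^ k * u)) = exp (2 * Ln (1 - u)) * R u"
      by (simp add: R_def e exp_add)
    also have "exp (2 * Ln (1 - u)) = (1 - u) ^ 2"
      using \<open>u \<noteq> 1\<close> exp_of_nat_mult[of 2 "Ln (1 - u)"] by simp
    finally have "g u * ((1 - u) ^ 2 * R u) = F 0"
      using power_series_eq_product[OF norm_pow rec b F_summable u] by (simp add: g_def)
    moreover have "L u = (1 - u) * (1 - u ^ h) * g u"
      unfolding L_def g_def
      using power_series_linear_plus_periodic[OF summable_norm_cancel[OF F_summable[OF u]] per F u] ..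
    moreover have "1 - u ^ h = (1 - u) * G u"
      using one_diff_power_eq[of u h] by (simp add: G_def)
    ultimately show ?thesis by (simp only: power2_eq_square ac_simps)
  qed
  have nonpos: "1 - \<eta> ^ k \<notin> \<real>\<^sub>\<le>\<^sub>0" if k: "k \<in> {1..<h}" for k
  proof
    assume "1 - \<eta> ^ k \<in> \<real>\<^sub>\<le>\<^sub>0"
    then have "Im (\<eta> ^ k) = 0" "Re (\<eta> ^ k) \<ge> 1" by (auto simp: complex_nonpos_Reals_iff)
    then have "\<eta> ^ k = 1" using norm_pow[of k] cmod_eq_Re[of "\<eta> ^ k"] by (simp add: complex_eq_iff)
    then show False using \<eta>[of k] k by simp
  qed
  have "isCont R 1"
    unfolding R_def using nonpos by (intro continuous_intros) auto
  moreover have "isCont L 1" unfolding L_def by (intro continuous_intros)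
  ultimately have "((\<lambda>x :: real. L (of_real x) * R (of_real x)) \<longlongrightarrow> L 1 * R 1) (at_left 1)"
    by (intro tendsto_mult isCont_tendsto_compose[of _ L] isCont_tendsto_compose[of _ R])
      (auto intro!: tendsto_eq_intros)
  moreover have "\<forall>\<^sub>F x in at_left 1. L (of_real x) * R (of_real x) = F 0 * G (of_real x)"
    by (rule eventually_mono[OF eventually_at_left_real[of 0 1]]) (auto intro!: key)
  ultimately have "((\<lambda>x :: real. F 0 * G (of_real x)) \<longlongrightarrow> L 1 * R 1) (at_left 1)"
    by (rule Lim_transform_eventually)
  moreover have "isCont G 1" unfolding G_def by (intro continuous_intros)
  then have "((\<lambda>x :: real. F 0 * G (of_real x)) \<longlongrightarrow> F 0 * G 1) (at_left 1)"
    by (intro tendsto_mult tendsto_const isCont_tendsto_compose[of _ G]) (auto intro!: tendsto_eq_intros)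
  ultimately have "L 1 * R 1 = F 0 * G 1"
    by (rule tendsto_unique[OF trivial_limit_at_left_real])
  then have "s * R 1 = F 0" using h by (simp add: L_def G_def)
  moreover have "R 1 * inverse (R 1) = 1" by (simp add: R_def)
  ultimately have "s = F 0 * inverse (R 1)" by (metis mult.assoc mult.right_neutral)
  also have "inverse (R 1) = exp (\<Sum>k=1..<h. - e k * Ln (1 - \<eta> ^ k))"
    by (simp add: R_def sum_negf flip: exp_minus)
  also have "\<dots> = (\<Prod>k=1..<h. exp (- e k * Ln (1 - \<eta> ^ k)))"
    by (rule exp_sum) simp
  also have "\<dots> = (\<Prod>k=1..<h. (1 - \<eta> ^ k) powr (- e k))"
    using \<eta> by (intro prod.cong refl) (auto simp: powr_def)
  also have "{1..<h} = {1..h-1}" using h by auto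
  finally show ?thesis .
qed

section \<open>The Kac--Wakimoto coefficient\<close>

lemma lookup_tensor:
  "Poly_Mapping.lookup (tensor p q) (s, t) = Poly_Mapping.lookup p s * Poly_Mapping.lookup q t"
proof -
  have "Poly_Mapping.lookup (tensor p q) (s, t) = (\<Sum>s'\<in>Poly_Mapping.keys p. \<Sum>t'\<in>Poly_Mapping.keys q.
      if t' = t then (if s' = s then Poly_Mapping.lookup p s' * Poly_Mapping.lookup q t' else 0) else 0)"
    unfolding tensor_def lookup_sum by (intro sum.cong refl) (auto simp: lookup_single)
  also have "\<dots> = (\<Sum>s'\<in>Poly_Mapping.keys p.
      if s' = s then Poly_Mapping.lookup p s' * Poly_Mapping.lookup q t else 0)"
    by (intro sum.cong refl) (auto simp: in_keys_iff)
  also have "\<dots> = Poly_Mapping.lookup p s * Poly_Mapping.lookup q t"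
    by (auto simp: in_keys_iff)
  finally show ?thesis .
qed

lemma tensor_pscale: "tensor (pscale c p) (pscale d q) = pscale (c * d) (tensor p q)"
proof (rule poly_mapping_eqI)
  fix st
  show "Poly_Mapping.lookup (tensor (pscale c p) (pscale d q)) st =
      Poly_Mapping.lookup (pscale (c * d) (tensor p q)) st"
    by (cases st) (simp add: lookup_tensor)
qed

lemma Sum_any_pscale: "Sum_any (\<lambda>i. pscale c (f i)) = pscale c (Sum_any f)"
proof (cases "c = 0")
  case False
  then have "{i. pscale c (f i) \<noteq> 0} = {i. f i \<noteq> 0}" by simp
  then show ?thesis by (simp add: Sum_any.expand_set pscale.scale_sum_right)
qed simp

context coxeter_setup
begin

lemma Gam_vacuum: "Gam \<gamma> 0 1 = 1" "n < 0 \<Longrightarrow> Gam \<gamma> n 1 = 0"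
  by (simp_all add: Gam_one exp_creation_int_def op_exp_def)

lemma series_tensor_Gam_vacuum: "series_tensor (Gam \<gamma>) (Gam \<delta>) 0 1 1 = tensor 1 1"
proof -
  have "tensor p 0 = 0" "tensor 0 p = 0" for p :: fock
    by (simp_all add: tensor_def)
  then have "tensor (Gam \<gamma> i 1) (Gam \<delta> (0 - i) 1) = 0" if "i \<noteq> 0" for i
    using that by (cases "i < 0") (simp_all add: Gam_vacuum)
  then have "series_tensor (Gam \<gamma>) (Gam \<delta>) 0 1 1 = (\<Sum>i\<in>{0}. tensor (Gam \<gamma> i 1) (Gam \<delta> (0 - i) 1))"
    unfolding series_tensor_def by (intro Sum_any.expand_superset) auto
  then show ?thesis by (simp add: Gam_vacuum)
qed

lemma sum_eta_powi: "(\<Sum>k<cox. (eta powi n) ^ k) = (if int cox dvd n then of_nat cox else 0)"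
proof (cases "int cox dvd n")
  case True
  then have "eta powi n = 1" by (simp add: eta_powi_eq_1_iff)
  then show ?thesis using True by simp
next
  case False
  then have "eta powi n \<noteq> 1" by (simp add: eta_powi_eq_1_iff)
  moreover have "(eta powi n) ^ cox = 1"
    using eta_powi_cox[of n] by (simp add: power_int_power' mult.commute)
  ultimately show ?thesis using False by (simp add: sum_gp_strict)
qed

text \<open>A finite Fourier inversion: expanding \<open>(\<gamma> | M\<^sup>k \<gamma>)\<close> in the eigenbasis \<open>H\<close> and summing over \<open>k\<close> keeps
  exactly the indices \<open>a\<close> with \<open>m\<^sub>a \<equiv> j\<close> modulo \<open>h\<close>. As \<open>0 < m\<^sub>a < h\<close>, each of them belongs to exactly one
  variable of weight \<open>j\<close>.\<close>

lemma weight_sum_eq: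
  assumes \<gamma>: "\<gamma> \<in> dual_space \<hh>" and j: "0 < j"
  shows "(\<Sum>v | v \<in> E_plus N \<and> weight v = j. \<gamma> (H (fst v)) * \<gamma> (H (N + 1 - fst v))) =
    (\<Sum>k<cox. dual_form form \<hh> \<gamma> ((dual_action \<hh> M ^^ k) \<gamma>) * (eta ^ k) ^ j)"
proof -
  let ?c = "\<lambda>a. \<gamma> (H a) * \<gamma> (H (N + 1 - a))"
  let ?V = "{v. v \<in> E_plus N \<and> weight v = j}"
  have inj: "inj_on fst ?V"
    using cox_pos by (auto simp: inj_on_def weight_def)
  have image: "fst ` ?V = {a \<in> {1..N}. int cox dvd int j - int (m a)}"
  proof (intro equalityI subsetI)
    fix a assume "a \<in> fst ` ?V"
    then show "a \<in> {a \<in> {1..N}. int cox dvd int j - int (m a)}"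
      by (auto simp: in_E_plus weight_def)
  next
    fix a assume "a \<in> {a \<in> {1..N}. int cox dvd int j - int (m a)}"
    then have a: "a \<in> {1..N}" and "int cox dvd int j - int (m a)" by auto
    then obtain q where q: "int j - int (m a) = int cox * q" by (auto simp: dvd_def)
    have "int cox * (- 1) < int cox * q"
      using exponents(1)[OF a] j by (simp flip: q)
    then have "q \<ge> 0" using cox_pos by (simp only: mult_less_cancel_left) auto
    then have "weight (a, nat q) = j"
      using q by (simp add: weight_def mult.commute flip: of_nat_eq_iff[where ?'a = int])
    then show "a \<in> fst ` ?V" using a by (force simp: in_E_plus)
  qed
  have "(\<Sum>v\<in>?V. ?c (fst v)) = (\<Sum>a\<in>fst ` ?V. ?c a)"
    using inj by (simp add: sum.reindex)
  also have "\<dots> = (\<Sum>a=1..N. if int cox dvd int j - int (m a) then ?c a else 0)"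
    unfolding image by (rule sum.inter_filter) simp
  also have "\<dots> = (\<Sum>a=1..N. ?c a / of_nat cox * (\<Sum>k<cox. (eta powi (int j - int (m a))) ^ k))"
    unfolding sum_eta_powi using cox_pos by (intro sum.cong refl) auto
  also have "\<dots> = (\<Sum>a=1..N. \<Sum>k<cox. ?c a / of_nat cox * (eta powi (int j - int (m a))) ^ k)"
    by (simp only: sum_distrib_left)
  also have "\<dots> = (\<Sum>k<cox. \<Sum>a=1..N. ?c a / of_nat cox * (eta powi (int j - int (m a))) ^ k)"
    by (rule sum.swap)
  also have "\<dots> = (\<Sum>k<cox. dual_form form \<hh> \<gamma> ((dual_action \<hh> M ^^ k) \<gamma>) * (eta ^ k) ^ j)"
  proof (intro sum.cong refl)
    fix k
    have "(eta powi (int j - int (m a))) ^ k = eta powi (- int (k * m a)) * (eta ^ k) ^ j" for a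
    proof -
      have "(eta powi (int j - int (m a))) ^ k = eta powi (- int (k * m a) + int (k * j))"
        by (simp add: power_int_power' algebra_simps)
      also have "\<dots> = eta powi (- int (k * m a)) * eta powi int (k * j)"
        by (rule power_int_add) simp
      finally show ?thesis by (simp only: power_int_of_nat power_mult)
    qed
    then show "(\<Sum>a=1..N. ?c a / of_nat cox * (eta powi (int j - int (m a))) ^ k) =
        dual_form form \<hh> \<gamma> ((dual_action \<hh> M ^^ k) \<gamma>) * (eta ^ k) ^ j"
      unfolding dual_form_expansion[OF \<gamma> dual_action_pow_dual[OF \<gamma>]] sum_divide_distrib sum_distrib_right
      by (intro sum.cong refl) (simp only: dual_action_pow_H[OF \<gamma>], simp)
  qed
  finally show ?thesis .
qed

end

context principal_realization
begin

text \<open>The constant factor between the current of \<open>x\<close> and the vertex operator, see \<open>wave_eq_Gam\<close>.\<close>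

definition vacuum_value :: "'g \<Rightarrow> complex" where
  "vacuum_value x = Poly_Mapping.lookup (\<rho> (average x 0) 1) 0"

lemma wave_eq_Gam:
  assumes "\<gamma> \<in> dual_space \<hh>" "\<gamma> \<noteq> (\<lambda>_. 0)" "x \<in> root_space \<hh> \<gamma>" "(M ^^ cox) x = x" "p \<in> fock_space N"
  shows "\<rho> (average x (- n)) p = pscale (vacuum_value x) (Gam \<gamma> n p)"
  using vertex_family_unique[OF wave_vertex_family[OF assms(1-4)] Gam_vertex_family const_coeff_Gam_0 assms(5), of n]
  by (simp add: vacuum_value_def)

text \<open>The two-point function satisfies the hypotheses of \<open>slope_eq_product\<close> with slope
  \<open>(x | y) / h\<^sup>2\<close> and exponents \<open>(\<gamma> | M\<^sup>k \<gamma>)\<close>.\<close>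

theorem vacuum_value_product:
  assumes \<gamma>: "\<gamma> \<in> dual_space \<hh>" "\<gamma> \<noteq> (\<lambda>_. 0)" and norm: "dual_form form \<hh> \<gamma> \<gamma> = 2"
    and free: "inj_on (\<lambda>k. (dual_action \<hh> M ^^ k) \<gamma>) {..<cox}"
    and x: "x \<in> root_space \<hh> \<gamma>" "(M ^^ cox) x = x"
    and y: "y \<in> root_space \<hh> (\<lambda>z. - \<gamma> z)" "(M ^^ cox) y = y"
  shows "vacuum_value x * vacuum_value y *
      (\<Prod>k=1..cox-1. (1 - eta ^ k) powr (- dual_form form \<hh> \<gamma> ((dual_action \<hh> M ^^ k) \<gamma>))) =
    form x y / of_nat cox ^ 2"
proof -
  have \<gamma>': "(\<lambda>z. - \<gamma> z) \<in> dual_space \<hh>" "(\<lambda>z. - \<gamma> z) \<noteq> (\<lambda>_. 0)"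
    using \<gamma> dual_uminus by (auto simp: fun_eq_iff)
  note X = wave_vertex_family[OF \<gamma> x] and Y = wave_vertex_family[OF \<gamma>' y]
  define F where "F = (\<lambda>k. Poly_Mapping.lookup (\<rho> (average x (int k)) (\<rho> (average y (- int k)) 1)) 0)"
  have rec: "of_nat k * F k = (\<Sum>j=1..k. (\<Sum>v | v \<in> E_plus N \<and> weight v = j.
      \<gamma> (H (fst v)) * \<gamma> (H (N + 1 - fst v))) * F (k - j))" for k
  proof -
    have "of_nat k * F k = (\<Sum>j=1..k. - (\<Sum>v | v \<in> E_plus N \<and> weight v = j.
        of_nat j * - \<gamma> (H (fst v)) * (\<gamma> (H (N + 1 - fst v)) / of_nat (weight v))) * F (k - j))"
      using two_point_recursion[OF X Y, of k] by (simp add: F_def)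
    also have "\<dots> = (\<Sum>j=1..k. (\<Sum>v | v \<in> E_plus N \<and> weight v = j.
        \<gamma> (H (fst v)) * \<gamma> (H (N + 1 - fst v))) * F (k - j))"
      unfolding sum_negf[symmetric]
      by (intro sum.cong refl arg_cong2[where f = "(*)"]) auto
    finally show ?thesis .
  qed
  obtain per :: "nat \<Rightarrow> complex" where per: "\<And>k. per (k + cox) = per k"
    "\<And>k. 0 < k \<Longrightarrow> F k = per k + of_nat k * (form x y / of_nat cox ^ 2)"
    unfolding F_def using two_point_linear_plus_periodic[OF \<gamma> free x y] by blast
  have "\<rho> (average y 0) 1 = pscale (vacuum_value y) 1"
    using wave_eq_Gam[OF \<gamma>' y fock_space_one, of 0] by (simp add: Gam_vacuum)
  then have "\<rho> (average x 0) (\<rho> (average y 0) 1) = pscale (vacuum_value y) (\<rho> (average x 0) 1)"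
    by (simp only: rho_scale[OF average_invariant[OF x(2)] fock_space_one])
  then have "F 0 = vacuum_value x * vacuum_value y"
    by (simp add: F_def vacuum_value_def[of x])
  moreover have "form x y / of_nat cox ^ 2 = F 0 *
      (\<Prod>k=1..cox-1. (1 - eta ^ k) powr (- dual_form form \<hh> \<gamma> ((dual_action \<hh> M ^^ k) \<gamma>)))"
  proof (rule slope_eq_product[OF cox_pos _ _ rec])
    show "norm eta = 1" by (simp add: eta_def)
    show "eta ^ k \<noteq> 1" if "0 < k" "k < cox" for k
      using that by (simp add: eta_pow_eq_1_iff nat_dvd_not_less)
  qed (use norm weight_sum_eq[OF \<gamma>(1)] per in auto)
  ultimately show ?thesis by simp
qed

lemma representative:
  assumes "i \<in> {1..N}"
  shows "\<alpha> i \<in> roots \<hh>" "inj_on (\<lambda>k. (dual_action \<hh> M ^^ k) (\<alpha> i)) {..<cox}"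
proof -
  have "(i, 0) \<in> {1..N} \<times> {..<cox}" using assms cox_pos by simp
  from bij_betwE[OF orbits, rule_format, OF this] show "\<alpha> i \<in> roots \<hh>" by simp
  show "inj_on (\<lambda>k. (dual_action \<hh> M ^^ k) (\<alpha> i)) {..<cox}"
  proof (rule inj_onI)
    fix k l assume "k \<in> {..<cox}" "l \<in> {..<cox}"
      "(dual_action \<hh> M ^^ k) (\<alpha> i) = (dual_action \<hh> M ^^ l) (\<alpha> i)"
    then show "k = l"
      using inj_onD[OF bij_betw_imp_inj_on[OF orbits], of "(i, k)" "(i, l)"] assms by simp
  qed
qed

text \<open>Uniqueness of the coefficient is tested on the vacuum, where the tensor product of the vertex
  operators has the coefficient \<open>1 \<otimes> 1\<close> of \<open>\<zeta>\<^sup>0\<close>.\<close>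

theorem kac_wakimoto_coeff_iff:
  assumes i: "i \<in> {1..N}"
  shows "kac_wakimoto_coeff \<rho> i a \<longleftrightarrow>
    a = 1 / of_nat cox * (\<Prod>k=1..cox-1. (1 - eta ^ k) powr dual_form form \<hh> (\<alpha> i) ((dual_action \<hh> M ^^ k) (\<alpha> i)))"
proof -
  let ?\<gamma> = "\<alpha> i" and ?\<gamma>' = "\<lambda>z. - \<alpha> i z"
  let ?A = "Av ?\<gamma>" and ?A' = "Av ?\<gamma>'"
  let ?e = "\<lambda>k. dual_form form \<hh> ?\<gamma> ((dual_action \<hh> M ^^ k) ?\<gamma>)"
  define P where "P = (\<Prod>k=1..cox-1. (1 - eta ^ k) powr (- ?e k))"
  define K where "K = of_nat cox / form ?A ?A'"
  note root = representative(1)[OF i] and free = representative(2)[OF i]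
  note root' = root_opposite[OF root]
  have \<gamma>: "?\<gamma> \<in> dual_space \<hh>" "?\<gamma> \<noteq> (\<lambda>_. 0)" and \<gamma>': "?\<gamma>' \<in> dual_space \<hh>" "?\<gamma>' \<noteq> (\<lambda>_. 0)"
    using root root' by (auto simp: roots_def)
  have A: "?A \<in> root_space \<hh> ?\<gamma>" "?A \<noteq> 0" "(M ^^ cox) ?A = ?A"
    and A': "?A' \<in> root_space \<hh> ?\<gamma>'" "?A' \<noteq> 0" "(M ^^ cox) ?A' = ?A'"
    using Av_root[OF root] Av_root[OF root'] Av_fixed[OF root] Av_fixed[OF root'] by auto
  have product: "vacuum_value x * vacuum_value y * P = form x y / of_nat cox ^ 2"
    if "x \<in> root_space \<hh> ?\<gamma>" "(M ^^ cox) x = x" "y \<in> root_space \<hh> ?\<gamma>'" "(M ^^ cox) y = y" for x y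
    unfolding P_def by (rule vacuum_value_product[OF \<gamma> normalized[OF root] free that])
  \<comment> \<open>If the product vanished, so would one of the two vacuum values; pairing the vector in question with another vector of the opposite root space excludes this.\<close>
  have nonzero: "form ?A ?A' \<noteq> 0"
  proof
    assume "form ?A ?A' = 0"
    obtain y where y: "y \<in> root_space \<hh> ?\<gamma>'" "(M ^^ cox) y = y" "form ?A y \<noteq> 0"
      using fixed_opposite_root_vector[OF \<gamma> A] .
    have "vacuum_value ?A * vacuum_value y * P \<noteq> 0"
      unfolding product[OF A(1,3) y(1,2)] using y(3) cox_pos by simp
    then have "vacuum_value ?A \<noteq> 0" "P \<noteq> 0" by auto
    obtain x where x: "x \<in> root_space \<hh> (\<lambda>z. - ?\<gamma>' z)" "(M ^^ cox) x = x" "form ?A' x \<noteq> 0"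
      using fixed_opposite_root_vector[OF \<gamma>' A'] .
    have "x \<in> root_space \<hh> ?\<gamma>" using x(1) by (simp only: minus_minus)
    have "vacuum_value x * vacuum_value ?A' * P \<noteq> 0"
      unfolding product[OF \<open>x \<in> root_space \<hh> ?\<gamma>\<close> x(2) A'(1,3)]
      using x(3) cox_pos by (simp add: form_sym)
    then have "vacuum_value ?A' \<noteq> 0" by auto
    then show False
      using product[OF A(1,3) A'(1,3)] \<open>form ?A ?A' = 0\<close> \<open>vacuum_value ?A \<noteq> 0\<close> \<open>P \<noteq> 0\<close>
      by (simp only: mult_eq_0_iff div_0) simp
  qed
  have tensor_eq: "pscale K (series_tensor (x_series \<rho> ?\<gamma>) (x_series \<rho> ?\<gamma>') n p q) =
      pscale (K * (vacuum_value ?A * vacuum_value ?A')) (series_tensor (Gam ?\<gamma>) (Gam ?\<gamma>') n p q)"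
    if "p \<in> fock_space N" "q \<in> fock_space N" for n p q
    unfolding series_tensor_def x_series_def wave_eq_Gam[OF \<gamma> A(1,3) that(1)]
      wave_eq_Gam[OF \<gamma>' A'(1,3) that(2)] tensor_pscale Sum_any_pscale
    by simp
  have "kac_wakimoto_coeff \<rho> i a \<longleftrightarrow> a = K * (vacuum_value ?A * vacuum_value ?A')"
  proof
    assume "kac_wakimoto_coeff \<rho> i a"
    then have "pscale K (series_tensor (x_series \<rho> ?\<gamma>) (x_series \<rho> ?\<gamma>') 0 1 1) =
        pscale a (series_tensor (Gam ?\<gamma>) (Gam ?\<gamma>') 0 1 1)"
      unfolding kac_wakimoto_coeff_def K_def using fock_space_one by blast
    then have "pscale (K * (vacuum_value ?A * vacuum_value ?A')) (series_tensor (Gam ?\<gamma>) (Gam ?\<gamma>') 0 1 1) =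
        pscale a (series_tensor (Gam ?\<gamma>) (Gam ?\<gamma>') 0 1 1)"
      by (simp only: tensor_eq[OF fock_space_one fock_space_one])
    from arg_cong[of _ _ "\<lambda>f. Poly_Mapping.lookup f (0, 0)", OF this[unfolded series_tensor_Gam_vacuum]]
    have "K * (vacuum_value ?A * vacuum_value ?A') = a" by (simp add: lookup_tensor)
    then show "a = K * (vacuum_value ?A * vacuum_value ?A')" by (rule sym)
  next
    assume a: "a = K * (vacuum_value ?A * vacuum_value ?A')"
    then show "kac_wakimoto_coeff \<rho> i a"
      unfolding kac_wakimoto_coeff_def K_def[symmetric] a by (intro allI ballI tensor_eq)
  qed
  also have "K * (vacuum_value ?A * vacuum_value ?A') = 1 / of_nat cox * inverse P"
  proof -
    have "vacuum_value ?A * vacuum_value ?A' * P = form ?A ?A' / of_nat cox ^ 2"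
      by (rule product[OF A(1,3) A'(1,3)])
    then have "P \<noteq> 0" using nonzero cox_pos by auto
    then have "vacuum_value ?A * vacuum_value ?A' = form ?A ?A' / of_nat cox ^ 2 * inverse P"
      unfolding product[OF A(1,3) A'(1,3), symmetric] by (simp add: mult.assoc)
    then show ?thesis using nonzero cox_pos by (simp add: K_def power2_eq_square)
  qed
  also have "inverse P = (\<Prod>k=1..cox-1. (1 - eta ^ k) powr ?e k)"
    unfolding P_def by (simp add: powr_minus flip: prod_inversef)
  finally show ?thesis .
qed

end

theorem corollary4:
  fixes scale :: "complex \<Rightarrow> 'g::ab_group_add \<Rightarrow> 'g"
    and bracket :: "'g \<Rightarrow> 'g \<Rightarrow> 'g"
    and X :: ade and N :: nat and \<hh> :: "'g set"
    and form :: "'g \<Rightarrow> 'g \<Rightarrow> complex"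
    and M :: "'g \<Rightarrow> 'g" and m :: "nat \<Rightarrow> nat"
    and \<alpha> :: "nat \<Rightarrow> 'g \<Rightarrow> complex" and H :: "nat \<Rightarrow> 'g"
    and Av :: "('g \<Rightarrow> complex) \<Rightarrow> 'g"
    and \<rho> :: "'g affine \<Rightarrow> fock \<Rightarrow> fock"
    and i :: nat and a :: complex
  assumes "principal_realization scale bracket X N \<hh> form M m \<alpha> H Av \<rho>"
    and "i \<in> {1..N}"
  shows "coxeter_setup.kac_wakimoto_coeff scale N \<hh> form M m \<alpha> H Av \<rho> i a \<longleftrightarrow>
    (let h = order_on \<hh> M; \<eta> = cis (2 * pi / of_nat h) in
      a = 1 / of_nat h *
        (\<Prod>k=1..h-1. (1 - \<eta> ^ k) powr dual_form form \<hh> (\<alpha> i) ((dual_action \<hh> M ^^ k) (\<alpha> i))))"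
proof -
  interpret principal_realization scale bracket X N \<hh> form M m \<alpha> H Av \<rho> by fact
  show ?thesis
    unfolding Let_def using kac_wakimoto_coeff_iff[OF assms(2)] by (simp only: eta_def)
qed

end
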